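(* There is a constant $C>0$, independent of $\Delta t$, $T$, $N$, $\lambda$ and of the solutions, such that the following holds. Let $\lambda>0$, let $N\ge1$ be an integer, $\Delta t>0$ and $T=N\Delta t$. Let $\boldsymbol{\mathcal U},\mathcal P,\sigma_{\mathcal F},\boldsymbol{\mathcal E},\sigma_{\mathcal S}$ solve the exact coupled fluid-structure problem on $(0,T)$ and, for $0\le n\le N-1$, let $\boldsymbol u^{n+1},\sigma_f^{n+1},p^{n+1}$ solve the fluid sub-problem (F) and $\boldsymbol\eta^{n+1},\dot{\boldsymbol\eta}^{n+1}$ solve the solid sub-problem (S) of the splitting method (all specified in the context, with the standing regularity assumptions). Assume in addition that $\partial_t\boldsymbol{\mathcal U}\in L^2(0,T;L^2(\Sigma))$ and $\partial_t\sigma_{\mathcal F}\boldsymbol n\in L^2(0,T;L^2(\Sigma))$. On $[t_{n-1},t_n]$, $1\le n\le N$, set $$\boldsymbol e_u^n=\boldsymbol{\mathcal U}-\boldsymbol u^n,\quad e_f^n=\sigma_{\mathcal F}-\sigma_f^n,\quad \boldsymbol e_\eta^n=\boldsymbol{\mathcal E}-\boldsymbol\eta^n,\quad \dot{\boldsymbol e}_\eta^n=\partial_t\boldsymbol{\mathcal E}-\dot{\boldsymbol\eta}^n,$$ and let $\tilde{\boldsymbol e}_u^{n}(x)=\frac1{\Delta t}\int_{t_{n-1}}^{t_n}\boldsymbol e_u^n(x,s)\,ds$ for $n\ge1$ and $\tilde{\boldsymbol e}_u^0=\boldsymbol{\mathcal U}(t_0)-\boldsymbol u^0(t_0)=0$.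 Define, with $\|\cdot\|_S$ as in the context, $$\mathbb E^N:=\frac{\rho_f}{2}\|\boldsymbol e_u^N(t_N)\|^2_{L^2(\Omega_f)}+\frac{\rho_s}{2}\|\dot{\boldsymbol e}_\eta^N(t_N)\|^2_{L^2(\Omega_s)}+\frac12\|\boldsymbol e_\eta^N(t_N)\|_S^2,$$ $$\mathbb T^n:=2\mu\int_{t_{n-1}}^{t_n}\|\varepsilon(\boldsymbol e_u^n(s))\|^2_{L^2(\Omega_f)}\,ds+\frac{\lambda}{4}\int_{t_{n-1}}^{t_n}\|\dot{\boldsymbol e}_\eta^n(s)-\tilde{\boldsymbol e}_u^{n-1}\|^2_{L^2(\Sigma)}\,ds\qquad(1\le n\le N),$$ $$\mathbb S^N:=\frac1{2\lambda}\int_{t_{N-1}}^{t_N}\|e_f^N(s)\boldsymbol n\|^2_{L^2(\Sigma)}\,ds+\frac{\lambda}{2}\int_{t_{N-1}}^{t_N}\|\boldsymbol e_u^N(s)\|^2_{L^2(\Sigma)}\,ds.$$ Then $$\mathbb E^N+\sum_{n=1}^N\mathbb T^n+\mathbb S^N\le C\,\Delta t\,T\left(\lambda\|\partial_t\boldsymbol{\mathcal U}\|^2_{L^2(0,T;L^2(\Sigma))}+\frac1\lambda\|\partial_t\sigma_{\mathcal F}\boldsymbol n\|^2_{L^2(0,T;L^2(\Sigma))}\right).$$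
   Context: Domains. $\Omega_s$ (solid) and $\Omega_f$ (fluid) are two spatial domains with matching interface $\Sigma=\partial\Omega_s\cap\partial\Omega_f$; $\Sigma_i=\partial\Omega_i\setminus\Sigma$ for $i=s,f$. $\boldsymbol n$ and $\boldsymbol n_s$ are the outward unit normals of $\Omega_f$ and $\Omega_s$, respectively (so $\boldsymbol n_s=-\boldsymbol n$ on $\Sigma$). Constants: densities $\rho_f,\rho_s>0$, viscosity $\mu>0$, Lamé constants $L_1>0$, $L_2\ge 0$. $\varepsilon(\cdot)$ is the symmetric gradient, $\mathbf I$ the identity matrix. $\|\boldsymbol w\|_S^2:=2L_1\|\varepsilon(\boldsymbol w)\|^2_{L^2(\Omega_s)}+L_2\|\mathrm{div}\,\boldsymbol w\|^2_{L^2(\Omega_s)}$. For a Hilbert space $X$, $\|v\|^2_{L^2(r_1,r_2;X)}=\int_{r_1}^{r_2}\|v(s)\|_X^2\,ds$. Exact coupled problem. The fluid velocity $\boldsymbol{\mathcal U}$, fluid pressure $\mathcal P$ and solid displacement $\boldsymbol{\mathcal E}$, with stresses $\sigma_{\mathcal F}=2\mu\,\varepsilon(\boldsymbol{\mathcal U})-\mathcal P\,\mathbf I$ and $\sigma_{\mathcal S}=2L_1\varepsilon(\boldsymbol{\mathcal E})+L_2(\mathrm{div}\,\boldsymbol{\mathcal E})\mathbf I$, satisfy $\rho_f\partial_t\boldsymbol{\mathcal U}-\mathrm{div}\,\sigma_{\mathcal F}=0$ and $\mathrm{div}\,\boldsymbol{\mathcal U}=0$ in $\Omega_f\times(0,T)$,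 $\boldsymbol{\mathcal U}=0$ on $\Sigma_f\times(0,T)$; $\rho_s\partial_{tt}\boldsymbol{\mathcal E}-\mathrm{div}\,\sigma_{\mathcal S}=0$ in $\Omega_s\times(0,T)$, $\boldsymbol{\mathcal E}=0$ on $\Sigma_s\times(0,T)$; and on $\Sigma$: $\boldsymbol{\mathcal U}=\partial_t\boldsymbol{\mathcal E}$, $\sigma_{\mathcal S}\boldsymbol n_s+\sigma_{\mathcal F}\boldsymbol n=0$. Splitting method. $t_n=n\Delta t$, $T=N\Delta t$. Initialization: $\boldsymbol\eta^0(\cdot,t_0)=\boldsymbol{\mathcal E}(\cdot,t_0)$, $\dot{\boldsymbol\eta}^0(\cdot,t_0)=\partial_t\boldsymbol{\mathcal E}(\cdot,t_0)$, $\boldsymbol u^0(\cdot,t_0)=\boldsymbol{\mathcal U}(\cdot,t_0)$, $\tilde{\boldsymbol u}^0=\boldsymbol u^0(\cdot,t_0)$, $\tilde\sigma_f^0=\sigma_{\mathcal F}(\cdot,t_0)$ (the initial pressure $\mathcal P(\cdot,t_0)$ is assumed known exactly). For $n\ge 1$: $\tilde{\boldsymbol u}^n(x)=\frac1{\Delta t}\int_{t_{n-1}}^{t_n}\boldsymbol u^n(x,s)\,ds$ and $\tilde\sigma_f^n(x)=\frac1{\Delta t}\int_{t_{n-1}}^{t_n}\sigma_f^n(x,s)\,ds$. For $n=0,\dots,N-1$ one solves successively: (S) Solid sub-problem on $[t_n,t_{n+1}]$: $\rho_s\partial_t\dot{\boldsymbol\eta}^{n+1}-\mathrm{div}\,\sigma_s^{n+1}=0$,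 $\dot{\boldsymbol\eta}^{n+1}=\partial_t\boldsymbol\eta^{n+1}$, $\sigma_s^{n+1}=2L_1\varepsilon(\boldsymbol\eta^{n+1})+L_2(\mathrm{div}\,\boldsymbol\eta^{n+1})\mathbf I$ in $\Omega_s\times[t_n,t_{n+1}]$; $\boldsymbol\eta^{n+1}=0$ on $\Sigma_s\times[t_n,t_{n+1}]$; $\lambda\dot{\boldsymbol\eta}^{n+1}+\sigma_s^{n+1}\boldsymbol n_s=\lambda\tilde{\boldsymbol u}^n-\tilde\sigma_f^n\boldsymbol n$ on $\Sigma\times[t_n,t_{n+1}]$; $\boldsymbol\eta^{n+1}(\cdot,t_n)=\boldsymbol\eta^n(\cdot,t_n)$, $\dot{\boldsymbol\eta}^{n+1}(\cdot,t_n)=\dot{\boldsymbol\eta}^n(\cdot,t_n)$ on $\Omega_s$. (F) Fluid sub-problem on $[t_n,t_{n+1}]$: $\rho_f\partial_t\boldsymbol u^{n+1}-\mathrm{div}\,\sigma_f^{n+1}=0$, $\sigma_f^{n+1}=2\mu\,\varepsilon(\boldsymbol u^{n+1})-p^{n+1}\mathbf I$, $\mathrm{div}\,\boldsymbol u^{n+1}=0$ in $\Omega_f\times[t_n,t_{n+1}]$; $\boldsymbol u^{n+1}=0$ on $\Sigma_f\times[t_n,t_{n+1}]$; $\lambda\boldsymbol u^{n+1}+\sigma_f^{n+1}\boldsymbol n=\lambda\dot{\boldsymbol\eta}^{n+1}+\tilde\sigma_f^n\boldsymbol n$ on $\Sigma\times[t_n,t_{n+1}]$; $\boldsymbol u^{n+1}(\cdot,t_n)=\boldsymbol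 u^n(\cdot,t_n)$ on $\Omega_f$. Standing regularity assumption. The sub-problems (S) and (F) are assumed well posed, with solutions regular enough that $\sigma_f^{n+1}\boldsymbol n$, $\sigma_s^{n+1}\boldsymbol n$, $\boldsymbol u^{n+1}$, $\dot{\boldsymbol\eta}^{n+1}$ all belong to $L^2(t_n,t_{n+1};L^2(\Sigma))$, and the corresponding traces of the exact solution belong to $L^2(0,T;L^2(\Sigma))$; domains, exact solution and sub-problem solutions are understood to be regular enough that the differential equations for the errors can be multiplied by the respective velocity errors and integrated by parts in space in the usual way, with the kinetic and elastic energies of the errors absolutely continuous in time on each $[t_n,t_{n+1}]$. *)

theory Defs
  imports "HOL-Analysis.Analysis"
begin

section \<open>Surface measure, domains and normals\<close>

text \<open>Points and vectors live in \<open>real ^ 'd\<close>, matrices in \<open>real ^ 'd ^ 'd\<close>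
  (so that \<open>norm\<close> and \<open>inner\<close> on matrices are the Frobenius norm and product).\<close>

text \<open>\<open>k\<close>-dimensional Hausdorff outer measure, normalised so as to agree with the usual
  \<open>k\<close>-dimensional area. Empty pieces are excluded because \<open>0 ^ 0 = 1\<close>.\<close>

definition hausdorff_outer :: "nat \<Rightarrow> 'a::metric_space set \<Rightarrow> ennreal" where
  "hausdorff_outer k A =
     (SUP \<delta>\<in>{0<..}. INF B\<in>{B :: nat \<Rightarrow> 'a set. A \<subseteq> (\<Union>i. B i) \<and> (\<forall>i. bounded (B i) \<and> diameter (B i) \<le> \<delta>)}.
        \<Sum>i. if B i = {} then 0 else ennreal (unit_ball_vol (real k) * (diameter (B i) / 2) ^ k))"

text \<open>A metric outer measure is countably additive on Borel sets, so \<open>measure_of\<close> does not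
  degenerate here.\<close>

definition area_measure :: "(real ^ 'd::finite) measure" where
  "area_measure = measure_of UNIV (sets borel) (hausdorff_outer (CARD('d) - 1))"

definition surf :: "(real ^ 'd::finite) set \<Rightarrow> (real ^ 'd) measure" where
  "surf S = restrict_space area_measure S"

definition vol :: "(real ^ 'd::finite) set \<Rightarrow> (real ^ 'd) measure" where
  "vol Om = restrict_space lborel Om"

text \<open>Bounded (strongly) Lipschitz domain: near each boundary point the set is the strict subgraph
  of a Lipschitz function in some direction \<open>\<nu>\<close>. Finiteness of the boundary area is a consequence
  of the other clauses, recorded for convenience.\<close>

definition lipschitz_domain :: "(real ^ 'd::finite) set \<Rightarrow> bool" where
  "lipschitz_domain Om \<longleftrightarrow> open Om \<and> bounded Om \<and>
     (\<forall>x\<in>frontier Om. \<exists>\<nu> (g :: real ^ 'd \<Rightarrow> real) L r. norm \<nu> = 1 \<and> lipschitz_on L UNIV g \<and> r > 0 \<and>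
        Om \<inter> ball x r = {y \<in> ball x r. y \<bullet> \<nu> < g (y - (y \<bullet> \<nu>) *\<^sub>R \<nu>)}) \<and>
     emeasure (surf (frontier Om)) (frontier Om) < \<infinity>"

text \<open>\<open>\<nu>\<close> is the outward unit normal of \<open>Om\<close> at \<open>x\<close>: up to cones of arbitrarily small opening
  around the tangent plane, \<open>Om\<close> fills exactly the half space \<open>(y - x) \<bullet> \<nu> < 0\<close> near \<open>x\<close>.
  On a Lipschitz domain such a normal exists at almost every boundary point.\<close>

definition outward_unit_normal :: "(real ^ 'd::finite) set \<Rightarrow> real ^ 'd \<Rightarrow> real ^ 'd \<Rightarrow> bool" where
  "outward_unit_normal Om x \<nu> \<longleftrightarrow> norm \<nu> = 1 \<and>
     (\<forall>\<epsilon>>0. \<exists>\<delta>>0. \<forall>y. 0 < dist y x \<and> dist y x < \<delta> \<longrightarrow>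
        ((y - x) \<bullet> \<nu> \<le> - \<epsilon> * dist y x \<longrightarrow> y \<in> Om) \<and>
        ((y - x) \<bullet> \<nu> \<ge> \<epsilon> * dist y x \<longrightarrow> y \<notin> closure Om))"

definition normal_field :: "(real ^ 'd::finite) set \<Rightarrow> (real ^ 'd \<Rightarrow> real ^ 'd) \<Rightarrow> bool" where
  "normal_field Om n \<longleftrightarrow> n \<in> borel_measurable borel \<and>
     (AE x in surf (frontier Om). outward_unit_normal Om x (n x))"

definition interface :: "(real ^ 'd::finite) set \<Rightarrow> (real ^ 'd) set \<Rightarrow> (real ^ 'd) set" where
  "interface Oms Omf = frontier Oms \<inter> frontier Omf"

definition fsi_geometry ::
    "(real ^ 'd::finite) set \<Rightarrow> (real ^ 'd) set \<Rightarrow> (real ^ 'd \<Rightarrow> real ^ 'd) \<Rightarrow> (real ^ 'd \<Rightarrow> real ^ 'd) \<Rightarrow> bool" where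
  "fsi_geometry Oms Omf ns nf \<longleftrightarrow> lipschitz_domain Oms \<and> lipschitz_domain Omf \<and> Oms \<inter> Omf = {} \<and>
     normal_field Oms ns \<and> normal_field Omf nf"


section \<open>Function spaces\<close>

text \<open>Time dependent fields are represented by functions \<open>f t x\<close>, defined pointwise. Equations
  between fields are required almost everywhere.\<close>

definition sq_integrable :: "'a measure \<Rightarrow> ('a \<Rightarrow> 'b::euclidean_space) \<Rightarrow> bool" where
  "sq_integrable M f \<longleftrightarrow> f \<in> borel_measurable M \<and> integrable M (\<lambda>x. (norm (f x))\<^sup>2)"

definition L2sq :: "'a measure \<Rightarrow> ('a \<Rightarrow> 'b::euclidean_space) \<Rightarrow> real" where
  "L2sq M f = (\<integral>x. (norm (f x))\<^sup>2 \<partial>M)"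

definition ae_time :: "real \<Rightarrow> real \<Rightarrow> (real \<Rightarrow> bool) \<Rightarrow> bool" where
  "ae_time a b P \<longleftrightarrow> (AE t in restrict_space lborel {a..b}. P t)"

text \<open>\<open>L\<^sup>2(a,b; L\<^sup>2(M))\<close>, as jointly measurable functions.\<close>

definition L2L2 :: "real \<Rightarrow> real \<Rightarrow> 'a measure \<Rightarrow> (real \<Rightarrow> 'a \<Rightarrow> 'b::euclidean_space) \<Rightarrow> bool" where
  "L2L2 a b M f \<longleftrightarrow> sq_integrable (restrict_space lborel {a..b} \<Otimes>\<^sub>M M) (\<lambda>(t, x). f t x)"

text \<open>\<open>C([a,b]; L\<^sup>2(M))\<close>\<close>

definition CL2 :: "real \<Rightarrow> real \<Rightarrow> 'a measure \<Rightarrow> (real \<Rightarrow> 'a \<Rightarrow> 'b::euclidean_space) \<Rightarrow> bool" where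
  "CL2 a b M f \<longleftrightarrow> L2L2 a b M f \<and>
     (\<forall>t\<in>{a..b}. sq_integrable M (f t) \<and>
        ((\<lambda>s. L2sq M (\<lambda>x. f s x - f t x)) \<longlongrightarrow> 0) (at t within {a..b}))"

text \<open>\<open>\<partial>\<^sub>t f = g\<close> with \<open>g \<in> L\<^sup>2(a,b; L\<^sup>2(M))\<close>; the values \<open>f t\<close> are those of the absolutely
  continuous representative, for every \<open>t \<in> [a,b]\<close>.\<close>

definition has_time_derivative ::
    "real \<Rightarrow> real \<Rightarrow> 'a measure \<Rightarrow> (real \<Rightarrow> 'a \<Rightarrow> 'b::euclidean_space) \<Rightarrow> (real \<Rightarrow> 'a \<Rightarrow> 'b) \<Rightarrow> bool" where
  "has_time_derivative a b M f g \<longleftrightarrow> L2L2 a b M g \<and>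
     (\<forall>s t. a \<le> s \<and> s \<le> t \<and> t \<le> b \<longrightarrow>
        (AE x in M. f t x - f s x = (LINT r:{s..t}|lborel. g r x)))"

text \<open>\<open>w \<in> H\<^sup>1(Om)\<close> with weak gradient \<open>G\<close> (\<open>G $ i $ j = \<partial>\<^sub>j w\<^sub>i\<close>), where the values of \<open>w\<close> on
  \<open>frontier Om\<close> are its trace. Both are characterised by Green's formula: test functions supported
  in \<open>Om\<close> give the weak gradient, the remaining ones the trace. Here \<open>\<phi>'\<close> is the gradient of \<open>\<phi>\<close>.\<close>

definition H1_with_trace ::
    "(real ^ 'd::finite) set \<Rightarrow> (real ^ 'd \<Rightarrow> real ^ 'd) \<Rightarrow> (real ^ 'd \<Rightarrow> real ^ 'd) \<Rightarrow> (real ^ 'd \<Rightarrow> real ^ 'd ^ 'd) \<Rightarrow> bool" where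
  "H1_with_trace Om n w G \<longleftrightarrow>
     sq_integrable (vol Om) w \<and> sq_integrable (vol Om) G \<and> sq_integrable (surf (frontier Om)) w \<and>
     (\<forall>(\<phi> :: real ^ 'd \<Rightarrow> real) \<phi>'.
        (\<forall>x. (\<phi> has_derivative (\<lambda>h. \<phi>' x \<bullet> h)) (at x)) \<and> continuous_on UNIV \<phi>' \<and> bounded {x. \<phi> x \<noteq> 0} \<longrightarrow>
        (\<forall>i j. (\<integral>x. w x $ i * \<phi>' x $ j \<partial>vol Om) + (\<integral>x. G x $ i $ j * \<phi> x \<partial>vol Om)
               = (\<integral>x. w x $ i * \<phi> x * n x $ j \<partial>surf (frontier Om))))"


section \<open>The fluid and the solid equations\<close>

text \<open>Symmetric gradient and divergence, as functions of the gradient.\<close>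

definition sym_part :: "real ^ 'd::finite ^ 'd \<Rightarrow> real ^ 'd ^ 'd" where
  "sym_part G = (1/2) *\<^sub>R (G + transpose G)"

definition divergence :: "real ^ 'd::finite ^ 'd \<Rightarrow> real" where
  "divergence G = trace G"

definition newton_stress :: "real \<Rightarrow> real ^ 'd::finite ^ 'd \<Rightarrow> real \<Rightarrow> real ^ 'd ^ 'd" where
  "newton_stress \<mu> G p = (2 * \<mu>) *\<^sub>R sym_part G - p *\<^sub>R mat 1"

definition elastic_stress :: "real \<Rightarrow> real \<Rightarrow> real ^ 'd::finite ^ 'd \<Rightarrow> real ^ 'd ^ 'd" where
  "elastic_stress L1 L2 G = (2 * L1) *\<^sub>R sym_part G + (L2 * divergence G) *\<^sub>R mat 1"

definition S_norm_sq ::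
    "real \<Rightarrow> real \<Rightarrow> (real ^ 'd::finite) set \<Rightarrow> (real ^ 'd \<Rightarrow> real ^ 'd ^ 'd) \<Rightarrow> real" where
  "S_norm_sq L1 L2 Om G =
     2 * L1 * L2sq (vol Om) (\<lambda>x. sym_part (G x)) + L2 * L2sq (vol Om) (\<lambda>x. divergence (G x))"

text \<open>Weak form of \<open>\<rho> \<partial>\<^sub>t v - div \<sigma> = 0\<close> in \<open>Om \<times> (a,b)\<close>. The test functions vanish on
  \<open>frontier Om - Sig\<close> only, so this also says that the values of \<open>\<sigma> n\<close> on \<open>Sig\<close> are the normal
  trace of the stress field. On \<open>Sig\<close> the matrix \<open>\<sigma>\<close> itself has no meaning besides \<open>\<sigma> n\<close>.\<close>

definition momentum_balance ::
    "real \<Rightarrow> (real ^ 'd::finite) set \<Rightarrow> (real ^ 'd) set \<Rightarrow> (real ^ 'd \<Rightarrow> real ^ 'd) \<Rightarrow> real \<Rightarrow> real \<Rightarrow>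
     (real \<Rightarrow> real ^ 'd \<Rightarrow> real ^ 'd) \<Rightarrow> (real \<Rightarrow> real ^ 'd \<Rightarrow> real ^ 'd ^ 'd) \<Rightarrow> bool" where
  "momentum_balance \<rho> Om Sig n a b v \<sigma> \<longleftrightarrow>
     (\<forall>\<phi> \<Phi>. H1_with_trace Om n \<phi> \<Phi> \<and> (AE x in surf (frontier Om - Sig). \<phi> x = 0) \<longrightarrow>
        (\<forall>s t. a \<le> s \<and> s \<le> t \<and> t \<le> b \<longrightarrow>
           \<rho> * (\<integral>x. v t x \<bullet> \<phi> x \<partial>vol Om) - \<rho> * (\<integral>x. v s x \<bullet> \<phi> x \<partial>vol Om) =
           (LINT r:{s..t}|lborel. (\<integral>x. (\<sigma> r x *v n x) \<bullet> \<phi> x \<partial>surf Sig) - (\<integral>x. \<sigma> r x \<bullet> \<Phi> x \<partial>vol Om))))"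

text \<open>Stokes system in \<open>Om \<times> (a,b)\<close> with \<open>u = 0\<close> on \<open>frontier Om - Sig\<close>, for solutions in the energy
  class with square integrable velocity and normal stress on \<open>Sig\<close>. \<open>Du\<close> is the gradient of \<open>u\<close>.\<close>

definition fluid_solution ::
    "real \<Rightarrow> real \<Rightarrow> (real ^ 'd::finite) set \<Rightarrow> (real ^ 'd) set \<Rightarrow> (real ^ 'd \<Rightarrow> real ^ 'd) \<Rightarrow> real \<Rightarrow> real \<Rightarrow>
     (real \<Rightarrow> real ^ 'd \<Rightarrow> real ^ 'd) \<Rightarrow> (real \<Rightarrow> real ^ 'd \<Rightarrow> real ^ 'd ^ 'd) \<Rightarrow>
     (real \<Rightarrow> real ^ 'd \<Rightarrow> real) \<Rightarrow> (real \<Rightarrow> real ^ 'd \<Rightarrow> real ^ 'd ^ 'd) \<Rightarrow> bool" where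
  "fluid_solution \<rho> \<mu> Om Sig n a b u Du p \<sigma> \<longleftrightarrow>
     CL2 a b (vol Om) u \<and> L2L2 a b (vol Om) Du \<and> L2L2 a b (vol Om) p \<and> L2L2 a b (vol Om) \<sigma> \<and>
     L2L2 a b (surf Sig) u \<and> L2L2 a b (surf Sig) (\<lambda>t x. \<sigma> t x *v n x) \<and>
     ae_time a b (\<lambda>t. H1_with_trace Om n (u t) (Du t)) \<and>
     ae_time a b (\<lambda>t. AE x in surf (frontier Om - Sig). u t x = 0) \<and>
     ae_time a b (\<lambda>t. AE x in vol Om. divergence (Du t x) = 0) \<and>
     ae_time a b (\<lambda>t. AE x in vol Om. \<sigma> t x = newton_stress \<mu> (Du t x) (p t x)) \<and>
     momentum_balance \<rho> Om Sig n a b u \<sigma>"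

text \<open>Linear elasticity in \<open>Om \<times> (a,b)\<close> with \<open>\<eta> = 0\<close> on \<open>frontier Om - Sig\<close>, for solutions
  \<open>\<eta> \<in> C([a,b]; H\<^sup>1) \<inter> C\<^sup>1([a,b]; L\<^sup>2)\<close> with square integrable velocity and normal stress on \<open>Sig\<close>.
  \<open>D\<eta>\<close> is the gradient of \<open>\<eta>\<close> and \<open>v\<close> its time derivative, both in \<open>Om\<close> and (for the traces) on
  \<open>Sig\<close>; no spatial derivative of \<open>v\<close> is required.\<close>

definition solid_solution ::
    "real \<Rightarrow> real \<Rightarrow> real \<Rightarrow> (real ^ 'd::finite) set \<Rightarrow> (real ^ 'd) set \<Rightarrow> (real ^ 'd \<Rightarrow> real ^ 'd) \<Rightarrow> real \<Rightarrow> real \<Rightarrow>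
     (real \<Rightarrow> real ^ 'd \<Rightarrow> real ^ 'd) \<Rightarrow> (real \<Rightarrow> real ^ 'd \<Rightarrow> real ^ 'd ^ 'd) \<Rightarrow>
     (real \<Rightarrow> real ^ 'd \<Rightarrow> real ^ 'd) \<Rightarrow> (real \<Rightarrow> real ^ 'd \<Rightarrow> real ^ 'd ^ 'd) \<Rightarrow> bool" where
  "solid_solution \<rho> L1 L2 Om Sig n a b \<eta> D\<eta> v \<sigma> \<longleftrightarrow>
     CL2 a b (vol Om) \<eta> \<and> CL2 a b (vol Om) D\<eta> \<and> CL2 a b (vol Om) v \<and> L2L2 a b (vol Om) \<sigma> \<and>
     L2L2 a b (surf Sig) (\<lambda>t x. \<sigma> t x *v n x) \<and>
     has_time_derivative a b (vol Om) \<eta> v \<and> has_time_derivative a b (surf Sig) \<eta> v \<and>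
     (\<forall>t\<in>{a..b}. H1_with_trace Om n (\<eta> t) (D\<eta> t)) \<and>
     (\<forall>t\<in>{a..b}. AE x in surf (frontier Om - Sig). \<eta> t x = 0) \<and>
     ae_time a b (\<lambda>t. AE x in vol Om. \<sigma> t x = elastic_stress L1 L2 (D\<eta> t x)) \<and>
     momentum_balance \<rho> Om Sig n a b v \<sigma>"


section \<open>The coupled problem and the splitting method\<close>

definition coupled_solution ::
    "real \<Rightarrow> real \<Rightarrow> real \<Rightarrow> real \<Rightarrow> real \<Rightarrow>
     (real ^ 'd::finite) set \<Rightarrow> (real ^ 'd) set \<Rightarrow> (real ^ 'd \<Rightarrow> real ^ 'd) \<Rightarrow> (real ^ 'd \<Rightarrow> real ^ 'd) \<Rightarrow> real \<Rightarrow>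
     (real \<Rightarrow> real ^ 'd \<Rightarrow> real ^ 'd) \<Rightarrow> (real \<Rightarrow> real ^ 'd \<Rightarrow> real ^ 'd ^ 'd) \<Rightarrow>
     (real \<Rightarrow> real ^ 'd \<Rightarrow> real) \<Rightarrow> (real \<Rightarrow> real ^ 'd \<Rightarrow> real ^ 'd ^ 'd) \<Rightarrow>
     (real \<Rightarrow> real ^ 'd \<Rightarrow> real ^ 'd) \<Rightarrow> (real \<Rightarrow> real ^ 'd \<Rightarrow> real ^ 'd ^ 'd) \<Rightarrow>
     (real \<Rightarrow> real ^ 'd \<Rightarrow> real ^ 'd) \<Rightarrow> (real \<Rightarrow> real ^ 'd \<Rightarrow> real ^ 'd ^ 'd) \<Rightarrow> bool" where
  "coupled_solution \<rho>f \<rho>s \<mu> L1 L2 Oms Omf ns nf T U DU P SF E DE dE SS \<longleftrightarrow>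
     (let Sig = interface Oms Omf in
       fluid_solution \<rho>f \<mu> Omf Sig nf 0 T U DU P SF \<and>
       solid_solution \<rho>s L1 L2 Oms Sig ns 0 T E DE dE SS \<and>
       ae_time 0 T (\<lambda>t. AE x in surf Sig. U t x = dE t x) \<and>
       ae_time 0 T (\<lambda>t. AE x in surf Sig. SS t x *v ns x + SF t x *v nf x = 0))"

text \<open>The time average of the \<open>n\<close>-th iterate over \<open>[t\<^sub>n\<^sub>-\<^sub>1, t\<^sub>n]\<close>; for \<open>n = 0\<close> the initial value.\<close>

definition slab_average ::
    "real \<Rightarrow> (nat \<Rightarrow> real \<Rightarrow> 'a \<Rightarrow> 'b::euclidean_space) \<Rightarrow> nat \<Rightarrow> 'a \<Rightarrow> 'b" where
  "slab_average dt f n x =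
     (if n = 0 then f 0 0 x
      else (1 / dt) *\<^sub>R (LINT s:{(real n - 1) * dt..real n * dt}|lborel. f n s x))"

text \<open>Of the iterates with index \<open>0\<close> only the values at time \<open>t\<^sub>0 = 0\<close> are used.\<close>

definition splitting_initialization ::
    "(real ^ 'd::finite) set \<Rightarrow> (real ^ 'd) set \<Rightarrow> (real ^ 'd \<Rightarrow> real ^ 'd) \<Rightarrow>
     (real \<Rightarrow> real ^ 'd \<Rightarrow> real ^ 'd) \<Rightarrow> (real \<Rightarrow> real ^ 'd \<Rightarrow> real ^ 'd ^ 'd) \<Rightarrow>
     (real \<Rightarrow> real ^ 'd \<Rightarrow> real ^ 'd) \<Rightarrow> (real \<Rightarrow> real ^ 'd \<Rightarrow> real ^ 'd) \<Rightarrow>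
     (nat \<Rightarrow> real \<Rightarrow> real ^ 'd \<Rightarrow> real ^ 'd) \<Rightarrow> (nat \<Rightarrow> real \<Rightarrow> real ^ 'd \<Rightarrow> real ^ 'd ^ 'd) \<Rightarrow>
     (nat \<Rightarrow> real \<Rightarrow> real ^ 'd \<Rightarrow> real ^ 'd) \<Rightarrow> (nat \<Rightarrow> real \<Rightarrow> real ^ 'd \<Rightarrow> real ^ 'd) \<Rightarrow> bool" where
  "splitting_initialization Oms Omf nf U SF E dE u sf \<eta> d\<eta> \<longleftrightarrow>
     (AE x in vol Oms. \<eta> 0 0 x = E 0 x) \<and> (AE x in vol Oms. d\<eta> 0 0 x = dE 0 x) \<and>
     (AE x in vol Omf. u 0 0 x = U 0 x) \<and>
     (AE x in surf (interface Oms Omf). u 0 0 x = U 0 x) \<and>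
     (AE x in surf (interface Oms Omf). sf 0 0 x *v nf x = SF 0 x *v nf x)"

definition solid_step ::
    "real \<Rightarrow> real \<Rightarrow> real \<Rightarrow>
     (real ^ 'd::finite) set \<Rightarrow> (real ^ 'd) set \<Rightarrow> (real ^ 'd \<Rightarrow> real ^ 'd) \<Rightarrow> (real ^ 'd \<Rightarrow> real ^ 'd) \<Rightarrow>
     real \<Rightarrow> real \<Rightarrow> nat \<Rightarrow>
     (nat \<Rightarrow> real \<Rightarrow> real ^ 'd \<Rightarrow> real ^ 'd) \<Rightarrow> (nat \<Rightarrow> real \<Rightarrow> real ^ 'd \<Rightarrow> real ^ 'd ^ 'd) \<Rightarrow>
     (nat \<Rightarrow> real \<Rightarrow> real ^ 'd \<Rightarrow> real ^ 'd) \<Rightarrow> (nat \<Rightarrow> real \<Rightarrow> real ^ 'd \<Rightarrow> real ^ 'd ^ 'd) \<Rightarrow>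
     (nat \<Rightarrow> real \<Rightarrow> real ^ 'd \<Rightarrow> real ^ 'd) \<Rightarrow> (nat \<Rightarrow> real \<Rightarrow> real ^ 'd \<Rightarrow> real ^ 'd ^ 'd) \<Rightarrow> bool" where
  "solid_step \<rho>s L1 L2 Oms Omf ns nf lam dt n u sf \<eta> D\<eta> d\<eta> ss \<longleftrightarrow>
     (let Sig = interface Oms Omf; a = real n * dt; b = real (Suc n) * dt in
       solid_solution \<rho>s L1 L2 Oms Sig ns a b (\<eta> (Suc n)) (D\<eta> (Suc n)) (d\<eta> (Suc n)) (ss (Suc n)) \<and>
       ae_time a b (\<lambda>t. AE x in surf Sig.
         lam *\<^sub>R d\<eta> (Suc n) t x + ss (Suc n) t x *v ns x
           = lam *\<^sub>R slab_average dt u n x - slab_average dt (\<lambda>m s y. sf m s y *v nf y) n x) \<and>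
       (AE x in vol Oms. \<eta> (Suc n) a x = \<eta> n a x) \<and>
       (AE x in vol Oms. d\<eta> (Suc n) a x = d\<eta> n a x))"

definition fluid_step ::
    "real \<Rightarrow> real \<Rightarrow>
     (real ^ 'd::finite) set \<Rightarrow> (real ^ 'd) set \<Rightarrow> (real ^ 'd \<Rightarrow> real ^ 'd) \<Rightarrow>
     real \<Rightarrow> real \<Rightarrow> nat \<Rightarrow>
     (nat \<Rightarrow> real \<Rightarrow> real ^ 'd \<Rightarrow> real ^ 'd) \<Rightarrow> (nat \<Rightarrow> real \<Rightarrow> real ^ 'd \<Rightarrow> real ^ 'd ^ 'd) \<Rightarrow>
     (nat \<Rightarrow> real \<Rightarrow> real ^ 'd \<Rightarrow> real) \<Rightarrow> (nat \<Rightarrow> real \<Rightarrow> real ^ 'd \<Rightarrow> real ^ 'd ^ 'd) \<Rightarrow>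
     (nat \<Rightarrow> real \<Rightarrow> real ^ 'd \<Rightarrow> real ^ 'd) \<Rightarrow> bool" where
  "fluid_step \<rho>f \<mu> Oms Omf nf lam dt n u Du p sf d\<eta> \<longleftrightarrow>
     (let Sig = interface Oms Omf; a = real n * dt; b = real (Suc n) * dt in
       fluid_solution \<rho>f \<mu> Omf Sig nf a b (u (Suc n)) (Du (Suc n)) (p (Suc n)) (sf (Suc n)) \<and>
       ae_time a b (\<lambda>t. AE x in surf Sig.
         lam *\<^sub>R u (Suc n) t x + sf (Suc n) t x *v nf x
           = lam *\<^sub>R d\<eta> (Suc n) t x + slab_average dt (\<lambda>m s y. sf m s y *v nf y) n x) \<and>
       (AE x in vol Omf. u (Suc n) a x = u n a x))"

end

theory Submission
  imports Defs
begin

text \<open>On each time slab the errors solve the same fluid and solid equations, so they satisfy exact energy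
  identities; the only source terms are the powers \<open>\<langle>g, e\<rangle>\<close> and \<open>\<langle>s, w\<rangle>\<close> of the interface tractions
  \<open>g\<close>, \<open>s\<close> of the fluid and of the solid against the velocities \<open>e\<close>, \<open>w\<close>. With
  \<open>\<gamma> = \<lambda> e + g - \<lambda> w\<close> and \<open>\<beta> = e + (s + g) / \<lambda>\<close>,
  \<open>\<langle>g, e\<rangle> + \<langle>s, w\<rangle> = (|\<gamma>|\<^sup>2 - |g|\<^sup>2) / (2 \<lambda>) + \<lambda> / 2 (|\<beta>|\<^sup>2 - |e|\<^sup>2) - \<lambda> / 2 |\<beta> - w|\<^sup>2\<close>,
  and by the Robin conditions \<open>\<gamma>\<close> and \<open>\<beta>\<close> are the exact traction and velocity minus the averages of the
  iterates over the previous slab. They therefore equal the averages of \<open>g\<close> and \<open>e\<close> over the previous slab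
  up to the variation of the exact traction and velocity over two slabs, which is controlled by their time
  derivatives. Hence the interface terms telescope, and Young's inequality with parameter \<open>1 / N\<close> costs only a
  factor \<open>(1 + 1 / N) ^ N \<le> 3\<close> instead of an exponential in \<open>T\<close>.

  Since the solutions have no time derivatives in a space that would make the velocities admissible test
  functions, the energy identities come from testing with averages over \<open>[r, r + h]\<close>, integrating
  over \<open>r\<close> and letting \<open>h \<rightarrow> 0\<close>.\<close>

section \<open>Square integrable functions\<close>

text \<open>Where \<open>dt * T\<close> comes from: on one slab the variation of the exact traces
  costs \<open>dt\<^sup>2\<close> times their squared derivatives integrated over two slabs. Young's
  inequality with parameter 1/N multiplies this by a factor of order N, and
  \<open>N * dt = T\<close>. A parameter independent of N would instead amplify the interface terms
  geometrically in the number of slabs. The energy identities rest on a symmetric kernel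
  \<open>G x y\<close>, the energy form evaluated at two different times. The weak equation only
  gives increments of \<open>G\<close> in one argument with the other one frozen. Continuity of
  \<open>G\<close> is all that this requires. A further obstacle sits at the joints of the slabs:
  the displacement is handed over as a function defined almost everywhere, whereas the energy
  contains its gradient. The handover of the energy therefore needs uniqueness of weak
  gradients.\<close>

lemma norm_add_sq_Young:
  fixes a b :: "'b::real_inner"
  assumes "c > 0"
  shows "(norm (a + b))\<^sup>2 \<le> (1 + c) * (norm a)\<^sup>2 + (1 + 1 / c) * (norm b)\<^sup>2"
proof -
  have "0 \<le> (norm (sqrt c *\<^sub>R a - (1 / sqrt c) *\<^sub>R b))\<^sup>2"
    by simp
  also have "\<dots> = c * (norm a)\<^sup>2 - 2 * (a \<bullet> b) + (1 / c) * (norm b)\<^sup>2"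
    using assms unfolding power2_norm_eq_inner
    by (simp add: inner_diff_left inner_diff_right inner_commute field_simps real_sqrt_mult_self
        flip: power2_eq_square) 
  finally show ?thesis
    by (simp add: power2_norm_eq_inner inner_add_left inner_add_right inner_commute algebra_simps)
qed

lemma norm_add_sq_le:
  fixes a b :: "'b::real_inner"
  shows "(norm (a + b))\<^sup>2 \<le> 2 * (norm a)\<^sup>2 + 2 * (norm b)\<^sup>2"
  using norm_add_sq_Young[of 1 a b] by simp

lemma norm_diff_sq_le:
  fixes a b :: "'b::real_inner"
  shows "(norm (a - b))\<^sup>2 \<le> 2 * (norm a)\<^sup>2 + 2 * (norm b)\<^sup>2"
  using norm_add_sq_le[of a "- b"] by simp

text \<open>The extended-valued counterpart of \<open>L2sq\<close>. A Bochner integral of a function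
  that is not integrable is 0, so a bound on \<open>L2sq\<close> alone never proves square
  integrability; here infinity stays visible, and Tonelli applies without integrability.\<close>

definition L2nn :: "'a measure \<Rightarrow> ('a \<Rightarrow> 'b::euclidean_space) \<Rightarrow> ennreal" where
  "L2nn M f = (\<integral>\<^sup>+x. ennreal ((norm (f x))\<^sup>2) \<partial>M)"

lemma sq_integrable_iff:
  "sq_integrable M f \<longleftrightarrow> f \<in> borel_measurable M \<and> L2nn M f < \<infinity>"
  unfolding sq_integrable_def L2nn_def
  by (auto simp: integrable_iff_bounded)

lemma L2nn_eq_L2sq: "sq_integrable M f \<Longrightarrow> L2nn M f = ennreal (L2sq M f)"
  unfolding sq_integrable_def L2nn_def L2sq_def by (simp add: nn_integral_eq_integral)

lemma L2sq_eq_enn2real: "f \<in> borel_measurable M \<Longrightarrow> L2sq M f = enn2real (L2nn M f)"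
  unfolding L2nn_def L2sq_def by (subst integral_eq_nn_integral) auto

lemma L2sq_nonneg [simp]: "0 \<le> L2sq M f"
  unfolding L2sq_def by simp

lemma L2nn_mono_AE: "AE x in M. norm (f x) \<le> norm (g x) \<Longrightarrow> L2nn M f \<le> L2nn M g"
  unfolding L2nn_def
  by (intro nn_integral_mono_AE) (auto intro!: ennreal_leI power_mono elim: eventually_mono)

lemma L2nn_cong_AE: "AE x in M. f x = g x \<Longrightarrow> L2nn M f = L2nn M g"
  unfolding L2nn_def by (intro nn_integral_cong_AE) auto

lemma sq_integrable_measurable [measurable_dest]: "sq_integrable M f \<Longrightarrow> f \<in> borel_measurable M"
  by (simp add: sq_integrable_def)

lemma sq_integrable_zero [simp, intro]: "sq_integrable M (\<lambda>x. 0)"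
  by (simp add: sq_integrable_def)

lemma sq_integrable_bound:
  assumes "sq_integrable M g" "f \<in> borel_measurable M" "AE x in M. norm (f x) \<le> C * norm (g x)"
  shows "sq_integrable M f"
  unfolding sq_integrable_def
proof (intro conjI assms)
  have "integrable M (\<lambda>x. C\<^sup>2 * (norm (g x))\<^sup>2)"
    using assms(1) by (auto simp: sq_integrable_def)
  then show "integrable M (\<lambda>x. (norm (f x))\<^sup>2)"
  proof (rule Bochner_Integration.integrable_bound)
    show "AE x in M. norm ((norm (f x))\<^sup>2) \<le> norm (C\<^sup>2 * (norm (g x))\<^sup>2)"
      using assms(3)
      by eventually_elim (simp add: flip: power_mult_distrib, rule power_mono, auto)
  qed (use assms(2) in measurable)
qed

lemma sq_integrable_add [simp, intro]:
  assumes "sq_integrable M f" "sq_integrable M g"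
  shows "sq_integrable M (\<lambda>x. f x + g x)"
  unfolding sq_integrable_def
proof
  have [measurable]: "f \<in> borel_measurable M" "g \<in> borel_measurable M"
    using assms by (auto simp: sq_integrable_def)
  show "(\<lambda>x. f x + g x) \<in> borel_measurable M"
    by simp
  have "integrable M (\<lambda>x. 2 * (norm (f x))\<^sup>2 + 2 * (norm (g x))\<^sup>2)"
    using assms by (auto simp: sq_integrable_def)
  then show "integrable M (\<lambda>x. (norm (f x + g x))\<^sup>2)"
    by (rule Bochner_Integration.integrable_bound) (auto intro: norm_add_sq_le)
qed

lemma sq_integrable_linear:
  assumes "bounded_linear L" "sq_integrable M f"
  shows "sq_integrable M (\<lambda>x. L (f x))"
proof -
  obtain C where "\<forall>x. norm (L x) \<le> norm x * C"
    using bounded_linear.bounded[OF assms(1)] by blast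
  moreover have "L \<in> borel_measurable borel"
    by (intro borel_measurable_continuous_onI linear_continuous_on assms(1))
  ultimately show ?thesis
    using assms(2)
    by (intro sq_integrable_bound[where C = C, OF assms(2)])
      (auto simp: mult.commute sq_integrable_def intro: measurable_compose)
qed

lemma sq_integrable_scaleR [simp, intro]: "sq_integrable M f \<Longrightarrow> sq_integrable M (\<lambda>x. c *\<^sub>R f x)"
  by (rule sq_integrable_linear) (rule bounded_linear_scaleR_right)

lemma sq_integrable_uminus: "sq_integrable M f \<Longrightarrow> sq_integrable M (\<lambda>x. - f x)"
  by (rule sq_integrable_linear) (rule bounded_linear_minus[OF bounded_linear_ident])

lemma sq_integrable_diff [simp, intro]:
  "sq_integrable M f \<Longrightarrow> sq_integrable M g \<Longrightarrow> sq_integrable M (\<lambda>x. f x - g x)"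
  unfolding diff_conv_add_uminus by (intro sq_integrable_add sq_integrable_uminus)

lemma sq_integrable_inner [simp, intro]:
  assumes "sq_integrable M f" "sq_integrable M g"
  shows "integrable M (\<lambda>x. f x \<bullet> g x)"
proof (rule Bochner_Integration.integrable_bound)
  show "integrable M (\<lambda>x. (norm (f x))\<^sup>2 + (norm (g x))\<^sup>2)"
    using assms by (auto simp: sq_integrable_def)
  show "(\<lambda>x. f x \<bullet> g x) \<in> borel_measurable M"
    using assms by (auto simp: sq_integrable_def)
  have "\<bar>f x \<bullet> g x\<bar> \<le> (norm (f x))\<^sup>2 + (norm (g x))\<^sup>2" for x
  proof -
    have "\<bar>f x \<bullet> g x\<bar> \<le> norm (f x) * norm (g x)"
      by (rule Cauchy_Schwarz_ineq2)
    also have "\<dots> \<le> (norm (f x))\<^sup>2 + (norm (g x))\<^sup>2"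
      using sum_squares_bound[of "norm (f x)" "norm (g x)"]
        mult_nonneg_nonneg[OF norm_ge_zero[of "f x"] norm_ge_zero[of "g x"]]
      by linarith
    finally show ?thesis .
  qed
  then show "AE x in M. norm (f x \<bullet> g x) \<le> norm ((norm (f x))\<^sup>2 + (norm (g x))\<^sup>2)"
    by simp
qed

definition L2ip :: "'a measure \<Rightarrow> ('a \<Rightarrow> 'b::euclidean_space) \<Rightarrow> ('a \<Rightarrow> 'b) \<Rightarrow> real" where
  "L2ip M f g = (\<integral>x. f x \<bullet> g x \<partial>M)"

lemma L2ip_self: "L2ip M f f = L2sq M f"
  by (simp add: L2ip_def L2sq_def power2_norm_eq_inner)

lemma L2ip_commute: "L2ip M f g = L2ip M g f"
  by (simp add: L2ip_def inner_commute)

lemma L2ip_diff_left: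
  "sq_integrable M f \<Longrightarrow> sq_integrable M g \<Longrightarrow> sq_integrable M h \<Longrightarrow>
   L2ip M (\<lambda>x. f x - g x) h = L2ip M f h - L2ip M g h"
  by (simp add: L2ip_def inner_diff_left Bochner_Integration.integral_diff)

lemma L2ip_diff_right:
  "sq_integrable M f \<Longrightarrow> sq_integrable M g \<Longrightarrow> sq_integrable M h \<Longrightarrow>
   L2ip M h (\<lambda>x. f x - g x) = L2ip M h f - L2ip M h g"
  by (simp add: L2ip_def inner_diff_right Bochner_Integration.integral_diff)

lemma L2ip_cong_AE:
  assumes "AE x in M. f x = f' x" "AE x in M. g x = g' x"
    "f \<in> borel_measurable M" "g \<in> borel_measurable M"
    "f' \<in> borel_measurable M" "g' \<in> borel_measurable M"
  shows "L2ip M f g = L2ip M f' g'"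
  unfolding L2ip_def using assms by (intro integral_cong_AE) auto

lemma L2sq_cong_AE:
  assumes "AE x in M. f x = g x" "f \<in> borel_measurable M" "g \<in> borel_measurable M"
  shows "L2sq M f = L2sq M g"
  unfolding L2sq_def using assms by (intro integral_cong_AE) auto

lemma L2ip_le:
  assumes "sq_integrable M f" "sq_integrable M g"
  shows "\<bar>L2ip M f g\<bar> \<le> sqrt (L2sq M f) * sqrt (L2sq M g)"
proof -
  have "(L2ip M f g)\<^sup>2 \<le> L2sq M f * L2sq M g"
  proof -
    have *: "0 \<le> L2sq M f - 2 * t * L2ip M f g + t\<^sup>2 * L2sq M g" for t
    proof -
      have "0 \<le> (\<integral>x. (f x - t *\<^sub>R g x) \<bullet> (f x - t *\<^sub>R g x) \<partial>M)"
        by (intro integral_nonneg_AE) auto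
      also have "\<dots> = (\<integral>x. f x \<bullet> f x - 2 * t * (f x \<bullet> g x) + t\<^sup>2 * (g x \<bullet> g x) \<partial>M)"
        by (simp add: inner_diff_left inner_diff_right inner_commute algebra_simps power2_eq_square)
      also have "\<dots> = L2sq M f - 2 * t * L2ip M f g + t\<^sup>2 * L2sq M g"
        using assms by (simp add: L2ip_self[symmetric] L2ip_def)
      finally show ?thesis .
    qed
    show ?thesis
    proof (cases "L2sq M g = 0")
      case True
      have "L2ip M f g = 0"
      proof (rule ccontr)
        assume "L2ip M f g \<noteq> 0"
        \<comment> \<open>With the last coefficient zero the polynomial is affine in
          \<open>t\<close>; this value of \<open>t\<close> makes it equal to -1.\<close>
        then show False
          using *[of "(L2sq M f + 1) / (2 * L2ip M f g)"] True by simp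
      qed
      then show ?thesis by simp
    next
      case False
      then have "L2sq M g > 0"
        using L2sq_nonneg[of M g] by linarith
      then show ?thesis
        using *[of "L2ip M f g / L2sq M g"] by (simp add: field_simps power2_eq_square)
    qed
  qed
  then have "sqrt ((L2ip M f g)\<^sup>2) \<le> sqrt (L2sq M f * L2sq M g)"
    by (rule real_sqrt_le_mono)
  then show ?thesis
    by (simp add: real_sqrt_mult)
qed

text \<open>Expand the difference of the products into three terms and apply Cauchy-Schwarz to each.
  Square integrability is asked for only eventually because for moving averages it will itself be
  deduced from closeness to the limit.\<close>

lemma tendsto_L2sq_imp_tendsto_L2ip:
  assumes ev: "\<forall>\<^sub>F i in F. sq_integrable M (f i) \<and> sq_integrable M (g i)"
    and fg: "sq_integrable M f0" "sq_integrable M g0"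
    and "((\<lambda>i. L2sq M (\<lambda>x. f i x - f0 x)) \<longlongrightarrow> 0) F" "((\<lambda>i. L2sq M (\<lambda>x. g i x - g0 x)) \<longlongrightarrow> 0) F"
  shows "((\<lambda>i. L2ip M (f i) (g i)) \<longlongrightarrow> L2ip M f0 g0) F"
proof -
  let ?a = "\<lambda>i. sqrt (L2sq M (\<lambda>x. f i x - f0 x))" and ?b = "\<lambda>i. sqrt (L2sq M (\<lambda>x. g i x - g0 x))"
  have le: "\<forall>\<^sub>F i in F. norm (L2ip M (f i) (g i) - L2ip M f0 g0) \<le> ?a i * ?b i + ?a i * sqrt (L2sq M g0) + sqrt (L2sq M f0) * ?b i"
    using ev
  proof eventually_elim
    case (elim i)
    then have *: "sq_integrable M (f i)" "sq_integrable M (g i)" by auto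
    have "L2ip M (f i) (g i) - L2ip M f0 g0 = L2ip M (\<lambda>x. f i x - f0 x) (\<lambda>x. g i x - g0 x)
        + L2ip M (\<lambda>x. f i x - f0 x) g0 + L2ip M f0 (\<lambda>x. g i x - g0 x)"
      using * fg by (simp add: L2ip_diff_left L2ip_diff_right)
    then show ?case
      using L2ip_le[of M "\<lambda>x. f i x - f0 x" "\<lambda>x. g i x - g0 x"] L2ip_le[of M "\<lambda>x. f i x - f0 x" g0]
        L2ip_le[of M f0 "\<lambda>x. g i x - g0 x"] * fg by simp
  qed
  have "((\<lambda>i. ?a i * ?b i + ?a i * sqrt (L2sq M g0) + sqrt (L2sq M f0) * ?b i) \<longlongrightarrow>
      sqrt 0 * sqrt 0 + sqrt 0 * sqrt (L2sq M g0) + sqrt (L2sq M f0) * sqrt 0) F"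
    by (intro tendsto_intros assms)
  then have "((\<lambda>i. L2ip M (f i) (g i) - L2ip M f0 g0) \<longlongrightarrow> 0) F"
    using Lim_null_comparison[OF le] by simp
  then show ?thesis
    by (simp add: LIM_zero_iff)
qed

section \<open>Moving averages converge in mean square\<close>

text \<open>A point of an open set stays in it under small shifts, so for open sets the loss of mass
  under translation tends to 0 by dominated convergence. Outer regularity carries this over to Borel
  sets of finite measure.\<close>

lemma L1_translation_indicator:
  fixes A :: "real set" and \<theta> :: "nat \<Rightarrow> real"
  assumes [measurable]: "A \<in> sets borel" and fin: "emeasure lborel A < \<infinity>" and \<theta>: "\<theta> \<longlonglongrightarrow> 0"
  shows "(\<lambda>i. LINT r|lborel. \<bar>indicator A (r + \<theta> i) - indicator A r :: real\<bar>) \<longlonglongrightarrow> 0"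
proof (rule LIMSEQ_I)
  fix e :: real assume "e > 0"
  \<comment> \<open>Only the one-sided loss is followed, since openness says nothing about points
    entering from outside. Translation invariance makes gain and loss equal, which is the factor 2
    in \<open>eq\<close>.\<close>
  define ip where "ip = (\<lambda>(B :: real set) t. \<lambda>r. max 0 (indicator B r - indicator B (r + t) :: real))"
  obtain U where U: "open U" "A \<subseteq> U" "emeasure lborel (U - A) < e / 4"
    using outer_regular_lborel[OF assms(1), of "e / 4"] \<open>e > 0\<close> by auto
  have [measurable]: "U \<in> sets borel" using U(1) by simp
  have fU: "emeasure lborel U < \<infinity>"
  proof -
    have "emeasure lborel U = emeasure lborel (U - A) + emeasure lborel A"
      using U(2) by (subst plus_emeasure) (auto intro!: arg_cong2[where f = emeasure])
    then show ?thesis using fin U(3) by (simp add: less_top) (metis ennreal_less_top less_trans top.not_eq_extremum)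
  qed
  have int: "integrable lborel (\<lambda>r. indicator B (t + 1 * r) :: real)" if "B \<in> sets borel" "emeasure lborel B < \<infinity>" for B :: "real set" and t
    using that by (intro lborel_integrable_real_affine) (auto intro!: integrable_real_indicator)
  have int': "integrable lborel (\<lambda>r. indicator B (r + t) :: real)" "integrable lborel (\<lambda>r. indicator B r :: real)"
    if "B \<in> sets borel" "emeasure lborel B < \<infinity>" for B :: "real set" and t
    using int[OF that, of t] int[OF that, of 0] by (auto simp: add.commute)
  have sh: "(LINT r|lborel. indicator B (r + t) :: real) = LINT r|lborel. indicator B r" for B :: "real set" and t
    using lborel_integral_real_affine[of 1 "\<lambda>r. indicator B r :: real" t] by (simp add: add.commute)
  have eq: "(LINT r|lborel. \<bar>indicator A (r + t) - indicator A r :: real\<bar>) = 2 * (LINT r|lborel. ip A t r)" for t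
  proof -
    have "(LINT r|lborel. \<bar>indicator A (r + t) - indicator A r :: real\<bar>)
       = (LINT r|lborel. 2 * ip A t r - (indicator A r - indicator A (r + t)))"
      unfolding ip_def by (intro Bochner_Integration.integral_cong) (auto split: split_indicator)
    also have "\<dots> = 2 * (LINT r|lborel. ip A t r)"
      using int'(1)[OF assms(1) fin, of t] int'(2)[OF assms(1) fin] sh[of A t] unfolding ip_def by simp
    finally show ?thesis .
  qed
  \<comment> \<open>If \<open>r\<close> lies in \<open>A\<close> and \<open>r + t\<close> does not,
    then \<open>r + t\<close> has either left \<open>U\<close> as well or landed in
    \<open>U - A\<close>. The second case has small measure, again by translation
    invariance.\<close>
  have le: "(LINT r|lborel. ip A t r) \<le> (LINT r|lborel. ip U t r) + e / 4" for t
  proof -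
    have fUA: "emeasure lborel (U - A) < \<infinity>"
      using U(3) by (metis ennreal_less_top infinity_ennreal_def less_trans)
    have "(LINT r|lborel. ip A t r) \<le> (LINT r|lborel. ip U t r + indicator (U - A) (r + t))"
      using int'(1)[OF assms(1) fin, of t] int'(2)[OF assms(1) fin] int'(1)[OF _ fU, of t] int'(2)[OF _ fU] int'(1)[OF _ fUA, of t] int'(2)[OF _ fUA] U(2) unfolding ip_def
      by (intro integral_mono) (auto split: split_indicator)
    also have "\<dots> = (LINT r|lborel. ip U t r) + measure lborel (U - A)"
      using int'(1)[OF _ fU, of t] int'(2)[OF _ fU] int'(1)[OF _ fUA, of t] int'(2)[OF _ fUA] sh[of "U - A" t] unfolding ip_def by simp
    also have "measure lborel (U - A) \<le> e / 4"
      using U(3) \<open>e > 0\<close> unfolding measure_def by (intro enn2real_leI) auto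
    finally show ?thesis by simp
  qed
  have "(\<lambda>i. LINT r|lborel. ip U (\<theta> i) r) \<longlonglongrightarrow> (LINT (r::real)|lborel. (0 :: real))"
  proof (rule integral_dominated_convergence[where w = "indicator U"])
    show "integrable lborel (indicator U :: real \<Rightarrow> real)"
      using int'(2)[OF _ fU] by simp
    show "AE r in lborel. (\<lambda>i. ip U (\<theta> i) r) \<longlonglongrightarrow> 0"
    proof (rule AE_I2)
      fix r :: real
      show "(\<lambda>i. ip U (\<theta> i) r) \<longlonglongrightarrow> 0"
      proof (cases "r \<in> U")
        case True
        have "(\<lambda>i. r + \<theta> i) \<longlonglongrightarrow> r + 0"
          by (intro tendsto_intros \<theta>)
        then have "\<forall>\<^sub>F i in sequentially. r + \<theta> i \<in> U"
          using topological_tendstoD[OF _ U(1)] True by fastforce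
        then have "\<forall>\<^sub>F i in sequentially. ip U (\<theta> i) r = 0"
          by eventually_elim (simp add: ip_def True)
        then show ?thesis by (rule tendsto_eventually)
      next
        case False
        then show ?thesis by (simp add: ip_def)
      qed
    qed
  qed (auto simp: ip_def split: split_indicator)
  then have "(\<lambda>i. LINT r|lborel. ip U (\<theta> i) r) \<longlonglongrightarrow> 0" by simp
  from LIMSEQ_D[OF this, of "e / 4"] \<open>e > 0\<close> obtain n0 where n0: "\<And>i. i \<ge> n0 \<Longrightarrow> (LINT r|lborel. ip U (\<theta> i) r) < e / 4"
    by fastforce
  show "\<exists>n0. \<forall>i\<ge>n0. norm ((LINT r|lborel. \<bar>indicator A (r + \<theta> i) - indicator A r :: real\<bar>) - 0) < e"
  proof (intro exI allI impI)
    fix i assume "n0 \<le> i"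
    have "0 \<le> (LINT r|lborel. \<bar>indicator A (r + \<theta> i) - indicator A r :: real\<bar>)" by simp
    moreover have "(LINT r|lborel. \<bar>indicator A (r + \<theta> i) - indicator A r :: real\<bar>) < e"
      unfolding eq using le[of "\<theta> i"] n0[OF \<open>n0 \<le> i\<close>] by linarith
    ultimately show "norm ((LINT r|lborel. \<bar>indicator A (r + \<theta> i) - indicator A r :: real\<bar>) - 0) < e"
      by simp
  qed
qed

lemma lborel_integrable_shift:
  fixes f :: "real \<Rightarrow> 'b::{banach, second_countable_topology}"
  shows "integrable lborel f \<Longrightarrow> integrable lborel (\<lambda>r. f (r + t))"
  using lborel_integrable_real_affine[of f 1 t] by (simp add: add.commute)

lemma lborel_integral_shift:
  fixes f :: "real \<Rightarrow> 'b::{banach, second_countable_topology}"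
  shows "(LINT r|lborel. f (r + t)) = (LINT r|lborel. f r)"
  using lborel_integral_real_affine[of 1 f t] by (simp add: add.commute)

text \<open>Density argument: the approximation error of the shifted function equals that of the
  unshifted one, so it is small uniformly in the shift.\<close>

lemma L1_translation_cont:
  fixes f :: "real \<Rightarrow> 'b::{banach, second_countable_topology}"
  assumes "integrable lborel f" "\<theta> \<longlonglongrightarrow> 0"
  shows "(\<lambda>i. LINT r|lborel. norm (f (r + \<theta> i) - f r)) \<longlonglongrightarrow> 0"
  using assms(1)
proof (induct f rule: integrable_induct)
  case (base A c)
  have "(\<lambda>i. (LINT r|lborel. \<bar>indicator A (r + \<theta> i) - indicator A r :: real\<bar>) * norm c) \<longlonglongrightarrow> 0 * norm c"
    by (intro tendsto_intros L1_translation_indicator assms) (use base in auto)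
  then show ?case
    by (simp flip: scaleR_diff_left)
next
  case (add f g)
  note [simp] = lborel_integrable_shift[OF add(1)] lborel_integrable_shift[OF add(3)] add(1,3)
  have "(\<lambda>i. (LINT r|lborel. norm (f (r + \<theta> i) - f r)) + (LINT r|lborel. norm (g (r + \<theta> i) - g r))) \<longlonglongrightarrow> 0 + 0"
    by (intro tendsto_intros add)
  then show ?case
  proof (rule_tac Lim_null_comparison[OF always_eventually])
    show "\<forall>i. norm (LINT r|lborel. norm (f (r + \<theta> i) + g (r + \<theta> i) - (f r + g r)))
      \<le> (LINT r|lborel. norm (f (r + \<theta> i) - f r)) + (LINT r|lborel. norm (g (r + \<theta> i) - g r))"
      by (auto simp flip: Bochner_Integration.integral_add intro!: integral_mono norm_triangle_le norm_triangle_ineq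
          simp: add_diff_add)
  qed simp
next
  case (lim f s)
  show ?case
  proof (rule LIMSEQ_I)
    fix e :: real assume "e > 0"
    note [simp] = lborel_integrable_shift[OF lim(1)] lborel_integrable_shift[OF lim(5)] lim(1) lim(5)
    have [measurable]: "s k \<in> borel_measurable borel" "f \<in> borel_measurable borel" for k
      using borel_measurable_integrable[OF lim(1)[of k]] borel_measurable_integrable[OF lim(5)] by simp_all
    have "(\<lambda>k. LINT r|lborel. norm (s k r - f r)) \<longlonglongrightarrow> (LINT (r::real)|lborel. (0 :: real))"
    proof (rule integral_dominated_convergence[where w = "\<lambda>r. 3 * norm (f r)"])
      show "AE r in lborel. (\<lambda>k. norm (s k r - f r)) \<longlonglongrightarrow> 0"
        using lim(3) by (auto intro!: AE_I2 tendsto_norm_zero simp: LIM_zero_iff)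
      show "AE r in lborel. norm (norm (s k r - f r)) \<le> 3 * norm (f r)" for k
        using lim(4)[of _ k] norm_triangle_ineq4[of "s k _" "f _"] by (auto intro!: AE_I2) (smt (verit))
    qed (use lim in auto)
    then have "(\<lambda>k. LINT r|lborel. norm (s k r - f r)) \<longlonglongrightarrow> 0" by simp
    from LIMSEQ_D[OF this, of "e / 3"] \<open>e > 0\<close> obtain k where k: "(LINT r|lborel. norm (s k r - f r)) < e / 3"
      by fastforce
    from LIMSEQ_D[OF lim(2)[of k], of "e / 3"] \<open>e > 0\<close> obtain n0 where
      n0: "\<And>i. i \<ge> n0 \<Longrightarrow> (LINT r|lborel. norm (s k (r + \<theta> i) - s k r)) < e / 3"
      by fastforce
    show "\<exists>n0. \<forall>i\<ge>n0. norm ((LINT r|lborel. norm (f (r + \<theta> i) - f r)) - 0) < e"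
    proof (intro exI allI impI)
      fix i assume "n0 \<le> i"
      have "(LINT r|lborel. norm (f (r + \<theta> i) - f r)) \<le>
          (LINT r|lborel. norm (s k (r + \<theta> i) - f (r + \<theta> i)) + norm (s k r - f r) + norm (s k (r + \<theta> i) - s k r))"
        by (intro integral_mono) (auto, norm)
      also have "\<dots> = (LINT r|lborel. norm (s k (r + \<theta> i) - f (r + \<theta> i))) + (LINT r|lborel. norm (s k r - f r))
          + (LINT r|lborel. norm (s k (r + \<theta> i) - s k r))"
        by simp
      also have "(LINT r|lborel. norm (s k (r + \<theta> i) - f (r + \<theta> i))) = (LINT r|lborel. norm (s k r - f r))"
        by (rule lborel_integral_shift[of "\<lambda>r. norm (s k r - f r)"])
      finally have "(LINT r|lborel. norm (f (r + \<theta> i) - f r)) < e"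
        using k n0[OF \<open>n0 \<le> i\<close>] by linarith
      then show "norm ((LINT r|lborel. norm (f (r + \<theta> i) - f r)) - 0) < e"
        by simp
    qed
  qed
qed


text \<open>The truncations \<open>g k\<close> are bounded by \<open>k\<close> and live on a bounded
  interval, so they are integrable, and the square of their increment is at most
  \<open>2 * k\<close> times the increment itself. The mean square statement thus reduces to the
  mean one.\<close>

lemma L2_translation_cont:
  fixes f :: "real \<Rightarrow> 'b::euclidean_space"
  assumes f: "sq_integrable lborel f" and \<theta>: "\<theta> \<longlonglongrightarrow> 0"
  shows "(\<lambda>i. L2nn lborel (\<lambda>r. f (r + \<theta> i) - f r)) \<longlonglongrightarrow> 0"
proof -
  have [measurable]: "f \<in> borel_measurable borel"
    using f by (simp add: sq_integrable_def)
  have [simp]: "sq_integrable lborel (\<lambda>r. f (r + t))" for t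
    using f lborel_integrable_shift[of "\<lambda>r. (norm (f r))\<^sup>2" t] by (simp add: sq_integrable_def)
  define g where "g = (\<lambda>(k::nat) r. if \<bar>r\<bar> \<le> k \<and> norm (f r) \<le> k then f r else 0)"
  have g_meas [measurable]: "g k \<in> borel_measurable borel" for k
    unfolding g_def by measurable
  have g_le: "norm (g k r) \<le> k" "norm (g k r) \<le> norm (f r)" for k r
    by (auto simp: g_def)
  have g_int: "integrable lborel (g k)" for k
  proof (rule Bochner_Integration.integrable_bound)
    show "integrable lborel (\<lambda>r. indicator {- real k..real k} r * real k)"
      by (intro integrable_mult_left integrable_real_indicator) auto
    show "AE r in lborel. norm (g k r) \<le> norm (indicator {- real k..real k} r * real k)"
      by (intro AE_I2) (auto simp: g_def abs_le_iff split: split_indicator)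
  qed simp
  have g_sq: "sq_integrable lborel (g k)" for k
    by (rule sq_integrable_bound[where C = 1, OF f]) (use g_le in auto)
  have conv: "(\<lambda>k. L2sq lborel (\<lambda>r. f r - g k r)) \<longlonglongrightarrow> 0"
  proof -
    have "(\<lambda>k. LINT r|lborel. (norm (f r - g k r))\<^sup>2) \<longlonglongrightarrow> (LINT (r::real)|lborel. (0::real))"
    proof (rule integral_dominated_convergence[where w = "\<lambda>r. (norm (f r))\<^sup>2"])
      show "AE r in lborel. (\<lambda>k. (norm (f r - g k r))\<^sup>2) \<longlonglongrightarrow> 0"
      proof (rule AE_I2)
        fix r
        obtain n :: nat where n: "max \<bar>r\<bar> (norm (f r)) \<le> n"
          using real_arch_simple by blast
        then have "\<forall>\<^sub>F k in sequentially. (norm (f r - g k r))\<^sup>2 = 0"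
          unfolding eventually_sequentially by (intro exI[of _ n]) (auto simp: g_def)
        then show "(\<lambda>k. (norm (f r - g k r))\<^sup>2) \<longlonglongrightarrow> 0"
          by (rule tendsto_eventually)
      qed
    qed (use f in \<open>auto simp: g_def sq_integrable_def\<close>)
    then show ?thesis by (simp add: L2sq_def)
  qed
  have "(\<lambda>i. L2sq lborel (\<lambda>r. f (r + \<theta> i) - f r)) \<longlonglongrightarrow> 0"
  proof (rule LIMSEQ_I)
    fix e :: real assume "e > 0"
    \<comment> \<open>The truncation error enters below with weight 4 at \<open>r\<close> and 4 at
      \<open>r + \<theta> i\<close>, eight times e/16 in all; the other e/2 is left for the
      truncated function.\<close>
    from LIMSEQ_D[OF conv, of "e / 16"] \<open>e > 0\<close> obtain k where k: "L2sq lborel (\<lambda>r. f r - g k r) < e / 16"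
      by fastforce
    have "(\<lambda>i. (4 * real k) * (LINT r|lborel. norm (g k (r + \<theta> i) - g k r))) \<longlonglongrightarrow> (4 * real k) * 0"
      by (intro tendsto_intros L1_translation_cont g_int \<theta>)
    from LIMSEQ_D[OF this, of "e / 2"] \<open>e > 0\<close> obtain n0
      where n0: "\<And>i. i \<ge> n0 \<Longrightarrow> (4 * real k) * (LINT r|lborel. norm (g k (r + \<theta> i) - g k r)) < e / 2"
      by fastforce
    show "\<exists>n0. \<forall>i\<ge>n0. norm (L2sq lborel (\<lambda>r. f (r + \<theta> i) - f r) - 0) < e"
    proof (intro exI allI impI)
      fix i assume i: "n0 \<le> i"
      let ?h = "\<lambda>r. f r - g k r"
      have h: "integrable lborel (\<lambda>r. (norm (?h r))\<^sup>2)"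
        using sq_integrable_diff[OF f g_sq] by (simp add: sq_integrable_def)
      note int = lborel_integrable_shift[OF h, of "\<theta> i"] h g_int[of k] lborel_integrable_shift[OF g_int, of k "\<theta> i"]
      have "L2sq lborel (\<lambda>r. f (r + \<theta> i) - f r) \<le>
          (LINT r|lborel. 2 * (2 * k * norm (g k (r + \<theta> i) - g k r)) + 4 * (norm (?h (r + \<theta> i)))\<^sup>2 + 4 * (norm (?h r))\<^sup>2)"
        unfolding L2sq_def
      proof (rule integral_mono)
        show "integrable lborel (\<lambda>r. (norm (f (r + \<theta> i) - f r))\<^sup>2)"
          using sq_integrable_diff[OF \<open>\<And>t. sq_integrable lborel (\<lambda>r. f (r + t))\<close> f] unfolding sq_integrable_def by blast
        show "integrable lborel (\<lambda>r. 2 * (2 * k * norm (g k (r + \<theta> i) - g k r)) + 4 * (norm (?h (r + \<theta> i)))\<^sup>2 + 4 * (norm (?h r))\<^sup>2)"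
          using int by simp
        fix r
        let ?G = "g k (r + \<theta> i) - g k r"
        have "norm ?G \<le> 2 * k"
          using g_le(1)[of k r] g_le(1)[of k "r + \<theta> i"] norm_triangle_ineq4[of "g k (r + \<theta> i)" "g k r"] by linarith
        then have "(norm ?G)\<^sup>2 \<le> 2 * k * norm ?G"
          unfolding power2_eq_square by (intro mult_right_mono) auto
        moreover have "(norm (f (r + \<theta> i) - f r))\<^sup>2 \<le> 2 * (norm ?G)\<^sup>2 + 2 * (norm (?h (r + \<theta> i) - ?h r))\<^sup>2"
          using norm_add_sq_le[of ?G "?h (r + \<theta> i) - ?h r"] by (simp add: algebra_simps)
        moreover have "(norm (?h (r + \<theta> i) - ?h r))\<^sup>2 \<le> 2 * (norm (?h (r + \<theta> i)))\<^sup>2 + 2 * (norm (?h r))\<^sup>2"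
          by (rule norm_diff_sq_le)
        ultimately show "(norm (f (r + \<theta> i) - f r))\<^sup>2 \<le>
            2 * (2 * k * norm ?G) + 4 * (norm (?h (r + \<theta> i)))\<^sup>2 + 4 * (norm (?h r))\<^sup>2"
          by linarith
      qed
      also have "\<dots> = (4 * real k) * (LINT r|lborel. norm (g k (r + \<theta> i) - g k r))
          + 4 * (LINT r|lborel. (norm (?h (r + \<theta> i)))\<^sup>2) + 4 * L2sq lborel ?h"
        using int by (simp add: L2sq_def)
      also have "(LINT r|lborel. (norm (?h (r + \<theta> i)))\<^sup>2) = L2sq lborel ?h"
        unfolding L2sq_def by (rule lborel_integral_shift)
      finally have "L2sq lborel (\<lambda>r. f (r + \<theta> i) - f r) < e"
        using k n0[OF i] by linarith
      then show "norm (L2sq lborel (\<lambda>r. f (r + \<theta> i) - f r) - 0) < e"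
        by simp
    qed
  qed
  then have "(\<lambda>i. ennreal (L2sq lborel (\<lambda>r. f (r + \<theta> i) - f r))) \<longlonglongrightarrow> ennreal 0"
    by (intro tendsto_intros)
  then show ?thesis
    using f by (simp add: L2nn_eq_L2sq)
qed

section \<open>Jensen's inequality in time and convergence of window averages\<close>

lemma nn_integral_shift:
  assumes [measurable]: "f \<in> borel_measurable borel"
  shows "(\<integral>\<^sup>+r. f (r + t) \<partial>lborel) = (\<integral>\<^sup>+(r::real). f r \<partial>lborel)"
  using nn_integral_real_affine[OF assms, of 1 t] by (simp add: add.commute)

text \<open>Cauchy-Schwarz against the constant 1. It also holds for functions that are not
  integrable on the interval, whose integral is 0 by convention; this allows it to be applied at
  every point \<open>x\<close> and not merely at almost every one.\<close>

lemma norm_set_integral_sq_le: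
  fixes f :: "real \<Rightarrow> 'b::euclidean_space"
  assumes [measurable]: "f \<in> borel_measurable borel" and "a \<le> b"
  shows "ennreal ((norm (LINT s:{a..b}|lborel. f s))\<^sup>2)
     \<le> ennreal (b - a) * (\<integral>\<^sup>+s\<in>{a..b}. ennreal ((norm (f s))\<^sup>2) \<partial>lborel)"
proof -
  have "ennreal (norm (LINT s:{a..b}|lborel. f s)) \<le> (\<integral>\<^sup>+s. indicator {a..b} s * ennreal (norm (f s)) * indicator {a..b} s \<partial>lborel)"
    (is "_ \<le> ?R")
  proof (cases "set_integrable lborel {a..b} f")
    case True
    then have "ennreal (norm (LINT s:{a..b}|lborel. f s)) \<le> (\<integral>\<^sup>+s. ennreal (norm (indicator {a..b} s *\<^sub>R f s)) \<partial>lborel)"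
      unfolding set_integrable_def set_lebesgue_integral_def by (rule integral_norm_bound_ennreal)
    also have "\<dots> = ?R"
      by (intro nn_integral_cong) (auto split: split_indicator)
    finally show ?thesis .
  next
    case False
    then show ?thesis
      by (simp add: set_integrable_def set_lebesgue_integral_def not_integrable_integral_eq)
  qed
  then have "(ennreal (norm (LINT s:{a..b}|lborel. f s)))\<^sup>2 \<le> ?R\<^sup>2"
    by (rule power_mono) simp
  also have "\<dots> \<le> (\<integral>\<^sup>+s. (indicator {a..b} s * ennreal (norm (f s)))\<^sup>2 \<partial>lborel) * (\<integral>\<^sup>+s. (indicator {a..b} s)\<^sup>2 \<partial>lborel)"
    by (rule Cauchy_Schwarz_nn_integral) auto
  also have "(\<integral>\<^sup>+s. (indicator {a..b} s)\<^sup>2 \<partial>lborel) = (\<integral>\<^sup>+s. indicator {a..b} s \<partial>lborel)"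
    by (intro nn_integral_cong) (auto split: split_indicator)
  also have "\<dots> = ennreal (b - a)"
    using \<open>a \<le> b\<close> by simp
  also have "(\<integral>\<^sup>+s. (indicator {a..b} s * ennreal (norm (f s)))\<^sup>2 \<partial>lborel) = (\<integral>\<^sup>+s\<in>{a..b}. ennreal ((norm (f s))\<^sup>2) \<partial>lborel)"
    by (intro nn_integral_cong) (auto split: split_indicator simp: ennreal_power)
  finally show ?thesis
    by (simp add: ennreal_power mult.commute)
qed

lemma L2nn_pair:
  assumes "sigma_finite_measure M" "sigma_finite_measure N"
    and f [measurable]: "case_prod f \<in> borel_measurable (N \<Otimes>\<^sub>M M)"
  shows "L2nn (N \<Otimes>\<^sub>M M) (case_prod f) = (\<integral>\<^sup>+t. L2nn M (f t) \<partial>N)"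
    and "L2nn (N \<Otimes>\<^sub>M M) (case_prod f) = (\<integral>\<^sup>+x. L2nn N (\<lambda>t. f t x) \<partial>M)"
proof -
  interpret pair_sigma_finite N M
    using assms by (simp add: pair_sigma_finite_def)
  have *: "(\<lambda>(t, x). ennreal ((norm (f t x))\<^sup>2)) \<in> borel_measurable (N \<Otimes>\<^sub>M M)"
    by measurable
  show "L2nn (N \<Otimes>\<^sub>M M) (case_prod f) = (\<integral>\<^sup>+t. L2nn M (f t) \<partial>N)"
    using M2.nn_integral_fst[OF *] by (simp add: L2nn_def split_beta')
  show "L2nn (N \<Otimes>\<^sub>M M) (case_prod f) = (\<integral>\<^sup>+x. L2nn N (\<lambda>t. f t x) \<partial>M)"
    using nn_integral_snd[OF *] by (simp add: L2nn_def split_beta')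
qed

text \<open>Apply the one-dimensional result on almost every time fibre and integrate over
  \<open>x\<close> by dominated convergence. By translation invariance four times the squared norm
  of the fibre is a majorant that does not depend on the shift.\<close>

lemma L2_translation_cont_pair:
  fixes F :: "real \<Rightarrow> 'a \<Rightarrow> 'b::euclidean_space"
  assumes M: "sigma_finite_measure M" and F: "sq_integrable (lborel \<Otimes>\<^sub>M M) (case_prod F)" and \<theta>: "\<theta> \<longlonglongrightarrow> 0"
  shows "(\<lambda>i. L2nn (lborel \<Otimes>\<^sub>M M) (\<lambda>(r, x). F (r + \<theta> i) x - F r x)) \<longlonglongrightarrow> 0"
proof -
  interpret M: sigma_finite_measure M by fact
  interpret pair_sigma_finite lborel M ..
  have [measurable]: "case_prod F \<in> borel_measurable (lborel \<Otimes>\<^sub>M M)"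
    and fin: "L2nn (lborel \<Otimes>\<^sub>M M) (case_prod F) < \<infinity>"
    using F by (auto simp: sq_integrable_iff)
  note eq = L2nn_pair(2)[OF M sigma_finite_lborel]
  have fin': "(\<integral>\<^sup>+x. L2nn lborel (\<lambda>r. F r x) \<partial>M) < \<infinity>"
    using fin eq[of F] by simp
  have sl: "(\<lambda>t. F t x) \<in> borel_measurable borel" if "x \<in> space M" for x
    using that by simp
  have meas: "(\<lambda>x. L2nn lborel (\<lambda>r. F (r + t) x - F r x)) \<in> borel_measurable M" 
     "(\<lambda>x. 4 * L2nn lborel (\<lambda>r. F r x)) \<in> borel_measurable M" for t
    unfolding L2nn_def by measurable
  have "(\<lambda>i. \<integral>\<^sup>+x. L2nn lborel (\<lambda>r. F (r + \<theta> i) x - F r x) \<partial>M) \<longlonglongrightarrow> (\<integral>\<^sup>+x. 0 \<partial>M)"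
  proof (rule nn_integral_dominated_convergence[where w = "\<lambda>x. 4 * L2nn lborel (\<lambda>r. F r x)"])
    show "AE x in M. L2nn lborel (\<lambda>r. F (r + \<theta> i) x - F r x) \<le> 4 * L2nn lborel (\<lambda>r. F r x)" for i
    proof (rule AE_I2)
      fix x assume x: "x \<in> space M"
      note [measurable] = sl[OF x]
      have "L2nn lborel (\<lambda>r. F (r + \<theta> i) x - F r x)
         \<le> (\<integral>\<^sup>+r. ennreal (2 * (norm (F (r + \<theta> i) x))\<^sup>2) + ennreal (2 * (norm (F r x))\<^sup>2) \<partial>lborel)"
        unfolding L2nn_def by (intro nn_integral_mono) (auto simp flip: ennreal_plus intro!: ennreal_leI norm_diff_sq_le)
      also have "\<dots> = 2 * (\<integral>\<^sup>+r. ennreal ((norm (F (r + \<theta> i) x))\<^sup>2) \<partial>lborel) + 2 * L2nn lborel (\<lambda>r. F r x)"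
        by (simp add: nn_integral_add nn_integral_cmult ennreal_mult L2nn_def)
      also have "(\<integral>\<^sup>+r. ennreal ((norm (F (r + \<theta> i) x))\<^sup>2) \<partial>lborel) = L2nn lborel (\<lambda>r. F r x)"
        unfolding L2nn_def by (rule nn_integral_shift) simp
      finally show "L2nn lborel (\<lambda>r. F (r + \<theta> i) x - F r x) \<le> 4 * L2nn lborel (\<lambda>r. F r x)"
        by (simp flip: distrib_right)
    qed
    show "(\<integral>\<^sup>+x. 4 * L2nn lborel (\<lambda>r. F r x) \<partial>M) < \<infinity>"
      using fin' by (subst nn_integral_cmult) (auto simp: ennreal_mult_less_top L2nn_def)
    have "AE x in M. L2nn lborel (\<lambda>r. F r x) \<noteq> \<infinity>"
      using fin' by (intro nn_integral_PInf_AE) (auto simp: L2nn_def)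
    then show "AE x in M. (\<lambda>i. L2nn lborel (\<lambda>r. F (r + \<theta> i) x - F r x)) \<longlonglongrightarrow> 0"
      using AE_space
      by eventually_elim (auto intro!: L2_translation_cont \<theta> simp: sq_integrable_iff less_top)
  qed (use meas in auto)
  moreover have "L2nn (lborel \<Otimes>\<^sub>M M) (\<lambda>(r, x). F (r + t) x - F r x) = (\<integral>\<^sup>+x. L2nn lborel (\<lambda>r. F (r + t) x - F r x) \<partial>M)" for t
    by (rule eq) simp
  ultimately show ?thesis
    by simp
qed


text \<open>The forward Steklov average. It is applied to functions extended by zero outside their
  time interval, so that every window makes sense.\<close>

definition moving_average :: "real \<Rightarrow> (real \<Rightarrow> 'a \<Rightarrow> 'b::euclidean_space) \<Rightarrow> real \<Rightarrow> 'a \<Rightarrow> 'b" where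
  "moving_average h F r x = (1 / h) *\<^sub>R (LINT \<tau>:{r..r + h}|lborel. F \<tau> x)"

lemma moving_average_measurable [measurable]:
  assumes "sigma_finite_measure M" and [measurable]: "case_prod F \<in> borel_measurable (lborel \<Otimes>\<^sub>M M)"
  shows "case_prod (moving_average h F) \<in> borel_measurable (lborel \<Otimes>\<^sub>M M)"
proof -
  \<comment> \<open>With the window moved into the integrand this is an integral over the whole line
    depending on a parameter, whose measurability in \<open>(r, x)\<close> is standard.\<close>
  have "moving_average h F r x = (1 / h) *\<^sub>R (LINT \<tau>|lborel. (if r \<le> \<tau> \<and> \<tau> \<le> r + h then F \<tau> x else 0))" for r x
    unfolding moving_average_def set_lebesgue_integral_def
    by (intro arg_cong[where f = "scaleR _"] Bochner_Integration.integral_cong) auto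
  then have "case_prod (moving_average h F) =
      (\<lambda>(r, x). (1 / h) *\<^sub>R (LINT \<tau>|lborel. (if r \<le> \<tau> \<and> \<tau> \<le> r + h then F \<tau> x else 0)))"
    by auto
  then show ?thesis by simp
qed

lemma sq_integrable_imp_set_integrable:
  fixes f :: "real \<Rightarrow> 'b::euclidean_space"
  assumes f: "sq_integrable lborel f"
  shows "set_integrable lborel {a..b} f"
  unfolding set_integrable_def
proof (rule Bochner_Integration.integrable_bound)
  have [measurable]: "f \<in> borel_measurable borel"
    using f by (simp add: sq_integrable_def)
  show "(\<lambda>s. indicator {a..b} s *\<^sub>R f s) \<in> borel_measurable lborel"
    by simp
  show "integrable lborel (\<lambda>s. (norm (f s))\<^sup>2 + indicator {a..b} s)"
    using f by (intro Bochner_Integration.integrable_add integrable_real_indicator) (auto simp: sq_integrable_def emeasure_lborel_Icc_eq)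
  have "norm (f s) \<le> (norm (f s))\<^sup>2 + 1" for s
    using sum_squares_bound[of "norm (f s)" 1] zero_le_power2[of "norm (f s)"] norm_ge_zero[of "f s"]
    by (simp del: zero_le_power2 norm_ge_zero)
  then show "AE s in lborel. norm (indicator {a..b} s *\<^sub>R f s) \<le> norm ((norm (f s))\<^sup>2 + indicator {a..b} s)"
    by (intro AE_I2) (auto split: split_indicator)
qed

lemma ennreal_inverse_sq_mult: "0 < h \<Longrightarrow> ennreal ((1 / h)\<^sup>2) * (ennreal h * X) = ennreal (1 / h) * X"
proof -
  assume h: "0 < h"
  have "ennreal ((1 / h)\<^sup>2) * ennreal h = ennreal ((1 / h)\<^sup>2 * h)"
    using h by (intro ennreal_mult'[symmetric]) auto
  also have "(1 / h)\<^sup>2 * h = 1 / h"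
    using h by (simp add: power2_eq_square)
  finally show ?thesis
    by (simp only: mult.assoc[symmetric])
qed

lemma ennreal_norm_scaleR_sq: "ennreal ((norm (c *\<^sub>R y))\<^sup>2) = ennreal (c\<^sup>2) * ennreal ((norm y)\<^sup>2)"
  by (simp add: power_mult_distrib ennreal_mult')

text \<open>Jensen's inequality: the squared normalisation \<open>(1 / (b - a))\<^sup>2\<close>
  against the factor \<open>b - a\<close> from Cauchy-Schwarz.\<close>

lemma norm_average_diff_sq_le:
  fixes f :: "real \<Rightarrow> 'b::euclidean_space"
  assumes [measurable]: "f \<in> borel_measurable borel" and int: "set_integrable lborel {a..b} f" and "a < b"
  shows "ennreal ((norm (c - (1 / (b - a)) *\<^sub>R (LINT s:{a..b}|lborel. f s)))\<^sup>2)
    \<le> ennreal (1 / (b - a)) * (\<integral>\<^sup>+s\<in>{a..b}. ennreal ((norm (c - f s))\<^sup>2) \<partial>lborel)"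
proof -
  have "(LINT s:{a..b}|lborel. c - f s) = (b - a) *\<^sub>R c - (LINT s:{a..b}|lborel. f s)"
    using int \<open>a < b\<close> by (subst set_integral_diff)
      (auto simp: set_integral_const set_integrable_def intro!: integrable_scaleR_left integrable_real_indicator)
  then have "c - (1 / (b - a)) *\<^sub>R (LINT s:{a..b}|lborel. f s) = (1 / (b - a)) *\<^sub>R (LINT s:{a..b}|lborel. c - f s)"
    using \<open>a < b\<close> by (simp add: scaleR_diff_right)
  then have "ennreal ((norm (c - (1 / (b - a)) *\<^sub>R (LINT s:{a..b}|lborel. f s)))\<^sup>2)
      = ennreal ((1 / (b - a))\<^sup>2) * ennreal ((norm (LINT s:{a..b}|lborel. c - f s))\<^sup>2)"
    by (simp only: ennreal_norm_scaleR_sq)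
  also have "\<dots> \<le> ennreal ((1 / (b - a))\<^sup>2) * (ennreal (b - a) * (\<integral>\<^sup>+s\<in>{a..b}. ennreal ((norm (c - f s))\<^sup>2) \<partial>lborel))"
    using \<open>a < b\<close> by (intro mult_left_mono norm_set_integral_sq_le) auto
  also have "\<dots> = ennreal (1 / (b - a)) * (\<integral>\<^sup>+s\<in>{a..b}. ennreal ((norm (c - f s))\<^sup>2) \<partial>lborel)"
    using \<open>a < b\<close> by (intro ennreal_inverse_sq_mult) simp
  finally show ?thesis .
qed

lemma moving_average_diff_le:
  fixes f :: "real \<Rightarrow> 'b::euclidean_space"
  assumes f: "sq_integrable lborel f" and "h > 0"
  shows "ennreal ((norm ((1 / h) *\<^sub>R (LINT \<tau>:{r..r + h}|lborel. f \<tau>) - f r))\<^sup>2)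
     \<le> ennreal (1 / h) * (\<integral>\<^sup>+\<theta>\<in>{0..h}. ennreal ((norm (f (r + \<theta>) - f r))\<^sup>2) \<partial>lborel)"
proof -
  have [measurable]: "f \<in> borel_measurable borel"
    using f by (simp add: sq_integrable_def)
  have "ennreal ((norm ((1 / h) *\<^sub>R (LINT \<tau>:{r..r + h}|lborel. f \<tau>) - f r))\<^sup>2)
      \<le> ennreal (1 / h) * (\<integral>\<^sup>+s\<in>{r..r + h}. ennreal ((norm (f s - f r))\<^sup>2) \<partial>lborel)"
    using norm_average_diff_sq_le[of f r "r + h" "f r"] sq_integrable_imp_set_integrable[OF f, of r "r + h"] \<open>h > 0\<close>
    by (simp add: norm_minus_commute)
  also have "(\<integral>\<^sup>+s\<in>{r..r + h}. ennreal ((norm (f s - f r))\<^sup>2) \<partial>lborel)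
      = (\<integral>\<^sup>+\<theta>. ennreal ((norm (f (\<theta> + r) - f r))\<^sup>2) * indicator {r..r + h} (\<theta> + r) \<partial>lborel)"
    by (rule nn_integral_shift[symmetric]) simp
  also have "\<dots> = (\<integral>\<^sup>+\<theta>\<in>{0..h}. ennreal ((norm (f (r + \<theta>) - f r))\<^sup>2) \<partial>lborel)"
    by (intro nn_integral_cong) (auto split: split_indicator simp: add.commute)
  finally show ?thesis .
qed

text \<open>By Jensen the squared error of the average is at most the mean of the squared
  translation errors over the shifts in \<open>[0, h]\<close>, and these tend to 0 with the
  shift.\<close>

lemma moving_average_tendsto:
  fixes F :: "real \<Rightarrow> 'a \<Rightarrow> 'b::euclidean_space"
  assumes M: "sigma_finite_measure M" and F: "sq_integrable (lborel \<Otimes>\<^sub>M M) (case_prod F)"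
    and h: "h \<longlonglongrightarrow> 0" "\<And>i. h i > 0"
  shows "(\<lambda>i. L2nn (lborel \<Otimes>\<^sub>M M) (\<lambda>(r, x). moving_average (h i) F r x - F r x)) \<longlonglongrightarrow> 0"
proof -
  interpret M: sigma_finite_measure M by fact
  interpret pair_sigma_finite lborel M ..
  interpret P: pair_sigma_finite lborel "lborel \<Otimes>\<^sub>M M" ..
  have [measurable]: "case_prod F \<in> borel_measurable (lborel \<Otimes>\<^sub>M M)"
    and fin: "L2nn (lborel \<Otimes>\<^sub>M M) (case_prod F) < \<infinity>"
    using F by (auto simp: sq_integrable_iff)
  define tr where "tr = (\<lambda>\<theta>. L2nn (lborel \<Otimes>\<^sub>M M) (\<lambda>(r, x). F (r + \<theta>) x - F r x))"
  have [measurable]: "tr \<in> borel_measurable borel"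
    unfolding tr_def L2nn_def by measurable
  have le: "L2nn (lborel \<Otimes>\<^sub>M M) (\<lambda>(r, x). moving_average k F r x - F r x)
      \<le> ennreal (1 / k) * (\<integral>\<^sup>+\<theta>\<in>{0..k}. tr \<theta> \<partial>lborel)" if "k > 0" for k
  proof -
    have "(\<integral>\<^sup>+x. L2nn lborel (\<lambda>r. F r x) \<partial>M) < \<infinity>"
      using fin L2nn_pair(2)[OF M sigma_finite_lborel, of F] by simp
    then have "AE x in M. L2nn lborel (\<lambda>r. F r x) \<noteq> \<infinity>"
      by (intro nn_integral_PInf_AE) (auto simp: L2nn_def)
    then have ae: "AE x in M. sq_integrable lborel (\<lambda>r. F r x)"
      using AE_space by eventually_elim (auto simp: sq_integrable_iff less_top)
    have "L2nn (lborel \<Otimes>\<^sub>M M) (\<lambda>(r, x). moving_average k F r x - F r x)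
      = (\<integral>\<^sup>+x. L2nn lborel (\<lambda>r. moving_average k F r x - F r x) \<partial>M)"
      by (rule L2nn_pair(2)[OF M sigma_finite_lborel]) (use moving_average_measurable[OF M, of F k] in measurable)
    also have "\<dots> \<le> (\<integral>\<^sup>+x. \<integral>\<^sup>+r. ennreal (1 / k) * (\<integral>\<^sup>+\<theta>\<in>{0..k}. ennreal ((norm (F (r + \<theta>) x - F r x))\<^sup>2) \<partial>lborel) \<partial>lborel \<partial>M)"
      unfolding L2nn_def moving_average_def
      by (intro nn_integral_mono_AE) (use ae that in \<open>auto intro!: nn_integral_mono moving_average_diff_le\<close>)
    also have "\<dots> = (\<integral>\<^sup>+z. ennreal (1 / k) * (\<integral>\<^sup>+\<theta>\<in>{0..k}. ennreal ((norm (F (fst z + \<theta>) (snd z) - F (fst z) (snd z)))\<^sup>2) \<partial>lborel) \<partial>(lborel \<Otimes>\<^sub>M M))"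
      by (subst nn_integral_snd[symmetric]) simp_all
    also have "\<dots> = ennreal (1 / k) * (\<integral>\<^sup>+z. (\<integral>\<^sup>+\<theta>\<in>{0..k}. ennreal ((norm (F (fst z + \<theta>) (snd z) - F (fst z) (snd z)))\<^sup>2) \<partial>lborel) \<partial>(lborel \<Otimes>\<^sub>M M))"
      by (rule nn_integral_cmult) simp
    also have "(\<integral>\<^sup>+z. (\<integral>\<^sup>+\<theta>\<in>{0..k}. ennreal ((norm (F (fst z + \<theta>) (snd z) - F (fst z) (snd z)))\<^sup>2) \<partial>lborel) \<partial>(lborel \<Otimes>\<^sub>M M))
       = (\<integral>\<^sup>+\<theta>. (\<integral>\<^sup>+z. ennreal ((norm (F (fst z + \<theta>) (snd z) - F (fst z) (snd z)))\<^sup>2) * indicator {0..k} \<theta> \<partial>(lborel \<Otimes>\<^sub>M M)) \<partial>lborel)"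
      by (rule P.Fubini') measurable
    also have "\<dots> = (\<integral>\<^sup>+\<theta>\<in>{0..k}. tr \<theta> \<partial>lborel)"
      unfolding tr_def L2nn_def by (simp add: nn_integral_multc split_beta')
    finally show ?thesis .
  qed
  have tr0: "(tr \<longlongrightarrow> 0) (at 0)"
    unfolding tendsto_at_iff_sequentially tr_def comp_def
    by (auto intro!: L2_translation_cont_pair[OF M F])
  have "\<forall>\<^sub>F i in sequentially. L2nn (lborel \<Otimes>\<^sub>M M) (\<lambda>(r, x). moving_average (h i) F r x - F r x) < e" if "e > 0" for e
  proof -
    obtain d where d: "0 < d" "d < e"
      using dense[OF \<open>e > 0\<close>] by blast
    then have "\<forall>\<^sub>F \<theta> in at 0. tr \<theta> < d"
      using order_tendstoD(2)[OF tr0] by blast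
    then obtain \<delta> where \<delta>: "\<delta> > 0" "\<And>\<theta>. \<theta> \<noteq> 0 \<Longrightarrow> \<bar>\<theta>\<bar> < \<delta> \<Longrightarrow> tr \<theta> < d"
      unfolding eventually_at by (auto simp: dist_real_def)
    \<comment> \<open>The filter \<open>at 0\<close> omits 0 itself, while the mean over
      \<open>{0..h}\<close> includes it.\<close>
    moreover have "tr 0 = 0"
      by (simp add: tr_def L2nn_def split_beta')
    ultimately have tr_le: "tr \<theta> \<le> d" if "\<bar>\<theta>\<bar> < \<delta>" for \<theta>
      using that by (cases "\<theta> = 0") (auto intro: less_imp_le)
    have "\<forall>\<^sub>F i in sequentially. h i < \<delta>"
      using order_tendstoD(2)[OF h(1) \<delta>(1)] .
    then show ?thesis
    proof eventually_elim
      case (elim i)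
      have "ennreal (1 / h i) * (\<integral>\<^sup>+\<theta>\<in>{0..h i}. tr \<theta> \<partial>lborel) \<le> ennreal (1 / h i) * (\<integral>\<^sup>+\<theta>. d * indicator {0..h i} \<theta> \<partial>lborel)"
        using elim by (intro mult_left_mono nn_integral_mono) (auto split: split_indicator intro!: tr_le)
      also have "(\<integral>\<^sup>+\<theta>. d * indicator {0..h i} \<theta> \<partial>lborel) = d * ennreal (h i)"
        using h(2)[of i] by (subst nn_integral_cmult_indicator) auto
      also have "ennreal (1 / h i) * (d * ennreal (h i)) = (ennreal (1 / h i) * ennreal (h i)) * d"
        by (simp add: mult_ac)
      also have "\<dots> = d"
        using h(2)[of i] by (simp flip: ennreal_mult')
      finally show ?case
        using le[OF h(2)[of i]] d(2) by (meson order_le_less_trans order_trans)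
    qed
  qed
  then show ?thesis
    by (intro order_tendstoI) auto
qed

section \<open>Symmetric kernels\<close>

text \<open>Write the inner variable as \<open>r + \<theta>\<close> in the second term and as
  \<open>r + h - \<theta>\<close> in the first. By symmetry both terms then sample the same function
  \<rho> \<mapsto> \<open>G \<rho> (\<rho> + \<theta>)\<close>, once on \<open>[s, t]\<close> and
  once on this interval shifted by \<open>h - \<theta>\<close>. The overlap cancels and only two end
  layers of length \<open>h - \<theta>\<close> survive.\<close>

lemma symmetric_kernel_double_integral:
  fixes G :: "real \<Rightarrow> real \<Rightarrow> real"
  assumes cont: "continuous_on UNIV (\<lambda>z. G (fst z) (snd z))" and sym: "\<And>x y. G x y = G y x"
    and "s \<le> t" "h > 0"
  defines "D \<equiv> \<lambda>\<theta>. integral {s..t} (\<lambda>r. G (r + h) (r + h - \<theta>)) - integral {s..t} (\<lambda>r. G r (r + \<theta>))"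
  shows "D integrable_on {0..h}"
    and "integral {s..t} (\<lambda>r. integral {r..r + h} (\<lambda>q. G (r + h) q - G r q)) = integral {0..h} D"
    and "0 \<le> \<theta> \<Longrightarrow> \<theta> \<le> h \<Longrightarrow> D \<theta> = integral {t..t + (h - \<theta>)} (\<lambda>\<rho>. G \<rho> (\<rho> + \<theta>)) - integral {s..s + (h - \<theta>)} (\<lambda>\<rho>. G \<rho> (\<rho> + \<theta>))"
proof -
  note [continuous_intros] = continuous_on_compose2[OF cont, of _ "\<lambda>x. (f x, g x)" for f g, simplified]
  have ci: "continuous_on {0..h} (\<lambda>\<theta>. integral {s..t} (\<lambda>r. f r \<theta>))"
    if "continuous_on UNIV (\<lambda>z. f (fst z) (snd z))" for f :: "real \<Rightarrow> real \<Rightarrow> real"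
    using integral_continuous_on_param[of "{0..h}" s t "\<lambda>\<theta> r. f r \<theta>"]
      continuous_on_compose2[OF that, of "{0..h} \<times> {s..t}" "\<lambda>z. (snd z, fst z)"]
    by (simp add: split_beta' continuous_intros)
  have c1: "continuous_on UNIV (\<lambda>z. G (fst z + h) (fst z + h - snd z))"
    and c2: "continuous_on UNIV (\<lambda>z. G (fst z) (fst z + snd z))"
    and c3: "continuous_on UNIV (\<lambda>z. G (fst z + h) (fst z + snd z))"
    by (intro continuous_intros)+
  note i1 = integrable_continuous_interval[OF ci[OF c1]]
    and i2 = integrable_continuous_interval[OF ci[OF c2]]
    and i3 = integrable_continuous_interval[OF ci[OF c3]]
  show "D integrable_on {0..h}"
    unfolding D_def by (intro integrable_diff i1 i2)
  have "integral {s..t} (\<lambda>r. integral {r..r + h} (\<lambda>q. G (r + h) q - G r q)) =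
      integral {s..t} (\<lambda>r. integral {0..h} (\<lambda>\<theta>. G (r + h) (r + \<theta>) - G r (r + \<theta>)))"
  proof (intro integral_cong)
    fix r
    have "continuous_on {0 + r..h + r} (\<lambda>q. G (r + h) q - G r q)"
      by (intro continuous_intros)
    from integral_shift[OF this]
    show "integral {r..r + h} (\<lambda>q. G (r + h) q - G r q) = integral {0..h} (\<lambda>\<theta>. G (r + h) (r + \<theta>) - G r (r + \<theta>))"
      by (simp add: o_def add.commute)
  qed
  also have "\<dots> = integral {0..h} (\<lambda>\<theta>. integral {s..t} (\<lambda>r. G (r + h) (r + \<theta>) - G r (r + \<theta>)))"
  proof -
    have "continuous_on (cbox (s, 0) (t, h)) (\<lambda>(r, \<theta>). G (r + h) (r + \<theta>) - G r (r + \<theta>))"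
      unfolding split_beta' by (intro continuous_intros)
    from integral_swap_continuous[OF this] show ?thesis by simp
  qed
  also have "\<dots> = integral {0..h} (\<lambda>\<theta>. integral {s..t} (\<lambda>r. G (r + h) (r + \<theta>)) - integral {s..t} (\<lambda>r. G r (r + \<theta>)))"
    by (intro integral_cong Henstock_Kurzweil_Integration.integral_diff integrable_continuous_interval continuous_intros)
  also have "\<dots> = integral {0..h} (\<lambda>\<theta>. integral {s..t} (\<lambda>r. G (r + h) (r + \<theta>))) - integral {0..h} (\<lambda>\<theta>. integral {s..t} (\<lambda>r. G r (r + \<theta>)))"
    by (intro Henstock_Kurzweil_Integration.integral_diff i2 i3)
  \<comment> \<open>The reflection \<theta> \<mapsto> h - \<theta>, carried out as a sign change
    followed by a shift.\<close>
  also have "integral {0..h} (\<lambda>\<theta>. integral {s..t} (\<lambda>r. G (r + h) (r + \<theta>))) = integral {0..h} (\<lambda>\<theta>. integral {s..t} (\<lambda>r. G (r + h) (r + h - \<theta>)))"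
  proof -
    let ?f = "\<lambda>\<theta>. integral {s..t} (\<lambda>r. G (r + h) (r + \<theta>))"
    have "integral {0..h} ?f = integral {- h..- 0} (\<lambda>x. ?f (- x))"
      using Henstock_Kurzweil_Integration.integral_reflect_real[of h 0 ?f] by simp
    also have "\<dots> = integral {- h + h..0 + h} (\<lambda>x. ?f (h - x))"
    proof -
      have "continuous_on {- h + h..0 + h} (\<lambda>x. ?f (h - x))"
        using ci[OF c1] by (simp add: algebra_simps)
      from integral_shift[OF this] show ?thesis by (simp add: o_def)
    qed
    finally show ?thesis by (simp add: algebra_simps)
  qed
  also have "\<dots> - integral {0..h} (\<lambda>\<theta>. integral {s..t} (\<lambda>r. G r (r + \<theta>))) = integral {0..h} D"
    unfolding D_def by (intro Henstock_Kurzweil_Integration.integral_diff[symmetric] i1 i2)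
  finally show "integral {s..t} (\<lambda>r. integral {r..r + h} (\<lambda>q. G (r + h) q - G r q)) = integral {0..h} D" .
  show "D \<theta> = integral {t..t + (h - \<theta>)} (\<lambda>\<rho>. G \<rho> (\<rho> + \<theta>)) - integral {s..s + (h - \<theta>)} (\<lambda>\<rho>. G \<rho> (\<rho> + \<theta>))"
    if "0 \<le> \<theta>" "\<theta> \<le> h"
  proof -
    \<comment> \<open>For fixed \<open>\<theta>\<close> this is the one function that both terms of
      \<open>D\<close> integrate.\<close>
    let ?g = "\<lambda>\<rho>. G \<rho> (\<rho> + \<theta>)" and ?k = "h - \<theta>"
    have cg: "continuous_on A ?g" for A
      by (intro continuous_intros)
    have ig: "?g integrable_on {c..d}" for c d
      by (intro integrable_continuous_interval cg)
    have "integral {s..t} (\<lambda>r. G (r + h) (r + h - \<theta>)) = integral {s..t} (?g \<circ> (\<lambda>r. r + ?k))"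
      by (intro integral_cong) (simp add: sym[of "_ + h" "_ + h - \<theta>"] algebra_simps)
    also have "\<dots> = integral {s + ?k..t + ?k} ?g"
      by (intro integral_shift cg)
    finally have "D \<theta> = integral {s + ?k..t + ?k} ?g - integral {s..t} ?g"
      by (simp add: D_def)
    moreover have "integral {s..s + ?k} ?g + integral {s + ?k..t + ?k} ?g = integral {s..t + ?k} ?g"
      using that \<open>s \<le> t\<close> by (intro Henstock_Kurzweil_Integration.integral_combine ig) auto
    moreover have "integral {s..t} ?g + integral {t..t + ?k} ?g = integral {s..t + ?k} ?g"
      using that \<open>s \<le> t\<close> by (intro Henstock_Kurzweil_Integration.integral_combine ig) auto
    ultimately show ?thesis by linarith
  qed
qed

text \<open>A rigorous substitute for differentiating half of \<open>G t t\<close> when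
  \<open>G\<close> is merely continuous: each end layer has length \<open>h - \<theta>\<close> and
  nearly constant integrand, and the integral of \<open>h - \<theta>\<close> over
  \<open>[0, h]\<close> is half of \<open>h\<^sup>2\<close>.\<close>

lemma symmetric_kernel_limit:
  fixes G :: "real \<Rightarrow> real \<Rightarrow> real"
  assumes cont: "continuous_on UNIV (\<lambda>z. G (fst z) (snd z))" and sym: "\<And>x y. G x y = G y x"
    and "s \<le> t"
  shows "((\<lambda>h. 1 / h\<^sup>2 * integral {s..t} (\<lambda>r. integral {r..r + h} (\<lambda>q. G (r + h) q - G r q)))
     \<longlongrightarrow> (G t t - G s s) / 2) (at_right 0)"
proof (rule tendstoI)
  fix e :: real assume "e > 0"
  have "\<exists>d>0. \<forall>x y. \<bar>x - c\<bar> < d \<longrightarrow> \<bar>y - c\<bar> < d \<longrightarrow> \<bar>G x y - G c c\<bar> < e / 3" for c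
  proof -
    have "isCont (\<lambda>z. G (fst z) (snd z)) (c, c)"
      using cont by (simp add: continuous_on_eq_continuous_at)
    then obtain d where d: "d > 0" "\<And>z. dist z (c, c) < d \<Longrightarrow> \<bar>G (fst z) (snd z) - G c c\<bar> < e / 3"
      using \<open>e > 0\<close> unfolding continuous_at_eps_delta by (metis dist_real_def divide_pos_pos fst_conv snd_conv zero_less_numeral)
    have "dist (x, y) (c, c) < d" if "\<bar>x - c\<bar> < d / 2" "\<bar>y - c\<bar> < d / 2" for x y
      using that sqrt_sum_squares_le_sum_abs[of "x - c" "y - c"] by (simp add: dist_Pair_Pair dist_real_def)
    then show ?thesis
      using d by (intro exI[of _ "d / 2"]) fastforce
  qed
  then obtain d1 d2 where d1: "d1 > 0" "\<And>x y. \<bar>x - t\<bar> < d1 \<Longrightarrow> \<bar>y - t\<bar> < d1 \<Longrightarrow> \<bar>G x y - G t t\<bar> < e / 3"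
    and d2: "d2 > 0" "\<And>x y. \<bar>x - s\<bar> < d2 \<Longrightarrow> \<bar>y - s\<bar> < d2 \<Longrightarrow> \<bar>G x y - G s s\<bar> < e / 3"
    by metis
  have "\<forall>\<^sub>F h in at_right 0. h \<in> {0<..<min d1 d2}"
    using d1(1) d2(1) by (intro eventually_at_right_real) auto
  then show "\<forall>\<^sub>F h in at_right 0. dist (1 / h\<^sup>2 * integral {s..t} (\<lambda>r. integral {r..r + h} (\<lambda>q. G (r + h) q - G r q)))
       ((G t t - G s s) / 2) < e"
  proof eventually_elim
    case (elim h)
    then have h: "h > 0" "h < d1" "h < d2" by auto
    define D where "D = (\<lambda>\<theta>. integral {s..t} (\<lambda>r. G (r + h) (r + h - \<theta>)) - integral {s..t} (\<lambda>r. G r (r + \<theta>)))"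
    note D = symmetric_kernel_double_integral[OF cont sym \<open>s \<le> t\<close> h(1), folded D_def]
    \<comment> \<open>Each of the two layers contributes an error of at most e/3 times
      \<open>h\<close>; integrated over \<open>[0, h]\<close> and divided by
      \<open>h\<^sup>2\<close> this leaves 2e/3, strictly below \<open>e\<close>.\<close>
    have part: "\<bar>integral {c..c + (h - \<theta>)} (\<lambda>\<rho>. G \<rho> (\<rho> + \<theta>)) - (h - \<theta>) * G c c\<bar> \<le> e / 3 * h"
      if \<theta>: "0 \<le> \<theta>" "\<theta> \<le> h" and c: "\<And>x y. \<bar>x - c\<bar> \<le> h \<Longrightarrow> \<bar>y - c\<bar> \<le> h \<Longrightarrow> \<bar>G x y - G c c\<bar> < e / 3" for c \<theta>
    proof -
      have int: "(\<lambda>\<rho>. G \<rho> (\<rho> + \<theta>)) integrable_on {c..c + (h - \<theta>)}"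
        by (intro integrable_continuous_interval continuous_on_compose2[OF cont, of _ "\<lambda>x. (x, x + \<theta>)", simplified] continuous_intros)
      have "integral {c..c + (h - \<theta>)} (\<lambda>\<rho>. G \<rho> (\<rho> + \<theta>)) - (h - \<theta>) * G c c
          = integral {c..c + (h - \<theta>)} (\<lambda>\<rho>. G \<rho> (\<rho> + \<theta>) - G c c)"
        using \<theta> int by (subst Henstock_Kurzweil_Integration.integral_diff) auto
      also have "norm \<dots> \<le> e / 3 * (c + (h - \<theta>) - c)"
      proof (rule integral_bound)
        show "continuous_on {c..c + (h - \<theta>)} (\<lambda>\<rho>. G \<rho> (\<rho> + \<theta>) - G c c)"
          by (intro continuous_intros continuous_on_compose2[OF cont, of _ "\<lambda>x. (x, x + \<theta>)", simplified])
        show "norm (G \<rho> (\<rho> + \<theta>) - G c c) \<le> e / 3" if "\<rho> \<in> {c..c + (h - \<theta>)}" for \<rho>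
          using c[of \<rho> "\<rho> + \<theta>"] that \<theta> by auto
      qed (use \<theta> in auto)
      also have "\<dots> \<le> e / 3 * h"
        using \<theta> \<open>e > 0\<close> by (intro mult_left_mono) auto
      finally show ?thesis by simp
    qed
    have hint: "((\<lambda>\<theta>. (h - \<theta>) * (G t t - G s s)) has_integral (h\<^sup>2 / 2) * (G t t - G s s)) {0..h}"
    proof -
      have "((\<lambda>\<theta>. h - \<theta>) has_integral (h * h - h\<^sup>2 / 2) - (h * 0 - 0\<^sup>2 / 2)) {0..h}"
        using h by (intro fundamental_theorem_of_calculus)
          (auto intro!: derivative_eq_intros simp: has_real_derivative_iff_has_vector_derivative[symmetric])
      then have "((\<lambda>\<theta>. h - \<theta>) has_integral h\<^sup>2 / 2) {0..h}"
        by (simp add: power2_eq_square)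
      then show ?thesis
        by (rule has_integral_mult_left)
    qed
    have "\<bar>integral {0..h} D - (h\<^sup>2 / 2) * (G t t - G s s)\<bar> = \<bar>integral {0..h} (\<lambda>\<theta>. D \<theta> - (h - \<theta>) * (G t t - G s s))\<bar>"
      using Henstock_Kurzweil_Integration.integral_diff[OF D(1) has_integral_integrable[OF hint]]
        integral_unique[OF hint] by (simp only:)
    also have "\<dots> \<le> integral {0..h} (\<lambda>\<theta>. 2 * (e / 3 * h))"
      unfolding real_norm_def[symmetric]
    proof (rule integral_norm_bound_integral)
      show "(\<lambda>\<theta>. D \<theta> - (h - \<theta>) * (G t t - G s s)) integrable_on {0..h}"
        using D(1) hint by (intro integrable_diff) (auto simp: has_integral_integrable)
      fix \<theta> assume "\<theta> \<in> {0..h}"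
      then have \<theta>: "0 \<le> \<theta>" "\<theta> \<le> h" by auto
      have "(h - \<theta>) * (G t t - G s s) = (h - \<theta>) * G t t - (h - \<theta>) * G s s"
        by (rule right_diff_distrib)
      moreover have "\<bar>integral {t..t + (h - \<theta>)} (\<lambda>\<rho>. G \<rho> (\<rho> + \<theta>)) - (h - \<theta>) * G t t\<bar> \<le> e / 3 * h"
        using h by (intro part[OF \<theta>] d1(2)) auto
      moreover have "\<bar>integral {s..s + (h - \<theta>)} (\<lambda>\<rho>. G \<rho> (\<rho> + \<theta>)) - (h - \<theta>) * G s s\<bar> \<le> e / 3 * h"
        using h by (intro part[OF \<theta>] d2(2)) auto
      ultimately show "norm (D \<theta> - (h - \<theta>) * (G t t - G s s)) \<le> 2 * (e / 3 * h)"
        using D(3)[OF \<theta>] unfolding real_norm_def D_def by linarith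
    qed auto
    also have "\<dots> = 2 * (e / 3) * h\<^sup>2"
      using h by (simp add: power2_eq_square)
    finally have "\<bar>integral {0..h} D - (h\<^sup>2 / 2) * (G t t - G s s)\<bar> / h\<^sup>2 \<le> 2 * (e / 3)"
      using h by (simp add: divide_le_eq)
    moreover have "\<bar>integral {0..h} D - (h\<^sup>2 / 2) * (G t t - G s s)\<bar> / h\<^sup>2 = \<bar>1 / h\<^sup>2 * integral {0..h} D - (G t t - G s s) / 2\<bar>"
    proof -
      have "1 / h\<^sup>2 * integral {0..h} D - (G t t - G s s) / 2 = (integral {0..h} D - (h\<^sup>2 / 2) * (G t t - G s s)) / h\<^sup>2"
        using h by (simp add: field_simps)
      then show ?thesis by (simp add: abs_divide)
    qed
    ultimately show ?case
      using \<open>e > 0\<close> unfolding D(2) by (simp add: dist_real_def)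
  qed
qed


lemma clamp_Icc:
  fixes f :: "real \<Rightarrow> real \<Rightarrow> 'a::topological_space"
  assumes "continuous_on ({a..b} \<times> {a..b}) (\<lambda>z. f (fst z) (snd z))" "a \<le> b"
  shows "continuous_on UNIV (\<lambda>z. f (max a (min b (fst z))) (max a (min b (snd z))))"
  using assms(2)
  by (intro continuous_on_compose2[OF assms(1), of _ "\<lambda>z. (max a (min b (fst z)), max a (min b (snd z)))", simplified]
      continuous_intros) auto

text \<open>The scheme shared by the fluid and the solid. Hypothesis \<open>J\<close> is the weak
  equation tested with a window average, \<open>lim\<close> says that the windowed source terms
  converge once divided by \<open>h\<^sup>2\<close>. Because windows of length \<open>h\<close> have
  to fit into \<open>[a, b]\<close>, the identity is first obtained for end times below
  \<open>b\<close>.\<close>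

lemma kernel_energy_identity:
  fixes G :: "real \<Rightarrow> real \<Rightarrow> real"
  assumes "a < b"
    and cont: "continuous_on ({a..b} \<times> {a..b}) (\<lambda>z. G (fst z) (snd z))"
    and sym: "\<And>x y. x \<in> {a..b} \<Longrightarrow> y \<in> {a..b} \<Longrightarrow> G x y = G y x"
    and J: "\<And>r h. a \<le> r \<Longrightarrow> 0 < h \<Longrightarrow> r + h \<le> b \<Longrightarrow> (LINT q:{r..r + h}|lborel. G (r + h) q - G r q) = J h r"
    and lim: "\<And>t h. a \<le> t \<Longrightarrow> t < b \<Longrightarrow> h \<longlonglongrightarrow> 0 \<Longrightarrow> (\<And>i. 0 < h i \<and> t + h i \<le> b) \<Longrightarrow>
       (\<lambda>i. 1 / (h i)\<^sup>2 * (LINT r:{a..t}|lborel. J (h i) r)) \<longlonglongrightarrow> (LINT r:{a..t}|lborel. j r)"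
    and j: "set_integrable lborel {a..b} j"
  shows "(G b b - G a a) / 2 = (LINT r:{a..b}|lborel. j r)"
proof -
  \<comment> \<open>Clamping extends the kernel continuously and symmetrically to the whole plane.
    The windows used below stay inside \<open>[a, b]\<close>, where nothing changes.\<close>
  define c where "c = (\<lambda>x. max a (min b x :: real))"
  define G' where "G' = (\<lambda>x y. G (c x) (c y))"
  have c: "c x = x" if "x \<in> {a..b}" for x
    using that by (auto simp: c_def)
  have c_in: "c x \<in> {a..b}" for x
    using \<open>a < b\<close> by (auto simp: c_def)
  have cont': "continuous_on UNIV (\<lambda>z. G' (fst z) (snd z))"
    unfolding G'_def c_def using clamp_Icc[OF cont] \<open>a < b\<close> by simp
  note [continuous_intros] = continuous_on_compose2[OF cont', of _ "\<lambda>x. (f x, g x)" for f g, simplified]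
  have sym': "G' x y = G' y x" for x y
    unfolding G'_def by (intro sym c_in)
  have lt: "(G t t - G a a) / 2 = (LINT r:{a..t}|lborel. j r)" if t: "a \<le> t" "t < b" for t
  proof -
    \<comment> \<open>This choice keeps every window that starts at or before \<open>t\<close>
      inside \<open>[a, b]\<close>, already for \<open>i = 0\<close>.\<close>
    define h where "h = (\<lambda>i. (b - t) / real (Suc i))"
    have h: "h \<longlonglongrightarrow> 0"
      unfolding h_def using LIMSEQ_Suc[OF lim_const_over_n[of "b - t"]] by simp
    have h0: "0 < h i" "t + h i \<le> b" for i
    proof -
      have "(b - t) / real (Suc i) \<le> (b - t) / 1"
        using t by (intro divide_left_mono) auto
      then show "0 < h i" "t + h i \<le> b"
        using t by (auto simp: h_def)
    qed
    have "filterlim h (at_right 0) sequentially"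
      by (intro tendsto_imp_filterlim_at_right h always_eventually allI h0)
    from filterlim_compose[OF symmetric_kernel_limit[OF cont' sym' t(1)] this]
    have "(\<lambda>i. 1 / (h i)\<^sup>2 * integral {a..t} (\<lambda>r. integral {r..r + h i} (\<lambda>q. G' (r + h i) q - G' r q))) \<longlonglongrightarrow> (G' t t - G' a a) / 2" .
    also have "(\<lambda>i. 1 / (h i)\<^sup>2 * integral {a..t} (\<lambda>r. integral {r..r + h i} (\<lambda>q. G' (r + h i) q - G' r q)))
        = (\<lambda>i. 1 / (h i)\<^sup>2 * (LINT r:{a..t}|lborel. J (h i) r))"
    proof
      fix i
      let ?I = "\<lambda>r. integral {r..r + h i} (\<lambda>q. G' (r + h i) q - G' r q)"
      have IJ: "?I r = J (h i) r" if r: "r \<in> {a..t}" for r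
      proof -
        have "set_integrable lborel {r..r + h i} (\<lambda>q. G' (r + h i) q - G' r q)"
          by (intro borel_integrable_atLeastAtMost' continuous_intros)
        then have "?I r = (LINT q:{r..r + h i}|lborel. G' (r + h i) q - G' r q)"
          by (rule set_borel_integral_eq_integral(2)[symmetric])
        also have "\<dots> = (LINT q:{r..r + h i}|lborel. G (r + h i) q - G r q)"
          using r h0[of i] by (intro set_lebesgue_integral_cong) (auto simp: G'_def c)
        also have "\<dots> = J (h i) r"
          using r h0[of i] by (intro J) auto
        finally show ?thesis .
      qed
      have "?I r = integral {0..h i} (\<lambda>\<theta>. G' (r + h i) (r + \<theta>) - G' r (r + \<theta>))" for r
      proof -
        have "continuous_on {0 + r..h i + r} (\<lambda>q. G' (r + h i) q - G' r q)"
          by (intro continuous_intros)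
        from integral_shift[OF this] show ?thesis
          by (simp add: o_def add.commute)
      qed
      moreover have "continuous_on {a..t} (\<lambda>r. integral {0..h i} (\<lambda>\<theta>. G' (r + h i) (r + \<theta>) - G' r (r + \<theta>)))"
        using integral_continuous_on_param[of "{a..t}" 0 "h i" "\<lambda>r \<theta>. G' (r + h i) (r + \<theta>) - G' r (r + \<theta>)"]
        by (simp add: split_beta' continuous_intros)
      ultimately have "set_integrable lborel {a..t} ?I"
        by (intro borel_integrable_atLeastAtMost') simp
      then have "integral {a..t} ?I = (LINT r:{a..t}|lborel. ?I r)"
        by (rule set_borel_integral_eq_integral(2)[symmetric])
      also have "\<dots> = (LINT r:{a..t}|lborel. J (h i) r)"
        using IJ by (intro set_lebesgue_integral_cong) auto
      finally show "1 / (h i)\<^sup>2 * integral {a..t} ?I = 1 / (h i)\<^sup>2 * (LINT r:{a..t}|lborel. J (h i) r)"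
        by simp
    qed
    finally have "(G' t t - G' a a) / 2 = (LINT r:{a..t}|lborel. j r)"
      using lim[OF t h] h0 by (intro LIMSEQ_unique) auto
    then show ?thesis
      using t by (simp add: G'_def c)
  qed
  have ab: "(G' t t - G' a a) / 2 = integral {a..t} j" if "t \<in> {a..<b}" for t
  proof -
    have "set_integrable lborel {a..t} j"
      using that by (intro set_integrable_subset[OF j]) auto
    then show ?thesis
      using lt[of t] that by (auto simp: G'_def c set_borel_integral_eq_integral(2))
  qed
  \<comment> \<open>Both sides are continuous in the end time, so the identity passes to
    \<open>b\<close>.\<close>
  have "continuous_on {a..b} (\<lambda>t. integral {a..t} j)"
    using set_borel_integral_eq_integral(1)[OF j] by (rule indefinite_integral_continuous_1)
  then have "((\<lambda>t. integral {a..t} j) \<longlongrightarrow> integral {a..b} j) (at b within {a..b})"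
    using \<open>a < b\<close> by (auto simp: continuous_on_def)
  then have "((\<lambda>t. integral {a..t} j) \<longlongrightarrow> integral {a..b} j) (at b within {a..<b})"
    by (rule tendsto_within_subset) auto
  then have lim1: "((\<lambda>t. (G' t t - G' a a) / 2) \<longlongrightarrow> integral {a..b} j) (at b within {a..<b})"
    by (rule Lim_transform_within[where d = 1]) (auto simp: ab)
  have "continuous_on UNIV (\<lambda>t. (G' t t - G' a a) / 2)"
    by (intro continuous_intros) auto
  then have "((\<lambda>t. (G' t t - G' a a) / 2) \<longlongrightarrow> (G' b b - G' a a) / 2) (at b)"
    by (auto simp: continuous_on_def)
  then have "((\<lambda>t. (G' t t - G' a a) / 2) \<longlongrightarrow> (G' b b - G' a a) / 2) (at b within {a..<b})"
    by (rule tendsto_within_subset) simp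
  moreover have "at b within {a..<b} \<noteq> bot"
    using \<open>a < b\<close> by (simp add: trivial_limit_within islimpt_Ico)
  ultimately have "(G' b b - G' a a) / 2 = integral {a..b} j"
    using lim1 tendsto_unique by blast
  then show ?thesis
    using \<open>a < b\<close> set_borel_integral_eq_integral(2)[OF j] by (simp add: G'_def c)
qed


section \<open>Square integrable functions of time and space\<close>

text \<open>Extension by zero in time. It places functions from different time intervals on the
  single product space \<open>lborel \<Otimes>\<^sub>M M\<close>, where translations and window
  averages are available.\<close>

definition cut :: "real \<Rightarrow> real \<Rightarrow> (real \<Rightarrow> 'a \<Rightarrow> 'b::euclidean_space) \<Rightarrow> real \<Rightarrow> 'a \<Rightarrow> 'b" where
  "cut a b f t x = indicator {a..b} t *\<^sub>R f t x"

lemma cut_in [simp]: "t \<in> {a..b} \<Longrightarrow> cut a b f t = f t"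
  and cut_out [simp]: "t \<notin> {a..b} \<Longrightarrow> cut a b f t = (\<lambda>x. 0)"
  by (auto simp: cut_def)

lemma cut_measurable_iff:
  "case_prod (cut a b f) \<in> borel_measurable (lborel \<Otimes>\<^sub>M M) \<longleftrightarrow>
   case_prod f \<in> borel_measurable (restrict_space lborel {a..b} \<Otimes>\<^sub>M M)"
proof
  assume [measurable]: "case_prod f \<in> borel_measurable (restrict_space lborel {a..b} \<Otimes>\<^sub>M M)"
  let ?A = "{z \<in> space (lborel \<Otimes>\<^sub>M M). fst z \<in> {a..b}}"
  have A: "?A \<in> sets (lborel \<Otimes>\<^sub>M M)"
    by measurable
  have fst: "fst \<in> measurable (restrict_space (lborel \<Otimes>\<^sub>M M) ?A) (restrict_space lborel {a..b})"
    by (intro measurable_restrict_space2 measurable_restrict_space1) (auto simp: space_restrict_space)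
  have snd: "snd \<in> measurable (restrict_space (lborel \<Otimes>\<^sub>M M) ?A) M"
    by (intro measurable_restrict_space1) auto
  have "(\<lambda>z. case_prod f (fst z, snd z)) \<in> borel_measurable (restrict_space (lborel \<Otimes>\<^sub>M M) ?A)"
    by (rule measurable_compose[OF measurable_Pair[OF fst snd]]) simp
  then have "(\<lambda>z. indicator ?A z *\<^sub>R case_prod f (fst z, snd z)) \<in> borel_measurable (lborel \<Otimes>\<^sub>M M)"
    using A by (subst (asm) borel_measurable_restrict_space_iff) auto
  then show "case_prod (cut a b f) \<in> borel_measurable (lborel \<Otimes>\<^sub>M M)"
    by (rule measurable_cong[THEN iffD1, rotated]) (auto simp: cut_def split: split_indicator)
next
  assume [measurable]: "case_prod (cut a b f) \<in> borel_measurable (lborel \<Otimes>\<^sub>M M)"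
  have id: "fst \<in> measurable (restrict_space lborel {a..b} \<Otimes>\<^sub>M M) lborel"
    by (rule measurable_compose[OF measurable_fst measurable_restrict_space1]) simp
  have "(\<lambda>z. case_prod (cut a b f) (fst z, snd z)) \<in> borel_measurable (restrict_space lborel {a..b} \<Otimes>\<^sub>M M)"
    by (rule measurable_compose[OF measurable_Pair[OF id measurable_snd]]) simp
  then show "case_prod f \<in> borel_measurable (restrict_space lborel {a..b} \<Otimes>\<^sub>M M)"
    by (rule measurable_cong[THEN iffD1, rotated]) (auto simp: cut_def space_pair_measure space_restrict_space split: split_indicator)
qed

lemma L2nn_cut:
  assumes "sigma_finite_measure M" "case_prod f \<in> borel_measurable (restrict_space lborel {a..b} \<Otimes>\<^sub>M M)"
  shows "L2nn (restrict_space lborel {a..b} \<Otimes>\<^sub>M M) (case_prod f) = L2nn (lborel \<Otimes>\<^sub>M M) (case_prod (cut a b f))"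
proof -
  have r: "sigma_finite_measure (restrict_space lborel {a..b})"
    by (rule sigma_finite_measure_restrict_space[OF sigma_finite_lborel]) simp
  have "L2nn (restrict_space lborel {a..b} \<Otimes>\<^sub>M M) (case_prod f) = (\<integral>\<^sup>+t. L2nn M (f t) \<partial>restrict_space lborel {a..b})"
    by (rule L2nn_pair(1)[OF assms(1) r assms(2)])
  also have "\<dots> = (\<integral>\<^sup>+t. L2nn M (f t) * indicator {a..b} t \<partial>lborel)"
    by (rule nn_integral_restrict_space) simp
  also have "\<dots> = (\<integral>\<^sup>+t. L2nn M (cut a b f t) \<partial>lborel)"
    by (intro nn_integral_cong) (auto simp: cut_def L2nn_def split: split_indicator)
  also have "\<dots> = L2nn (lborel \<Otimes>\<^sub>M M) (case_prod (cut a b f))"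
    using assms by (intro L2nn_pair(1)[symmetric] sigma_finite_lborel) (auto simp: cut_measurable_iff)
  finally show ?thesis .
qed

lemma L2L2_iff:
  assumes "sigma_finite_measure M"
  shows "L2L2 a b M f \<longleftrightarrow> sq_integrable (lborel \<Otimes>\<^sub>M M) (case_prod (cut a b f))"
  using L2nn_cut[OF assms, of f a b] unfolding L2L2_def sq_integrable_iff by (auto simp: cut_measurable_iff)

lemma L2L2_diff:
  assumes "L2L2 a b M f" "L2L2 a b M g"
  shows "L2L2 a b M (\<lambda>t x. f t x - g t x)"
  using sq_integrable_diff[of _ "case_prod f" "case_prod g"] assms unfolding L2L2_def by (simp add: split_beta')

lemma L2L2_linear:
  assumes "bounded_linear L" "L2L2 a b M f"
  shows "L2L2 a b M (\<lambda>t x. L (f t x))"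
  using sq_integrable_linear[OF assms(1), of _ "case_prod f"] assms unfolding L2L2_def by (simp add: split_beta')

lemma L2L2_subinterval:
  assumes M: "sigma_finite_measure M" and f: "L2L2 a b M f" and "a \<le> a'" "b' \<le> b"
  shows "L2L2 a' b' M f"
proof -
  have "sq_integrable (lborel \<Otimes>\<^sub>M M) (case_prod (cut a' b' f))"
  proof (rule sq_integrable_bound[where C = 1])
    show f': "sq_integrable (lborel \<Otimes>\<^sub>M M) (case_prod (cut a b f))"
      using f by (simp add: L2L2_iff[OF M])
    have [measurable]: "case_prod (cut a b f) \<in> borel_measurable (lborel \<Otimes>\<^sub>M M)"
      using f' by (simp add: sq_integrable_def)
    have "case_prod (cut a' b' f) = (\<lambda>z. if a' \<le> fst z \<and> fst z \<le> b' then case_prod (cut a b f) z else 0)"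
      using assms by (auto simp: cut_def split: split_indicator)
    then show "case_prod (cut a' b' f) \<in> borel_measurable (lborel \<Otimes>\<^sub>M M)"
      by simp
  qed (use assms in \<open>auto simp: cut_def split: split_indicator\<close>)
  then show ?thesis
    by (simp add: L2L2_iff[OF M])
qed

lemma L2L2_section:
  assumes f: "L2L2 a b M f" and t: "t \<in> {a..b}"
  shows "f t \<in> borel_measurable M"
proof -
  have "case_prod f \<in> borel_measurable (restrict_space lborel {a..b} \<Otimes>\<^sub>M M)"
    using f by (simp add: L2L2_def sq_integrable_def)
  moreover have "t \<in> space (restrict_space lborel {a..b})"
    using t by (simp add: space_restrict_space)
  ultimately have "(\<lambda>x. case_prod f (t, x)) \<in> borel_measurable M"
    by (intro measurable_compose[OF measurable_Pair1']) 
  then show ?thesis by simp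
qed

lemma ae_time_iff: "ae_time a b P \<longleftrightarrow> (AE t in lborel. t \<in> {a..b} \<longrightarrow> P t)"
  unfolding ae_time_def by (subst AE_restrict_space_iff) auto

lemma ae_time_subinterval: "ae_time a b P \<Longrightarrow> a \<le> a' \<Longrightarrow> b' \<le> b \<Longrightarrow> ae_time a' b' P"
  unfolding ae_time_iff by (elim AE_mp) (auto intro!: AE_I2)

lemma ae_time_conj: "ae_time a b P \<Longrightarrow> ae_time a b Q \<Longrightarrow> ae_time a b (\<lambda>t. P t \<and> Q t)"
  unfolding ae_time_def by auto

lemma L2L2_ae_sq_integrable:
  assumes M: "sigma_finite_measure M" and f: "L2L2 a b M f"
  shows "ae_time a b (\<lambda>t. sq_integrable M (f t))"
proof -
  have [measurable]: "case_prod f \<in> borel_measurable (restrict_space lborel {a..b} \<Otimes>\<^sub>M M)"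
    using f by (simp add: L2L2_def sq_integrable_def)
  interpret sigma_finite_measure M by fact
  have r: "sigma_finite_measure (restrict_space lborel {a..b})"
    by (rule sigma_finite_measure_restrict_space[OF sigma_finite_lborel]) simp
  have "(\<integral>\<^sup>+t. L2nn M (f t) \<partial>restrict_space lborel {a..b}) < \<infinity>"
    using f L2nn_pair(1)[OF M r, of f] by (simp add: L2L2_def sq_integrable_iff)
  then have "AE t in restrict_space lborel {a..b}. L2nn M (f t) \<noteq> \<infinity>"
    by (intro nn_integral_PInf_AE) (auto simp: L2nn_def)
  then show ?thesis
    unfolding ae_time_iff ae_time_def[symmetric]
    by (elim AE_mp) (use L2L2_section[OF f] in \<open>auto intro!: AE_I2 simp: sq_integrable_iff less_top\<close>)
qed

lemma
  assumes M: "sigma_finite_measure M" and f: "L2L2 a b M f" and g: "L2L2 a b M g"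
  shows L2L2_ip_integrable: "set_integrable lborel {a..b} (\<lambda>t. L2ip M (f t) (g t))"
    and L2L2_ip_integral: "(LINT t:{a..b}|lborel. L2ip M (f t) (g t)) = L2ip (lborel \<Otimes>\<^sub>M M) (case_prod (cut a b f)) (case_prod (cut a b g))"
proof -
  interpret sigma_finite_measure M by fact
  interpret pair_sigma_finite lborel M ..
  have int: "integrable (lborel \<Otimes>\<^sub>M M) (\<lambda>(t, x). cut a b f t x \<bullet> cut a b g t x)"
    using sq_integrable_inner[of "lborel \<Otimes>\<^sub>M M" "case_prod (cut a b f)" "case_prod (cut a b g)"] f g
    by (simp add: L2L2_iff[OF M] split_beta')
  have eq: "indicator {a..b} t *\<^sub>R L2ip M (f t) (g t) = (\<integral>x. cut a b f t x \<bullet> cut a b g t x \<partial>M)" for t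
    by (auto simp: cut_def L2ip_def split: split_indicator)
  show "set_integrable lborel {a..b} (\<lambda>t. L2ip M (f t) (g t))"
    unfolding set_integrable_def eq using integrable_fst'[OF int] by simp
  show "(LINT t:{a..b}|lborel. L2ip M (f t) (g t)) = L2ip (lborel \<Otimes>\<^sub>M M) (case_prod (cut a b f)) (case_prod (cut a b g))"
    unfolding set_lebesgue_integral_def eq using integral_fst'[OF int] by (simp add: L2ip_def split_beta')
qed

lemma L2L2_sq_integral:
  assumes M: "sigma_finite_measure M" and f: "L2L2 a b M f"
  shows "(LINT t:{a..b}|lborel. L2sq M (f t)) = L2sq (lborel \<Otimes>\<^sub>M M) (case_prod (cut a b f))"
  using L2L2_ip_integral[OF M f f] by (simp add: L2ip_self)

lemma L2L2_const:
  assumes M: "sigma_finite_measure M" and \<phi>: "sq_integrable M \<phi>"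
  shows "L2L2 a b M (\<lambda>t. \<phi>)"
proof -
  interpret sigma_finite_measure M by fact
  have [measurable]: "\<phi> \<in> borel_measurable M"
    using \<phi> by (simp add: sq_integrable_def)
  have m: "case_prod (\<lambda>t. \<phi>) \<in> borel_measurable (restrict_space lborel {a..b} \<Otimes>\<^sub>M M)"
    by measurable
  have r: "sigma_finite_measure (restrict_space lborel {a..b})"
    by (rule sigma_finite_measure_restrict_space[OF sigma_finite_lborel]) simp
  have "L2nn (restrict_space lborel {a..b} \<Otimes>\<^sub>M M) (case_prod (\<lambda>t. \<phi>)) = (\<integral>\<^sup>+t. L2nn M \<phi> \<partial>restrict_space lborel {a..b})"
    by (rule L2nn_pair(1)[OF M r m])
  also have "\<dots> < \<infinity>"
    using \<phi> by (auto simp: sq_integrable_iff emeasure_restrict_space space_restrict_space ennreal_mult_less_top emeasure_lborel_Icc_eq)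
  finally show ?thesis
    using m by (simp add: L2L2_def sq_integrable_iff)
qed

lemma L2ip_pair:
  assumes M: "sigma_finite_measure M"
    and A: "sq_integrable (lborel \<Otimes>\<^sub>M M) (case_prod A)" and B: "sq_integrable (lborel \<Otimes>\<^sub>M M) (case_prod B)"
  shows "L2ip (lborel \<Otimes>\<^sub>M M) (case_prod A) (case_prod B) = (LINT r|lborel. L2ip M (A r) (B r))"
proof -
  interpret sigma_finite_measure M by fact
  interpret pair_sigma_finite lborel M ..
  have "integrable (lborel \<Otimes>\<^sub>M M) (\<lambda>(t, x). A t x \<bullet> B t x)"
    using sq_integrable_inner[OF A B] by (simp add: split_beta')
  from integral_fst'[OF this] show ?thesis
    by (simp add: L2ip_def split_beta')
qed

text \<open>By Tonelli almost every time fibre is square integrable, hence integrable on a bounded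
  interval. Pointwise time integrals may be split linearly at such points.\<close>

lemma L2L2_ae_set_integrable:
  assumes M: "sigma_finite_measure M" and f: "L2L2 a b M f"
  shows "AE x in M. set_integrable lborel {a..b} (\<lambda>\<tau>. f \<tau> x)"
proof -
  interpret sigma_finite_measure M by fact
  let ?F = "cut a b f"
  have [measurable]: "case_prod ?F \<in> borel_measurable (lborel \<Otimes>\<^sub>M M)"
    and fin: "L2nn (lborel \<Otimes>\<^sub>M M) (case_prod ?F) < \<infinity>"
    using f by (auto simp: L2L2_iff[OF M] sq_integrable_iff)
  have "(\<integral>\<^sup>+x. L2nn lborel (\<lambda>r. ?F r x) \<partial>M) < \<infinity>"
    using fin L2nn_pair(2)[OF M sigma_finite_lborel, of ?F] by simp
  then have "AE x in M. L2nn lborel (\<lambda>r. ?F r x) \<noteq> \<infinity>"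
    by (intro nn_integral_PInf_AE) (auto simp: L2nn_def)
  then show ?thesis
    using AE_space
  proof eventually_elim
    case (elim x)
    have "sq_integrable lborel (\<lambda>r. ?F r x)"
      using elim by (auto simp: sq_integrable_iff less_top)
    then have "set_integrable lborel {a..b} (\<lambda>r. ?F r x)"
      by (rule sq_integrable_imp_set_integrable)
    then show ?case
      by (rule set_integrable_cong[THEN iffD1, rotated -1]) auto
  qed
qed

lemma L2nn_time_integral_le:
  assumes M: "sigma_finite_measure M" and f: "L2L2 a b M f" and "a \<le> b"
  shows "L2nn M (\<lambda>x. LINT s:{a..b}|lborel. f s x) \<le> ennreal (b - a) * ennreal (LINT r:{a..b}|lborel. L2sq M (f r))"
proof -
  interpret sigma_finite_measure M by fact
  let ?F = "cut a b f"
  have F: "sq_integrable (lborel \<Otimes>\<^sub>M M) (case_prod ?F)"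
    using f by (simp add: L2L2_iff[OF M])
  then have [measurable]: "case_prod ?F \<in> borel_measurable (lborel \<Otimes>\<^sub>M M)"
    by (simp add: sq_integrable_def)
  have "L2nn M (\<lambda>x. LINT s:{a..b}|lborel. f s x) \<le> (\<integral>\<^sup>+x. ennreal (b - a) * L2nn lborel (\<lambda>s. ?F s x) \<partial>M)"
    unfolding L2nn_def[of M]
  proof (rule nn_integral_mono)
    fix x assume x: "x \<in> space M"
    have "(LINT s:{a..b}|lborel. f s x) = (LINT s:{a..b}|lborel. ?F s x)"
      by (intro set_lebesgue_integral_cong) auto
    then have "ennreal ((norm (LINT s:{a..b}|lborel. f s x))\<^sup>2)
        \<le> ennreal (b - a) * (\<integral>\<^sup>+s\<in>{a..b}. ennreal ((norm (?F s x))\<^sup>2) \<partial>lborel)"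
      using x \<open>a \<le> b\<close> by (auto intro!: norm_set_integral_sq_le)
    also have "(\<integral>\<^sup>+s\<in>{a..b}. ennreal ((norm (?F s x))\<^sup>2) \<partial>lborel) = L2nn lborel (\<lambda>s. ?F s x)"
      unfolding L2nn_def by (intro nn_integral_cong) (auto simp: cut_def split: split_indicator)
    finally show "ennreal ((norm (LINT s:{a..b}|lborel. f s x))\<^sup>2) \<le> ennreal (b - a) * L2nn lborel (\<lambda>s. ?F s x)" .
  qed
  also have "\<dots> = ennreal (b - a) * L2nn (lborel \<Otimes>\<^sub>M M) (case_prod ?F)"
    unfolding L2nn_pair(2)[OF M sigma_finite_lborel \<open>case_prod ?F \<in> _\<close>]
    by (rule nn_integral_cmult) (simp add: L2nn_def)
  also have "L2nn (lborel \<Otimes>\<^sub>M M) (case_prod ?F) = ennreal (LINT r:{a..b}|lborel. L2sq M (f r))"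
    using L2nn_eq_L2sq[OF F] by (simp add: L2L2_sq_integral[OF M f])
  finally show ?thesis .
qed

text \<open>Fubini with a test function frozen in time. It converts a weak equation, integrated over
  a window and tested with a fixed function, into a pairing with the time integral of the
  stress.\<close>

lemma
  assumes M: "sigma_finite_measure M" and f: "L2L2 a b M f" and \<phi>: "sq_integrable M \<phi>" and "a \<le> b"
  shows sq_integrable_time_integral: "sq_integrable M (\<lambda>x. LINT \<tau>:{a..b}|lborel. f \<tau> x)"
    and L2ip_time_integral: "(LINT \<tau>:{a..b}|lborel. L2ip M (f \<tau>) \<phi>) = L2ip M (\<lambda>x. LINT \<tau>:{a..b}|lborel. f \<tau> x) \<phi>"
proof -
  interpret sigma_finite_measure M by fact
  interpret pair_sigma_finite lborel M ..
  let ?F = "cut a b f"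
  have F: "sq_integrable (lborel \<Otimes>\<^sub>M M) (case_prod ?F)"
    using f by (simp add: L2L2_iff[OF M])
  have [measurable]: "case_prod ?F \<in> borel_measurable (lborel \<Otimes>\<^sub>M M)"
    using F by (simp add: sq_integrable_def)
  have eq: "(LINT \<tau>:{a..b}|lborel. f \<tau> x) = (LINT \<tau>|lborel. ?F \<tau> x)" for x
    by (simp add: set_lebesgue_integral_def cut_def)
  have m: "(\<lambda>x. LINT \<tau>|lborel. ?F \<tau> x) \<in> borel_measurable M"
    by measurable
  show sq: "sq_integrable M (\<lambda>x. LINT \<tau>:{a..b}|lborel. f \<tau> x)"
    unfolding sq_integrable_iff
  proof
    show "(\<lambda>x. LINT \<tau>:{a..b}|lborel. f \<tau> x) \<in> borel_measurable M"
      unfolding eq by (rule m)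
    have "L2nn M (\<lambda>x. LINT \<tau>:{a..b}|lborel. f \<tau> x) \<le> ennreal (b - a) * ennreal (LINT r:{a..b}|lborel. L2sq M (f r))"
      by (rule L2nn_time_integral_le[OF M f \<open>a \<le> b\<close>])
    also have "\<dots> < \<infinity>"
      by (simp add: ennreal_mult_less_top)
    finally show "L2nn M (\<lambda>x. LINT \<tau>:{a..b}|lborel. f \<tau> x) < \<infinity>" .
  qed
  let ?P = "cut a b (\<lambda>t. \<phi>)"
  have P: "sq_integrable (lborel \<Otimes>\<^sub>M M) (case_prod ?P)"
    using L2L2_const[OF M \<phi>, of a b] by (simp add: L2L2_iff[OF M])
  have int: "integrable (lborel \<Otimes>\<^sub>M M) (\<lambda>(t, x). ?F t x \<bullet> ?P t x)"
    using sq_integrable_inner[OF F P] by (simp add: split_beta')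
  have "(LINT \<tau>:{a..b}|lborel. L2ip M (f \<tau>) \<phi>) = L2ip (lborel \<Otimes>\<^sub>M M) (case_prod ?F) (case_prod ?P)"
    by (rule L2L2_ip_integral[OF M f L2L2_const[OF M \<phi>]])
  also have "\<dots> = (\<integral>x. \<integral>t. ?F t x \<bullet> ?P t x \<partial>lborel \<partial>M)"
    using integral_snd[OF int] by (simp add: L2ip_def split_beta')
  also have "\<dots> = L2ip M (\<lambda>x. LINT \<tau>:{a..b}|lborel. f \<tau> x) \<phi>"
    unfolding L2ip_def
  proof (rule integral_cong_AE)
    show "(\<lambda>x. \<integral>t. ?F t x \<bullet> ?P t x \<partial>lborel) \<in> borel_measurable M"
      using borel_measurable_integrable[OF integrable_snd[OF int]] by simp
    show "(\<lambda>x. (LINT \<tau>:{a..b}|lborel. f \<tau> x) \<bullet> \<phi> x) \<in> borel_measurable M"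
      using sq \<phi> by (auto simp: sq_integrable_def)
    show "AE x in M. (\<integral>t. ?F t x \<bullet> ?P t x \<partial>lborel) = (LINT \<tau>:{a..b}|lborel. f \<tau> x) \<bullet> \<phi> x"
      using L2L2_ae_set_integrable[OF M f]
    proof eventually_elim
      case (elim x)
      have "(\<integral>t. ?F t x \<bullet> ?P t x \<partial>lborel) = (\<integral>t. ?F t x \<bullet> \<phi> x \<partial>lborel)"
        by (intro Bochner_Integration.integral_cong) (auto simp: cut_def split: split_indicator)
      also have "\<dots> = (\<integral>t. ?F t x \<partial>lborel) \<bullet> \<phi> x"
        using elim by (intro integral_inner_left) (simp add: set_integrable_def cut_def)
      finally show ?case by (simp add: eq)
    qed
  qed
  finally show "(LINT \<tau>:{a..b}|lborel. L2ip M (f \<tau>) \<phi>) = L2ip M (\<lambda>x. LINT \<tau>:{a..b}|lborel. f \<tau> x) \<phi>" .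
qed

text \<open>An extended distance below 1 to a square integrable limit already forces square
  integrability, so the approximants need no separate bound.\<close>

lemma L2nn_tendsto_imp:
  assumes [measurable]: "\<And>i. f i \<in> borel_measurable M" and f0: "sq_integrable M f0"
    and lim: "((\<lambda>i. L2nn M (\<lambda>x. f i x - f0 x)) \<longlongrightarrow> 0) F"
  shows "\<forall>\<^sub>F i in F. sq_integrable M (f i)" and "((\<lambda>i. L2sq M (\<lambda>x. f i x - f0 x)) \<longlongrightarrow> 0) F"
proof -
  have [measurable]: "f0 \<in> borel_measurable M"
    using f0 by (simp add: sq_integrable_def)
  have "\<forall>\<^sub>F i in F. L2nn M (\<lambda>x. f i x - f0 x) < 1"
    using order_tendstoD(2)[OF lim, of 1] by simp
  then show "\<forall>\<^sub>F i in F. sq_integrable M (f i)"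
  proof eventually_elim
    case (elim i)
    then have "sq_integrable M (\<lambda>x. f i x - f0 x)"
      by (auto simp: sq_integrable_iff elim: order_less_trans)
    from sq_integrable_add[OF this f0] show ?case by simp
  qed
  have "((\<lambda>i. enn2real (L2nn M (\<lambda>x. f i x - f0 x))) \<longlongrightarrow> 0) F"
    using lim by (intro tendsto_enn2real) auto
  then show "((\<lambda>i. L2sq M (\<lambda>x. f i x - f0 x)) \<longlongrightarrow> 0) F"
    by (simp add: L2sq_eq_enn2real)
qed

text \<open>The factor \<open>1 / (h i)\<^sup>2\<close> normalises both window integrals to
  averages. These converge in mean square on the product space, and therefore so does their inner
  product.\<close>

lemma L2L2_ip_average_limit:
  assumes M: "sigma_finite_measure M" and F: "L2L2 a b M F" and K: "L2L2 a b M K"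
    and "a \<le> t" and h: "h \<longlonglongrightarrow> 0" "\<And>i. 0 < h i \<and> t + h i \<le> b"
  shows "(\<lambda>i. 1 / (h i)\<^sup>2 * (LINT r:{a..t}|lborel. L2ip M (\<lambda>x. LINT \<tau>:{r..r + h i}|lborel. F \<tau> x)
      (\<lambda>x. LINT \<tau>:{r..r + h i}|lborel. K \<tau> x))) \<longlonglongrightarrow> (LINT r:{a..t}|lborel. L2ip M (F r) (K r))"
proof -
  interpret sigma_finite_measure M by fact
  interpret pair_sigma_finite lborel M ..
  let ?N = "lborel \<Otimes>\<^sub>M M"
  let ?F = "cut a b F" and ?K = "cut a b K"
  let ?mF = "\<lambda>i. moving_average (h i) ?F" and ?mK = "\<lambda>i. moving_average (h i) ?K"
  \<comment> \<open>Cutting one factor to \<open>[a, t]\<close> encodes the range of the outer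
    integral. Windows starting there end before \<open>b\<close>, so they do not see the extension
    by zero.\<close>
  let ?cF = "\<lambda>i. cut a t (?mF i)"
  have t: "t \<le> b" using h(2)[of 0] by simp
  have sF: "sq_integrable ?N (case_prod ?F)" and sK: "sq_integrable ?N (case_prod ?K)"
    and sF': "sq_integrable ?N (case_prod (cut a t F))"
    using F K L2L2_subinterval[OF M F order_refl t] by (simp_all add: L2L2_iff[OF M])
  have [measurable]: "case_prod ?F \<in> borel_measurable ?N" "case_prod ?K \<in> borel_measurable ?N"
    "case_prod (cut a t F) \<in> borel_measurable ?N"
    using sF sK sF' by (auto simp: sq_integrable_def)
  have m: "case_prod (?mF i) \<in> borel_measurable ?N" "case_prod (?mK i) \<in> borel_measurable ?N" for i
    by (rule moving_average_measurable[OF M]; simp)+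
  have cm: "case_prod (?cF i) \<in> borel_measurable ?N" for i
  proof -
    note [measurable] = m(1)[of i]
    have "case_prod (?cF i) = (\<lambda>z. if a \<le> fst z \<and> fst z \<le> t then case_prod (?mF i) z else 0)"
      by (auto simp: cut_def split: split_indicator)
    then show ?thesis by simp
  qed
  have limF: "(\<lambda>i. L2nn ?N (\<lambda>z. case_prod (?cF i) z - case_prod (cut a t F) z)) \<longlonglongrightarrow> 0"
  proof (rule tendsto_sandwich[OF _ _ tendsto_const])
    show "(\<lambda>i. L2nn ?N (\<lambda>(r, x). ?mF i r x - ?F r x)) \<longlonglongrightarrow> 0"
      using h by (intro moving_average_tendsto[OF M sF]) auto
    show "\<forall>\<^sub>F i in sequentially. L2nn ?N (\<lambda>z. case_prod (?cF i) z - case_prod (cut a t F) z) \<le> L2nn ?N (\<lambda>(r, x). ?mF i r x - ?F r x)"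
      using t by (intro always_eventually allI L2nn_mono_AE AE_I2) (auto simp: cut_def split: split_indicator)
  qed auto
  have limK: "(\<lambda>i. L2nn ?N (\<lambda>z. case_prod (?mK i) z - case_prod ?K z)) \<longlonglongrightarrow> 0"
    using moving_average_tendsto[OF M sK, of h] h by (simp add: split_beta')
  note evF = L2nn_tendsto_imp[OF cm sF' limF] and evK = L2nn_tendsto_imp[OF m(2) sK limK]
  have "(\<lambda>i. L2ip ?N (case_prod (?cF i)) (case_prod (?mK i))) \<longlonglongrightarrow> L2ip ?N (case_prod (cut a t F)) (case_prod ?K)"
    by (rule tendsto_L2sq_imp_tendsto_L2ip[OF eventually_conj[OF evF(1) evK(1)] sF' sK evF(2) evK(2)])
  also have "L2ip ?N (case_prod (cut a t F)) (case_prod ?K) = (LINT r:{a..t}|lborel. L2ip M (F r) (K r))"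
    unfolding L2ip_pair[OF M sF' sK] set_lebesgue_integral_def
    using t by (intro Bochner_Integration.integral_cong) (auto simp: L2ip_def cut_def split: split_indicator)
  finally have lim: "(\<lambda>i. L2ip ?N (case_prod (?cF i)) (case_prod (?mK i))) \<longlonglongrightarrow> (LINT r:{a..t}|lborel. L2ip M (F r) (K r))" .
  have "\<forall>\<^sub>F i in sequentially. L2ip ?N (case_prod (?cF i)) (case_prod (?mK i)) =
     1 / (h i)\<^sup>2 * (LINT r:{a..t}|lborel. L2ip M (\<lambda>x. LINT \<tau>:{r..r + h i}|lborel. F \<tau> x) (\<lambda>x. LINT \<tau>:{r..r + h i}|lborel. K \<tau> x))"
    using evF(1) evK(1)
  proof eventually_elim
    case (elim i)
    have eq: "L2ip M (?cF i r) (?mK i r) = indicator {a..t} r *\<^sub>R ((1 / (h i)\<^sup>2) * L2ip M (\<lambda>x. LINT \<tau>:{r..r + h i}|lborel. F \<tau> x) (\<lambda>x. LINT \<tau>:{r..r + h i}|lborel. K \<tau> x))" for r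
    proof (cases "r \<in> {a..t}")
      case True
      have "(LINT \<tau>:{r..r + h i}|lborel. cut a b f \<tau> x) = (LINT \<tau>:{r..r + h i}|lborel. f \<tau> x)" for x and f :: "real \<Rightarrow> 'a \<Rightarrow> 'b"
        using True h(2)[of i] by (intro set_lebesgue_integral_cong) (auto simp: cut_def)
      then show ?thesis
        using True by (simp add: L2ip_def moving_average_def power2_eq_square)
    qed (simp add: L2ip_def)
    show ?case
      unfolding L2ip_pair[OF M elim] eq set_lebesgue_integral_def[of _ "{a..t}"]
      by (simp flip: mult.left_commute[of "1 / (h i)\<^sup>2"])
  qed
  from Lim_transform_eventually[OF lim this] show ?thesis .
qed

section \<open>Curves that are continuous in mean square\<close>

lemma CL2_ip_continuous:
  assumes f: "CL2 a b M f" and g: "CL2 a b M g"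
  shows "continuous_on ({a..b} \<times> {a..b}) (\<lambda>z. L2ip M (f (fst z)) (g (snd z)))"
  unfolding continuous_on_def
proof
  fix z assume z: "z \<in> {a..b} \<times> {a..b}"
  let ?F = "at z within {a..b} \<times> {a..b}"
  have ev: "\<forall>\<^sub>F w in ?F. w \<in> {a..b} \<times> {a..b}"
    by (simp add: eventually_at_filter)
  have sq: "t \<in> {a..b} \<Longrightarrow> sq_integrable M (f t)" "t \<in> {a..b} \<Longrightarrow> sq_integrable M (g t)" for t
    using f g by (auto simp: CL2_def)
  have cont: "((\<lambda>s. L2sq M (\<lambda>x. k s x - k t x)) \<longlongrightarrow> 0) (at t within {a..b})"
    "L2sq M (\<lambda>x. k t x - k t x) = 0" if "CL2 a b M k" "t \<in> {a..b}" for t and k :: "real \<Rightarrow> 'a \<Rightarrow> 'b"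
    using that by (auto simp: CL2_def L2sq_def)
  have tk: "((\<lambda>w. L2sq M (\<lambda>x. k (p w) x - k (p z) x)) \<longlongrightarrow> 0) ?F"
    if k: "CL2 a b M k" and p: "p = fst \<or> p = snd" for k :: "real \<Rightarrow> 'a \<Rightarrow> 'b" and p
  proof -
    have pz: "p z \<in> {a..b}" using z p by auto
    \<comment> \<open>\<open>w\<close> may tend to \<open>z\<close> with one coordinate equal to
      that of \<open>z\<close>, so a limit along the punctured neighbourhood of \<open>p z\<close>
      does not compose with the projection. The missing point is supplied by the value 0 of the
      distance there.\<close>
    have "((\<lambda>s. L2sq M (\<lambda>x. k s x - k (p z) x)) \<longlongrightarrow> 0) (inf (nhds (p z)) (principal {a..b}))"
    proof (rule topological_tendstoI)
      fix S :: "real set" assume S: "open S" "0 \<in> S"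
      from topological_tendstoD[OF cont(1)[OF k pz] S]
      show "\<forall>\<^sub>F s in inf (nhds (p z)) (principal {a..b}). L2sq M (\<lambda>x. k s x - k (p z) x) \<in> S"
        unfolding eventually_inf_principal eventually_at_filter
        by eventually_elim (use cont(2)[OF k pz] S in metis)
    qed
    moreover have "filterlim p (inf (nhds (p z)) (principal {a..b})) ?F"
      unfolding filterlim_inf filterlim_principal
      using p ev by (auto intro!: tendsto_fst tendsto_snd tendsto_ident_at elim!: eventually_mono)
    ultimately show ?thesis by (rule filterlim_compose)
  qed
  show "((\<lambda>z. L2ip M (f (fst z)) (g (snd z))) \<longlongrightarrow> L2ip M (f (fst z)) (g (snd z))) ?F"
    using z by (intro tendsto_L2sq_imp_tendsto_L2ip tk f g sq eventually_mono[OF ev]) (auto intro: sq)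
qed

lemma CL2_diff:
  assumes f: "CL2 a b M f" and g: "CL2 a b M g"
  shows "CL2 a b M (\<lambda>t x. f t x - g t x)"
  unfolding CL2_def
proof (intro conjI ballI)
  show "L2L2 a b M (\<lambda>t x. f t x - g t x)"
    using f g by (auto simp: CL2_def intro: L2L2_diff)
  fix t assume t: "t \<in> {a..b}"
  have sq: "s \<in> {a..b} \<Longrightarrow> sq_integrable M (f s)" "s \<in> {a..b} \<Longrightarrow> sq_integrable M (g s)" for s
    using f g by (auto simp: CL2_def)
  show "sq_integrable M (\<lambda>x. f t x - g t x)"
    using sq t by auto
  have "((\<lambda>s. 2 * L2sq M (\<lambda>x. f s x - f t x) + 2 * L2sq M (\<lambda>x. g s x - g t x)) \<longlongrightarrow> 2 * 0 + 2 * 0) (at t within {a..b})"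
    using f g t by (intro tendsto_intros) (auto simp: CL2_def)
  then have "((\<lambda>s. 2 * L2sq M (\<lambda>x. f s x - f t x) + 2 * L2sq M (\<lambda>x. g s x - g t x)) \<longlongrightarrow> 0) (at t within {a..b})"
    by simp
  moreover have "\<forall>\<^sub>F s in at t within {a..b}. norm (L2sq M (\<lambda>x. f s x - g s x - (f t x - g t x)))
      \<le> 2 * L2sq M (\<lambda>x. f s x - f t x) + 2 * L2sq M (\<lambda>x. g s x - g t x)"
    unfolding eventually_at_filter
  proof (intro always_eventually allI impI)
    fix s assume s: "s \<in> {a..b}"
    have int: "sq_integrable M (\<lambda>x. f s x - f t x)" "sq_integrable M (\<lambda>x. g s x - g t x)"
      "sq_integrable M (\<lambda>x. f s x - g s x - (f t x - g t x))"
      using sq s t by auto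
    have "L2sq M (\<lambda>x. f s x - g s x - (f t x - g t x)) \<le> (\<integral>x. 2 * (norm (f s x - f t x))\<^sup>2 + 2 * (norm (g s x - g t x))\<^sup>2 \<partial>M)"
      unfolding L2sq_def
    proof (rule integral_mono)
      show "(norm (f s x - g s x - (f t x - g t x)))\<^sup>2 \<le> 2 * (norm (f s x - f t x))\<^sup>2 + 2 * (norm (g s x - g t x))\<^sup>2" for x
        using norm_diff_sq_le[of "f s x - f t x" "g s x - g t x"] by (simp add: algebra_simps)
    qed (use int in \<open>auto simp: sq_integrable_def\<close>)
    also have "\<dots> = 2 * L2sq M (\<lambda>x. f s x - f t x) + 2 * L2sq M (\<lambda>x. g s x - g t x)"
      using int unfolding L2sq_def sq_integrable_def by simp
    finally show "norm (L2sq M (\<lambda>x. f s x - g s x - (f t x - g t x))) \<le> 2 * L2sq M (\<lambda>x. f s x - f t x) + 2 * L2sq M (\<lambda>x. g s x - g t x)"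
      by simp
  qed
  ultimately show "((\<lambda>s. L2sq M (\<lambda>x. f s x - g s x - (f t x - g t x))) \<longlongrightarrow> 0) (at t within {a..b})"
    by (rule Lim_null_comparison[rotated])
qed

lemma CL2_linear:
  assumes L: "bounded_linear L" and f: "CL2 a b M f"
  shows "CL2 a b M (\<lambda>t x. L (f t x))"
  unfolding CL2_def
proof (intro conjI ballI)
  show "L2L2 a b M (\<lambda>t x. L (f t x))"
    using f by (auto simp: CL2_def intro: L2L2_linear[OF L])
  fix t assume t: "t \<in> {a..b}"
  have sq: "s \<in> {a..b} \<Longrightarrow> sq_integrable M (f s)" for s
    using f by (auto simp: CL2_def)
  show "sq_integrable M (\<lambda>x. L (f t x))"
    using sq t by (intro sq_integrable_linear[OF L]) auto
  obtain C where C: "\<And>x. norm (L x) \<le> norm x * C"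
    using bounded_linear.bounded[OF L] by blast
  have "((\<lambda>s. C\<^sup>2 * L2sq M (\<lambda>x. f s x - f t x)) \<longlongrightarrow> C\<^sup>2 * 0) (at t within {a..b})"
    using f t by (intro tendsto_intros) (auto simp: CL2_def)
  then have "((\<lambda>s. C\<^sup>2 * L2sq M (\<lambda>x. f s x - f t x)) \<longlongrightarrow> 0) (at t within {a..b})"
    by simp
  moreover have "\<forall>\<^sub>F s in at t within {a..b}. norm (L2sq M (\<lambda>x. L (f s x) - L (f t x))) \<le> C\<^sup>2 * L2sq M (\<lambda>x. f s x - f t x)"
    unfolding eventually_at_filter
  proof (intro always_eventually allI impI)
    fix s assume s: "s \<in> {a..b}"
    have int: "sq_integrable M (\<lambda>x. f s x - f t x)" "sq_integrable M (\<lambda>x. L (f s x) - L (f t x))"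
      using s t by (auto intro!: sq sq_integrable_diff sq_integrable_linear[OF L])
    have "L2sq M (\<lambda>x. L (f s x) - L (f t x)) \<le> (\<integral>x. C\<^sup>2 * (norm (f s x - f t x))\<^sup>2 \<partial>M)"
      unfolding L2sq_def
    proof (rule integral_mono)
      fix x
      have "norm (L (f s x - f t x)) \<le> C * norm (f s x - f t x)"
        using C[of "f s x - f t x"] by (simp add: mult.commute)
      then have "(norm (L (f s x - f t x)))\<^sup>2 \<le> (C * norm (f s x - f t x))\<^sup>2"
        by (intro power_mono) auto
      then show "(norm (L (f s x) - L (f t x)))\<^sup>2 \<le> C\<^sup>2 * (norm (f s x - f t x))\<^sup>2"
        by (simp add: linear_diff[OF bounded_linear.linear[OF L]] power_mult_distrib)
    qed (use int in \<open>auto simp: sq_integrable_def\<close>)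
    then show "norm (L2sq M (\<lambda>x. L (f s x) - L (f t x))) \<le> C\<^sup>2 * L2sq M (\<lambda>x. f s x - f t x)"
      by (simp add: L2sq_def)
  qed
  ultimately show "((\<lambda>s. L2sq M (\<lambda>x. L (f s x) - L (f t x))) \<longlongrightarrow> 0) (at t within {a..b})"
    by (rule Lim_null_comparison[rotated])
qed

lemma CL2_subinterval:
  assumes M: "sigma_finite_measure M" and f: "CL2 a b M f" and "a \<le> a'" "b' \<le> b"
  shows "CL2 a' b' M f"
  unfolding CL2_def
proof (intro conjI ballI)
  show "L2L2 a' b' M f"
    using assms by (auto simp: CL2_def intro: L2L2_subinterval)
  fix t assume "t \<in> {a'..b'}"
  then have t: "t \<in> {a..b}" using assms by auto
  then show "sq_integrable M (f t)"
    using f by (auto simp: CL2_def)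
  have "((\<lambda>s. L2sq M (\<lambda>x. f s x - f t x)) \<longlongrightarrow> 0) (at t within {a..b})"
    using f t by (auto simp: CL2_def)
  then show "((\<lambda>s. L2sq M (\<lambda>x. f s x - f t x)) \<longlongrightarrow> 0) (at t within {a'..b'})"
    by (rule tendsto_within_subset) (use assms in auto)
qed

section \<open>Traces and weak gradients\<close>

lemma sets_area_measure [measurable_cong]: "sets area_measure = sets borel"
  and space_area_measure [simp]: "space area_measure = UNIV"
  unfolding area_measure_def using sets.sigma_sets_eq[of borel] by auto

lemma space_surf [simp]: "space (surf S) = S"
  and space_vol [simp]: "space (vol Om) = Om"
  by (simp_all add: surf_def vol_def space_restrict_space)

lemma measurable_surf: "f \<in> borel_measurable borel \<Longrightarrow> f \<in> borel_measurable (surf S)"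
  unfolding surf_def by (rule measurable_restrict_space1) (simp add: measurable_cong_sets[OF sets_area_measure refl])

lemma measurable_vol: "f \<in> borel_measurable borel \<Longrightarrow> f \<in> borel_measurable (vol S)"
  unfolding vol_def by (rule measurable_restrict_space1) simp

lemma lipschitz_domain_finite_vol:
  assumes "lipschitz_domain Om"
  shows "finite_measure (vol Om)"
proof
  have "open Om" "bounded Om"
    using assms by (auto simp: lipschitz_domain_def)
  then show "emeasure (vol Om) (space (vol Om)) \<noteq> \<infinity>"
    using emeasure_bounded_finite[of Om] by (simp add: vol_def emeasure_restrict_space)
qed

lemma lipschitz_domain_finite_surf:
  assumes "lipschitz_domain Om" "S \<subseteq> frontier Om" "closed S"
  shows "finite_measure (surf S)"
proof
  have fr: "frontier Om \<in> sets area_measure" and S: "S \<in> sets area_measure"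
    using assms(3) by (auto simp: sets_area_measure)
  have "emeasure (surf S) S = emeasure area_measure S"
    using S by (simp add: surf_def emeasure_restrict_space)
  also have "\<dots> \<le> emeasure area_measure (frontier Om)"
    by (rule emeasure_mono[OF assms(2) fr])
  also have "\<dots> = emeasure (surf (frontier Om)) (frontier Om)"
    using fr by (simp add: surf_def emeasure_restrict_space)
  also have "\<dots> < \<infinity>"
    using assms(1) by (simp add: lipschitz_domain_def)
  finally show "emeasure (surf S) (space (surf S)) \<noteq> \<infinity>"
    by simp
qed

lemma sq_integrable_restrict_subset:
  assumes "A \<in> sets N" "B \<in> sets N" "A \<subseteq> B" and f: "sq_integrable (restrict_space N B) f"
  shows "sq_integrable (restrict_space N A) f"
proof -
  have eq: "restrict_space N A = restrict_space (restrict_space N B) A"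
    using assms(3) by (simp add: restrict_restrict_space assms Int_absorb1)
  have "f \<in> borel_measurable (restrict_space N A)"
    unfolding eq using f by (simp add: measurable_restrict_space1 sq_integrable_def)
  moreover have "L2nn (restrict_space N A) f \<le> L2nn (restrict_space N B) f"
    unfolding L2nn_def using assms
    by (simp add: nn_integral_restrict_space) (auto intro!: nn_integral_mono split: split_indicator)
  ultimately show ?thesis
    using f by (auto simp: sq_integrable_iff elim: order_le_less_trans)
qed

lemma sq_integrable_surf_subset:
  "closed A \<Longrightarrow> closed B \<Longrightarrow> A \<subseteq> B \<Longrightarrow> sq_integrable (surf B) f \<Longrightarrow> sq_integrable (surf A) f"
  unfolding surf_def by (rule sq_integrable_restrict_subset) (auto simp: sets_area_measure)

lemma sq_integrable_bounded:
  assumes "finite_measure M" "f \<in> borel_measurable M" "AE x in M. norm (f x) \<le> B"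
  shows "sq_integrable M f"
proof -
  interpret finite_measure M by fact
  have "integrable M (\<lambda>x. B\<^sup>2)" by simp
  then have "sq_integrable M (\<lambda>x. B)"
    by (simp add: sq_integrable_def)
  then show ?thesis
    by (rule sq_integrable_bound[where C = 1]) (use assms in auto)
qed

text \<open>Compactness gives the bounds on the closed support. Off it the function vanishes on an
  open set, and its gradient with it.\<close>

lemma C1_bounded_support:
  fixes \<phi> :: "'a::euclidean_space \<Rightarrow> real"
  assumes der: "\<And>x. (\<phi> has_derivative (\<lambda>h. \<phi>' x \<bullet> h)) (at x)" and cont: "continuous_on UNIV \<phi>'"
    and bdd: "bounded {x. \<phi> x \<noteq> 0}"
  shows "\<exists>B. \<forall>x. \<bar>\<phi> x\<bar> \<le> B" "\<exists>B. \<forall>x. norm (\<phi>' x) \<le> B"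
proof -
  let ?K = "closure {x. \<phi> x \<noteq> 0}"
  have K: "compact ?K"
    using bdd by (simp add: compact_closure)
  have c: "continuous_on UNIV \<phi>"
    by (rule has_derivative_continuous_on) (rule has_derivative_at_withinI[OF der])
  have "\<exists>B. \<forall>x\<in>?K. norm (\<phi> x) \<le> B" "\<exists>B. \<forall>x\<in>?K. norm (\<phi>' x) \<le> B"
    using compact_imp_bounded[OF compact_continuous_image[OF continuous_on_subset[OF c subset_UNIV] K]]
      compact_imp_bounded[OF compact_continuous_image[OF continuous_on_subset[OF cont subset_UNIV] K]]
    by (auto simp: bounded_iff)
  then obtain B1 B2 where B: "\<And>x. x \<in> ?K \<Longrightarrow> norm (\<phi> x) \<le> B1" "\<And>x. x \<in> ?K \<Longrightarrow> norm (\<phi>' x) \<le> B2"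
    by blast
  have out: "\<phi> x = 0" "\<phi>' x = 0" if x: "x \<notin> ?K" for x
  proof -
    show "\<phi> x = 0"
      using x closure_subset[of "{x. \<phi> x \<noteq> 0}"] by auto
    have "((\<lambda>x. 0) has_derivative (\<lambda>h. \<phi>' x \<bullet> h)) (at x)"
      by (rule has_derivative_transform_within_open[OF der, of "- ?K"])
        (use x closure_subset[of "{x. \<phi> x \<noteq> 0}"] in auto)
    then have "(\<lambda>h. \<phi>' x \<bullet> h) = (\<lambda>h. 0)"
      using has_derivative_const has_derivative_unique by blast
    then have "\<phi>' x \<bullet> \<phi>' x = 0" by meson
    then show "\<phi>' x = 0" by simp
  qed
  have "\<bar>\<phi> x\<bar> \<le> max 0 B1" for x
    using B(1)[of x] out(1)[of x] by (cases "x \<in> ?K") auto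
  then show "\<exists>B. \<forall>x. \<bar>\<phi> x\<bar> \<le> B" by blast
  have "norm (\<phi>' x) \<le> max 0 B2" for x
    using B(2)[of x] out(2)[of x] by (cases "x \<in> ?K") auto
  then show "\<exists>B. \<forall>x. norm (\<phi>' x) \<le> B" by blast
qed

lemma borel_measurable_vec_nth: "(\<lambda>v :: 'b::euclidean_space ^ 'd::finite. v $ i) \<in> borel_measurable borel"
  by (intro borel_measurable_continuous_onI continuous_intros)

text \<open>Green's formula is an equation between Bochner integrals, and subtracting two instances
  of it is legitimate only if every term is integrable. Finite volume and finite boundary area make
  the bounded factors square integrable.\<close>

lemma green_integrable:
  fixes w :: "real ^ 'd::finite \<Rightarrow> real ^ 'd"
  assumes dom: "lipschitz_domain Om" and n: "normal_field Om n" and w: "H1_with_trace Om n w G"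
    and der: "\<And>x. (\<phi> has_derivative (\<lambda>h. \<phi>' x \<bullet> h)) (at x)" and cont: "continuous_on UNIV \<phi>'"
    and bdd: "bounded {x. \<phi> x \<noteq> 0}"
  shows "integrable (vol Om) (\<lambda>x. w x $ i * \<phi>' x $ j)" "integrable (vol Om) (\<lambda>x. G x $ i $ j * \<phi> x)"
    "integrable (surf (frontier Om)) (\<lambda>x. w x $ i * \<phi> x * n x $ j)"
proof -
  obtain B1 B2 where B: "\<And>x. \<bar>\<phi> x\<bar> \<le> B1" "\<And>x. norm (\<phi>' x) \<le> B2"
    using C1_bounded_support[OF der cont bdd] by metis
  have "continuous_on UNIV \<phi>"
    by (rule has_derivative_continuous_on) (rule has_derivative_at_withinI[OF der])
  then have m\<phi> [measurable]: "\<phi> \<in> borel_measurable borel"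
    by (rule borel_measurable_continuous_onI)
  have m\<phi>': "\<phi>' \<in> borel_measurable borel"
    using cont by (rule borel_measurable_continuous_onI)
  have m\<phi>'j: "(\<lambda>x. \<phi>' x $ j) \<in> borel_measurable borel"
    by (rule measurable_compose[OF m\<phi>' borel_measurable_vec_nth])
  have mn [measurable]: "n \<in> borel_measurable borel" and nn: "AE x in surf (frontier Om). norm (n x) = 1"
    using n by (auto simp: normal_field_def outward_unit_normal_def elim: eventually_mono)
  note vol = lipschitz_domain_finite_vol[OF dom] and srf = lipschitz_domain_finite_surf[OF dom order_refl frontier_closed]
  have lin: "bounded_linear (\<lambda>v :: real ^ 'd. v $ i)" "bounded_linear (\<lambda>A :: real ^ 'd ^ 'd. A $ i $ j)"
    by (auto intro!: bounded_linear_vec_nth bounded_linear_compose[OF bounded_linear_vec_nth bounded_linear_vec_nth])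
  have sq: "sq_integrable (vol Om) (\<lambda>x. w x $ i)" "sq_integrable (vol Om) (\<lambda>x. G x $ i $ j)"
    "sq_integrable (surf (frontier Om)) (\<lambda>x. w x $ i)"
    using w by (auto simp: H1_with_trace_def intro!: sq_integrable_linear[OF lin(1)] sq_integrable_linear[OF lin(2)])
  have "sq_integrable (vol Om) (\<lambda>x. \<phi>' x $ j)"
    by (rule sq_integrable_bounded[OF vol measurable_vol[OF m\<phi>'j], of B2])
      (auto intro: order_trans[OF component_le_norm_cart B(2)])
  from sq_integrable_inner[OF sq(1) this] show "integrable (vol Om) (\<lambda>x. w x $ i * \<phi>' x $ j)" by simp
  have "sq_integrable (vol Om) \<phi>"
    by (rule sq_integrable_bounded[OF vol measurable_vol[OF m\<phi>], of B1]) (auto simp: B)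
  from sq_integrable_inner[OF sq(2) this] show "integrable (vol Om) (\<lambda>x. G x $ i $ j * \<phi> x)" by simp
  have "(\<lambda>x. \<phi> x * n x $ j) \<in> borel_measurable (surf (frontier Om))"
    by (intro measurable_surf borel_measurable_times m\<phi> measurable_compose[OF mn borel_measurable_vec_nth])
  moreover have "AE x in surf (frontier Om). norm (\<phi> x * n x $ j) \<le> B1"
    using nn
  proof eventually_elim
    case (elim x)
    have "\<bar>\<phi> x\<bar> * \<bar>n x $ j\<bar> \<le> B1 * 1"
      using B(1)[of x] component_le_norm_cart[of "n x" j] elim by (intro mult_mono) auto
    then show ?case by (simp add: abs_mult)
  qed
  ultimately have "sq_integrable (surf (frontier Om)) (\<lambda>x. \<phi> x * n x $ j)"
    by (rule sq_integrable_bounded[OF srf])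
  from sq_integrable_inner[OF sq(3) this] show "integrable (surf (frontier Om)) (\<lambda>x. w x $ i * \<phi> x * n x $ j)"
    by (simp add: mult.assoc)
qed

lemma H1_with_trace_diff:
  assumes dom: "lipschitz_domain Om" and n: "normal_field Om n"
    and w1: "H1_with_trace Om n w1 G1" and w2: "H1_with_trace Om n w2 G2"
  shows "H1_with_trace Om n (\<lambda>x. w1 x - w2 x) (\<lambda>x. G1 x - G2 x)"
  unfolding H1_with_trace_def
proof (intro conjI allI impI)
  show "sq_integrable (vol Om) (\<lambda>x. w1 x - w2 x)" "sq_integrable (vol Om) (\<lambda>x. G1 x - G2 x)"
    "sq_integrable (surf (frontier Om)) (\<lambda>x. w1 x - w2 x)"
    using w1 w2 by (auto simp: H1_with_trace_def)
  fix \<phi> :: "real ^ 'a \<Rightarrow> real" and \<phi>' i j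
  assume *: "(\<forall>x. (\<phi> has_derivative (\<lambda>h. \<phi>' x \<bullet> h)) (at x)) \<and> continuous_on UNIV \<phi>' \<and> bounded {x. \<phi> x \<noteq> 0}"
  then have "(\<integral>x. w x $ i * \<phi>' x $ j \<partial>vol Om) + (\<integral>x. G x $ i $ j * \<phi> x \<partial>vol Om)
               = (\<integral>x. w x $ i * \<phi> x * n x $ j \<partial>surf (frontier Om))" if "H1_with_trace Om n w G" for w G
    using that by (auto simp: H1_with_trace_def)
  note eq = this[OF w1] this[OF w2]
  note int = green_integrable[OF dom n w1, of \<phi> \<phi>' i j] green_integrable[OF dom n w2, of \<phi> \<phi>' i j]
  show "(\<integral>x. (w1 x - w2 x) $ i * \<phi>' x $ j \<partial>vol Om) + (\<integral>x. (G1 x - G2 x) $ i $ j * \<phi> x \<partial>vol Om)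
               = (\<integral>x. (w1 x - w2 x) $ i * \<phi> x * n x $ j \<partial>surf (frontier Om))"
    using eq int * by (simp add: left_diff_distrib)
qed

text \<open>The sets of positivity of nonnegative \<open>C\<^sup>1\<close> functions form a generator of the Borel sets that is
  stable under intersection.\<close>

definition C1_positivity_sets :: "'a::euclidean_space set set" where
  "C1_positivity_sets = {{x. \<psi> x > 0} | \<psi> \<psi>'. (\<forall>x. GDERIV \<psi> x :> \<psi>' x) \<and> continuous_on UNIV \<psi>' \<and> (\<forall>x. \<psi> x \<ge> 0)}"

lemma GDERIV_imp_continuous_on: "(\<And>x. GDERIV f x :> f' x) \<Longrightarrow> continuous_on A f"
  unfolding gderiv_def by (rule has_derivative_continuous_on) (rule has_derivative_at_withinI)

text \<open>The product of two nonnegative functions is positive exactly where both are.\<close>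

lemma C1_positivity_sets_Int:
  assumes "A \<in> C1_positivity_sets" "B \<in> C1_positivity_sets"
  shows "A \<inter> B \<in> C1_positivity_sets"
proof -
  obtain f f' where f: "A = {x. f x > 0}" "\<And>x. GDERIV f x :> f' x" "continuous_on UNIV f'" "\<And>x. f x \<ge> 0"
    using assms(1) by (auto simp: C1_positivity_sets_def)
  obtain g g' where g: "B = {x. g x > 0}" "\<And>x. GDERIV g x :> g' x" "continuous_on UNIV g'" "\<And>x. g x \<ge> 0"
    using assms(2) by (auto simp: C1_positivity_sets_def)
  have "A \<inter> B = {x. f x * g x > 0}"
    using f(1,4) g(1,4) by (auto simp: zero_less_mult_iff) (metis leD)+
  moreover have "\<And>x. GDERIV (\<lambda>x. f x * g x) x :> f x *\<^sub>R g' x + g x *\<^sub>R f' x"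
    by (rule GDERIV_mult[OF f(2) g(2)])
  moreover have "continuous_on UNIV (\<lambda>x. f x *\<^sub>R g' x + g x *\<^sub>R f' x)"
    by (intro continuous_intros f g GDERIV_imp_continuous_on[OF f(2)] GDERIV_imp_continuous_on[OF g(2)])
  moreover have "f x * g x \<ge> 0" for x
    using f(4) g(4) by simp
  ultimately show ?thesis
    unfolding C1_positivity_sets_def
    by (intro CollectI exI[of _ "\<lambda>x. f x * g x"] exI[of _ "\<lambda>x. f x *\<^sub>R g' x + g x *\<^sub>R f' x"] conjI allI)
qed

text \<open>Squaring the positive part removes its kink. Composed with a quadratic it yields a
  continuously differentiable bump function for a ball.\<close>

lemma DERIV_max_0_sq: "DERIV (\<lambda>s::real. (max 0 s)\<^sup>2) s :> 2 * max 0 s"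
proof -
  consider "s < 0" | "s > 0" | "s = 0" by linarith
  then show ?thesis
  proof cases
    case 1
    have "DERIV (\<lambda>s::real. 0) s :> 0" by simp
    then have "DERIV (\<lambda>s::real. (max 0 s)\<^sup>2) s :> 0"
      by (rule has_field_derivative_transform_within_open[of _ _ _ "{..<0}"]) (use 1 in auto)
    then show ?thesis using 1 by simp
  next
    case 2
    have "DERIV (\<lambda>s::real. s\<^sup>2) s :> 2 * s" by (auto intro!: derivative_eq_intros)
    then have "DERIV (\<lambda>s::real. (max 0 s)\<^sup>2) s :> 2 * s"
      by (rule has_field_derivative_transform_within_open[of _ _ _ "{0<..}"]) (use 2 in auto)
    then show ?thesis using 2 by simp
  next
    case 3
    have "((\<lambda>h. (max 0 h)\<^sup>2 / h) \<longlongrightarrow> 0) (at (0::real))"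
    proof (rule Lim_null_comparison)
      show "\<forall>\<^sub>F h in at 0. norm ((max 0 h)\<^sup>2 / h) \<le> \<bar>h\<bar>"
        by (rule always_eventually) (auto simp: max_def power2_eq_square)
      show "((\<lambda>h::real. \<bar>h\<bar>) \<longlongrightarrow> 0) (at 0)"
        by (intro tendsto_rabs_zero tendsto_ident_at)
    qed
    then show ?thesis
      using 3 by (simp add: DERIV_def)
  qed
qed

lemma ball_in_C1_positivity_sets: "ball c r \<in> C1_positivity_sets"
proof (cases "r \<le> 0")
  case True
  then have "ball c r = {x. (0::real) > 0}" by simp
  then show ?thesis
    unfolding C1_positivity_sets_def
    by (intro CollectI exI[of _ "\<lambda>_. 0"] conjI) (auto simp: GDERIV_const)
next
  case False
  \<comment> \<open>Positive exactly inside the ball; the bump function is the square of its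
    positive part.\<close>
  let ?q = "\<lambda>x. r\<^sup>2 - (x - c) \<bullet> (x - c)"
  have "GDERIV ?q x :> (- 2) *\<^sub>R (x - c)" for x
    unfolding gderiv_def
    by (rule has_derivative_eq_rhs, rule derivative_intros, (rule derivative_intros)+)
      (simp add: fun_eq_iff inner_commute)
  from GDERIV_DERIV_compose[OF this DERIV_max_0_sq]
  have "GDERIV (\<lambda>x. (max 0 (?q x))\<^sup>2) x :> (2 * max 0 (?q x)) *\<^sub>R ((- 2) *\<^sub>R (x - c))" for x .
  moreover have "continuous_on UNIV (\<lambda>x. (2 * max 0 (?q x)) *\<^sub>R ((- 2) *\<^sub>R (x - c)))"
    by (intro continuous_intros)
  moreover have "ball c r = {x. (max 0 (?q x))\<^sup>2 > 0}"
  proof -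
    have "x \<in> ball c r \<longleftrightarrow> (norm (x - c))\<^sup>2 < r\<^sup>2" for x
      using False by (simp add: dist_norm norm_minus_commute power_strict_mono power2_less_imp_less[of _ r] flip: not_le)
    then show ?thesis
      by (auto simp: power2_norm_eq_inner)
  qed
  ultimately show ?thesis
    unfolding C1_positivity_sets_def by (intro CollectI exI[of _ "\<lambda>x. (max 0 (?q x))\<^sup>2"] exI conjI) auto
qed

text \<open>Balls belong to the generator, and by Lindelof's theorem every open set is a countable
  union of balls.\<close>

lemma borel_eq_sigma_C1_positivity_sets:
  "sets (borel :: 'a::euclidean_space measure) = sigma_sets UNIV C1_positivity_sets"
proof
  have "A \<in> sets borel" if A: "A \<in> C1_positivity_sets" for A :: "'a set"
  proof -
    obtain \<psi> :: "'a \<Rightarrow> real" and \<psi>' where "A = {x. \<psi> x > 0}" "\<And>x. GDERIV \<psi> x :> \<psi>' x"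
      using A by (auto simp: C1_positivity_sets_def)
    then have "open A"
      using GDERIV_imp_continuous_on[of \<psi> \<psi>' UNIV] by (simp add: open_Collect_less continuous_on_const)
    then show ?thesis by simp
  qed
  then show "sigma_sets UNIV C1_positivity_sets \<subseteq> sets (borel :: 'a measure)"
    using sets.sigma_sets_subset[of C1_positivity_sets "borel :: 'a measure"] by auto
  have "U \<in> sigma_sets UNIV C1_positivity_sets" if U: "open U" for U :: "'a set"
  proof -
    let ?\<F> = "{B. \<exists>c r. B = ball c r \<and> B \<subseteq> U}"
    obtain \<F> where \<F>: "\<F> \<subseteq> ?\<F>" "countable \<F>" "\<Union>\<F> = \<Union>?\<F>"
      using Lindelof[of ?\<F>] by auto
    have "\<Union>?\<F> = U"
    proof
      show "U \<subseteq> \<Union>?\<F>"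
      proof
        fix x assume x: "x \<in> U"
        then obtain e where "e > 0" "ball x e \<subseteq> U"
          using U open_contains_ball by blast
        then show "x \<in> \<Union>?\<F>" by (auto intro!: exI[of _ "ball x e"])
      qed
    qed auto
    moreover have "\<Union>\<F> \<in> sigma_sets UNIV C1_positivity_sets"
      using \<F>(1,2) by (intro sigma_sets_UNION) (auto intro: sigma_sets.Basic ball_in_C1_positivity_sets)
    ultimately show ?thesis using \<F>(3) by simp
  qed
  then show "sets (borel :: 'a measure) \<subseteq> sigma_sets UNIV C1_positivity_sets"
    unfolding borel_def by simp (intro sigma_sets_mono, auto)
qed


text \<open>The Borel sets over which \<open>g\<close> integrates to 0 form a Dynkin system. It
  contains an intersection stable generator, hence all Borel sets, and then \<open>g\<close>
  vanishes almost everywhere.\<close>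

lemma AE_zero_if_C1_positivity_integrals_zero:
  fixes g :: "'a::euclidean_space \<Rightarrow> real"
  assumes g: "integrable lborel g"
    and zero: "\<And>A. A \<in> C1_positivity_sets \<Longrightarrow> (LINT x:A|lborel. g x) = 0"
  shows "AE x in lborel. g x = 0"
proof (rule sigma_finite_measure.density_zero[OF sigma_finite_lborel g])
  have int: "set_integrable lborel A g" if "A \<in> sets borel" for A
    unfolding set_integrable_def using g that by (intro integrable_mult_indicator) auto
  fix A :: "'a set" assume "A \<in> sets lborel"
  then have A: "A \<in> sigma_sets UNIV C1_positivity_sets"
    by (simp add: borel_eq_sigma_C1_positivity_sets)
  have stable: "Int_stable (C1_positivity_sets :: 'a set set)"
    by (auto simp: Int_stable_def intro: C1_positivity_sets_Int)
  have subset_Pow_UNIV: "C1_positivity_sets \<subseteq> Pow (UNIV :: 'a set)" by simp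
  show "(LINT x:A|lborel. g x) = 0"
    using stable subset_Pow_UNIV A
  proof (induction rule: sigma_sets_induct_disjoint)
    case (basic A)
    then show ?case by (rule zero)
  next
    case empty
    show ?case by (simp add: set_lebesgue_integral_def)
  next
    case (compl A)
    \<comment> \<open>The constant function 1 puts the whole space into the generator, so the total
      integral is 0 and complements inherit the property.\<close>
    have "{x :: 'a. (1::real) > 0} \<in> C1_positivity_sets"
      unfolding C1_positivity_sets_def
      by (intro CollectI exI[of _ "\<lambda>_. 1"] exI[of _ "\<lambda>_. 0"] conjI) (auto simp: GDERIV_const)
    then have "(LINT x:UNIV|lborel. g x) = 0"
      using zero by simp
    moreover have A: "A \<in> sets borel"
      using compl by (simp add: borel_eq_sigma_C1_positivity_sets)
    then have "(LINT x:UNIV|lborel. g x) = (LINT x:A|lborel. g x) + (LINT x:(UNIV - A)|lborel. g x)"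
      using set_integral_Un[OF _ int int, of A "UNIV - A"] by simp
    ultimately show ?case using compl by simp
  next
    case (union A)
    have A: "A i \<in> sets borel" for i
      using union(2) by (auto simp: borel_eq_sigma_C1_positivity_sets)
    have "(LINT x:(\<Union>i. A i)|lborel. g x) = (\<Sum>i. (LINT x:(A i)|lborel. g x))"
      using union(1) A by (intro lebesgue_integral_countable_add int) (auto simp: disjoint_family_on_def)
    then show ?case using union by simp
  qed
qed

text \<open>Serves to hand over the elastic energy from slab to slab, where only the values of the
  displacement are known to agree. Testing with functions supported in a ball inside
  \<open>Om\<close> shows that each entry of \<open>G\<close> is orthogonal to all of them, and
  these approximate indicators of a generator of the Borel sets.\<close>

lemma H1_gradient_unique:
  assumes "open Om" and H: "H1_with_trace Om n w G" and w0: "AE x in vol Om. w x = 0"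
  shows "AE x in vol Om. G x = 0"
proof -
  have [measurable]: "Om \<in> sets borel" using \<open>open Om\<close> by simp
  have G: "sq_integrable (vol Om) G"
    using H by (simp add: H1_with_trace_def)
  have ballzero: "AE x in lborel. x \<in> ball c r \<longrightarrow> G x $ i $ j = 0" if B: "cball c r \<subseteq> Om" for c r i j
  proof -
    let ?B = "ball c r"
    let ?g = "\<lambda>x. indicator ?B x * G x $ i $ j"
    have BOm: "?B \<subseteq> Om" using B ball_subset_cball by blast
    have lin: "bounded_linear (\<lambda>A :: real ^ 'a ^ 'a. A $ i $ j)"
      by (intro bounded_linear_compose[OF bounded_linear_vec_nth bounded_linear_vec_nth])
    have GB: "sq_integrable (restrict_space lborel ?B) (\<lambda>x. G x $ i $ j)"
      using sq_integrable_restrict_subset[OF _ _ BOm, of lborel "\<lambda>x. G x $ i $ j"] sq_integrable_linear[OF lin G]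
      by (auto simp: vol_def)
    have fin: "finite_measure (restrict_space lborel ?B)"
      using emeasure_bounded_finite[of ?B] by (intro finite_measureI) (simp add: emeasure_restrict_space space_restrict_space)
    have "sq_integrable (restrict_space lborel ?B) (\<lambda>x. 1 :: real)"
      by (rule sq_integrable_bounded[OF fin, where B = 1]) auto
    from sq_integrable_inner[OF GB this] have "integrable (restrict_space lborel ?B) (\<lambda>x. G x $ i $ j)"
      by simp
    then have g: "integrable lborel ?g"
      by (subst (asm) integrable_restrict_space) auto
    \<comment> \<open>The volume term with \<open>w\<close> vanishes by assumption and the boundary
      term because the test function is 0 on the frontier, which is disjoint from the open set
      \<open>Om\<close>.\<close>
    have test: "(LINT x|lborel. ?g x * \<phi> x) = 0"
      if der: "\<And>x. GDERIV \<phi> x :> \<phi>' x" and c\<phi>: "continuous_on UNIV \<phi>'" and supp: "\<And>x. x \<notin> ?B \<Longrightarrow> \<phi> x = 0"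
      for \<phi> :: "real ^ 'a \<Rightarrow> real" and \<phi>'
    proof -
      have "(\<phi> has_derivative (\<lambda>h. \<phi>' x \<bullet> h)) (at x)" for x
        using der[of x] by (simp add: gderiv_def inner_commute)
      moreover have "bounded {x. \<phi> x \<noteq> 0}"
        by (rule bounded_subset[OF bounded_ball[of c r]]) (use supp in blast)
      ultimately have "(\<integral>x. w x $ i * \<phi>' x $ j \<partial>vol Om) + (\<integral>x. G x $ i $ j * \<phi> x \<partial>vol Om)
               = (\<integral>x. w x $ i * \<phi> x * n x $ j \<partial>surf (frontier Om))"
        using H c\<phi> unfolding H1_with_trace_def by blast
      moreover have "(\<integral>x. w x $ i * \<phi>' x $ j \<partial>vol Om) = 0"
        by (rule integral_eq_zero_AE) (use w0 in auto)
      moreover have "(\<integral>x. w x $ i * \<phi> x * n x $ j \<partial>surf (frontier Om)) = 0"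
      proof (rule integral_eq_zero_AE[OF AE_I2])
        fix x assume "x \<in> space (surf (frontier Om))"
        then have "x \<notin> ?B"
          using BOm \<open>open Om\<close> by (auto simp: frontier_def interior_open)
        then show "w x $ i * \<phi> x * n x $ j = 0"
          by (simp add: supp)
      qed
      moreover have "(\<integral>x. G x $ i $ j * \<phi> x \<partial>vol Om) = (LINT x|lborel. ?g x * \<phi> x)"
        unfolding vol_def using BOm supp
        by (subst integral_restrict_space) (auto intro!: Bochner_Integration.integral_cong split: split_indicator)
      ultimately show ?thesis by simp
    qed
    have "AE x in lborel. ?g x = 0"
    proof (rule AE_zero_if_C1_positivity_integrals_zero[OF g])
      fix A :: "(real ^ 'a) set" assume A: "A \<in> C1_positivity_sets"
      have "A \<inter> ?B \<in> C1_positivity_sets"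
        by (rule C1_positivity_sets_Int[OF A ball_in_C1_positivity_sets])
      then obtain \<psi> \<psi>' where \<psi>: "A \<inter> ?B = {x. \<psi> x > 0}" "\<And>x. GDERIV \<psi> x :> \<psi>' x" "continuous_on UNIV \<psi>'" "\<And>x. \<psi> x \<ge> 0"
        by (auto simp: C1_positivity_sets_def)
      have c\<psi>: "continuous_on UNIV \<psi>"
        by (rule GDERIV_imp_continuous_on[OF \<psi>(2)])
      then have [measurable]: "\<psi> \<in> borel_measurable borel"
        by (rule borel_measurable_continuous_onI)
      have nz: "1 + real k * \<psi> x \<noteq> 0" for k x
        using \<psi>(4)[of x] by (smt (verit) mult_nonneg_nonneg of_nat_0_le_iff)
      \<comment> \<open>The functions \<open>real k * \<psi> x / (1 + real k * \<psi> x)\<close> are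
        continuously differentiable, lie between 0 and 1, vanish where \<open>\<psi>\<close> does
        and converge pointwise to the indicator of \<open>A \<inter> ?B\<close>.\<close>
      have z: "(LINT x|lborel. ?g x * (real k * \<psi> x / (1 + real k * \<psi> x))) = 0" for k
      proof (rule test)
        fix x
        have "DERIV (\<lambda>s. real k * s / (1 + real k * s)) (\<psi> x) :> real k / (1 + real k * \<psi> x)\<^sup>2"
          using nz[of k x] by (auto intro!: derivative_eq_intros simp: power2_eq_square field_simps)
        from GDERIV_DERIV_compose[OF \<psi>(2) this]
        show "GDERIV (\<lambda>x. real k * \<psi> x / (1 + real k * \<psi> x)) x :> (real k / (1 + real k * \<psi> x)\<^sup>2) *\<^sub>R \<psi>' x" .
      next
        show "continuous_on UNIV (\<lambda>x. (real k / (1 + real k * \<psi> x)\<^sup>2) *\<^sub>R \<psi>' x)"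
          using nz by (intro continuous_intros c\<psi> \<psi>(3)) auto
        show "real k * \<psi> x / (1 + real k * \<psi> x) = 0" if "x \<notin> ?B" for x
          using that \<psi>(1,4) by (metis IntD2 antisym_conv2 div_0 mem_Collect_eq mult_zero_right)
      qed
      have "(\<lambda>k. LINT x|lborel. ?g x * (real k * \<psi> x / (1 + real k * \<psi> x))) \<longlonglongrightarrow> (LINT x|lborel. indicator A x * ?g x)"
      proof (rule integral_dominated_convergence[where w = "\<lambda>x. \<bar>?g x\<bar>"])
        show "AE x in lborel. (\<lambda>k. ?g x * (real k * \<psi> x / (1 + real k * \<psi> x))) \<longlonglongrightarrow> indicator A x * ?g x"
        proof (rule AE_I2)
          fix x
          show "(\<lambda>k. ?g x * (real k * \<psi> x / (1 + real k * \<psi> x))) \<longlonglongrightarrow> indicator A x * ?g x"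
          proof (cases "\<psi> x > 0")
            case True
            then have xA: "x \<in> A" using \<psi>(1) by blast
            have "filterlim (\<lambda>k. 1 + \<psi> x * real k) at_top sequentially"
              by (intro filterlim_tendsto_add_at_top[OF tendsto_const]
                  filterlim_tendsto_pos_mult_at_top[OF tendsto_const True] filterlim_real_sequentially)
            then have "(\<lambda>k. 1 - 1 / (1 + \<psi> x * real k)) \<longlonglongrightarrow> 1 - 0"
              by (intro tendsto_diff tendsto_const tendsto_divide_0[OF tendsto_const] filterlim_at_top_imp_at_infinity)
            moreover have "1 - 1 / (1 + \<psi> x * real k) = real k * \<psi> x / (1 + real k * \<psi> x)" for k
              using nz[of k x] by (simp add: field_simps)
            ultimately have "(\<lambda>k. real k * \<psi> x / (1 + real k * \<psi> x)) \<longlonglongrightarrow> 1"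
              by simp
            from tendsto_mult[OF tendsto_const[of "?g x"] this] show ?thesis
              using xA by simp
          next
            case False
            then have "\<psi> x = 0" using \<psi>(4)[of x] by simp
            moreover have "x \<notin> A \<or> x \<notin> ?B" using False \<psi>(1) by blast
            ultimately show ?thesis by (auto split: split_indicator)
          qed
        qed
        show "AE x in lborel. norm (?g x * (real k * \<psi> x / (1 + real k * \<psi> x))) \<le> \<bar>?g x\<bar>" for k
        proof (rule AE_I2)
          fix x
          have "\<bar>real k * \<psi> x / (1 + real k * \<psi> x)\<bar> \<le> 1"
            using \<psi>(4)[of x] by (simp add: abs_of_nonneg divide_le_eq add_pos_nonneg)
          then show "norm (?g x * (real k * \<psi> x / (1 + real k * \<psi> x))) \<le> \<bar>?g x\<bar>"
            unfolding real_norm_def abs_mult[of "?g x"] by (intro mult_left_le) auto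
        qed
        have [measurable]: "A \<in> sets borel"
          using A sigma_sets.Basic[OF A, of UNIV] by (simp add: borel_eq_sigma_C1_positivity_sets)
        have [measurable]: "?g \<in> borel_measurable borel"
          using borel_measurable_integrable[OF g] by simp
        show "(\<lambda>x. indicator A x * ?g x) \<in> borel_measurable lborel"
          "(\<lambda>x. ?g x * (real k * \<psi> x / (1 + real k * \<psi> x))) \<in> borel_measurable lborel" for k
          by simp_all
      qed (use g in simp)
      then show "(LINT x:A|lborel. ?g x) = 0"
        unfolding z by (simp add: LIMSEQ_const_iff set_lebesgue_integral_def)
    qed
    then show ?thesis
      by eventually_elim auto
  qed
  \<comment> \<open>A countable subcover keeps the union of the exceptional null sets null.\<close>
  let ?\<F> = "{B. \<exists>c r. B = ball c r \<and> cball c r \<subseteq> Om}"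
  obtain \<F> where \<F>: "\<F> \<subseteq> ?\<F>" "countable \<F>" "\<Union>\<F> = \<Union>?\<F>"
    using Lindelof[of ?\<F>] by auto
  have cover: "Om \<subseteq> \<Union>?\<F>"
  proof
    fix x assume "x \<in> Om"
    then obtain e where "e > 0" "cball x e \<subseteq> Om"
      using \<open>open Om\<close> open_contains_cball by blast
    then show "x \<in> \<Union>?\<F>" by (auto intro!: exI[of _ "ball x e"])
  qed
  have "AE x in lborel. \<forall>i\<in>UNIV. \<forall>j\<in>UNIV. x \<in> B \<longrightarrow> G x $ i $ j = 0" if BF: "B \<in> \<F>" for B
  proof -
    obtain c r where B: "B = ball c r" "cball c r \<subseteq> Om"
      using BF \<F>(1) by blast
    show ?thesis
      unfolding B(1) by (intro AE_finite_allI ballzero B(2)) auto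
  qed
  then have "AE x in lborel. \<forall>B\<in>\<F>. \<forall>i\<in>UNIV. \<forall>j\<in>UNIV. x \<in> B \<longrightarrow> G x $ i $ j = 0"
    using \<F>(2) by (subst AE_ball_countable) auto
  then have "AE x in lborel. x \<in> Om \<longrightarrow> G x = 0"
  proof eventually_elim
    case (elim x)
    show ?case
    proof
      assume "x \<in> Om"
      then obtain B where "B \<in> \<F>" "x \<in> B" using cover \<F>(3) by blast
      with elim show "G x = 0" by (auto simp: vec_eq_iff)
    qed
  qed
  then show ?thesis
    unfolding vol_def by (subst AE_restrict_space_iff) auto
qed

section \<open>Energy identities\<close>

lemma set_integral_cong_ae_time:
  fixes f g :: "real \<Rightarrow> real"
  assumes "set_integrable lborel {a..b} f" "set_integrable lborel {a..b} g" "ae_time a b (\<lambda>t. f t = g t)"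
  shows "(LINT t:{a..b}|lborel. f t) = (LINT t:{a..b}|lborel. g t)"
  unfolding set_lebesgue_integral_def
proof (rule integral_cong_AE)
  show "(\<lambda>t. indicator {a..b} t *\<^sub>R f t) \<in> borel_measurable lborel"
    "(\<lambda>t. indicator {a..b} t *\<^sub>R g t) \<in> borel_measurable lborel"
    using assms(1,2) unfolding set_integrable_def by (auto dest: borel_measurable_integrable)
  show "AE t in lborel. indicator {a..b} t *\<^sub>R f t = indicator {a..b} t *\<^sub>R g t"
    using assms(3) unfolding ae_time_iff by eventually_elim (auto split: split_indicator)
qed

lemma ae_time_AE_mp2:
  assumes "ae_time a b (\<lambda>t. AE x in M. P t x)" "ae_time a b (\<lambda>t. AE x in M. Q t x)" "\<And>t x. P t x \<Longrightarrow> Q t x \<Longrightarrow> R t x"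
  shows "ae_time a b (\<lambda>t. AE x in M. R t x)"
  using assms(1,2) unfolding ae_time_def
proof eventually_elim
  case (elim t)
  then show "AE x in M. R t x"
    by eventually_elim (rule assms(3))
qed

lemma L2L2_ip_integral_diff:
  assumes M: "sigma_finite_measure M" and f: "L2L2 a b M f" and g: "L2L2 a b M g" and k: "L2L2 a b M k"
  shows "(LINT t:{a..b}|lborel. L2ip M (\<lambda>x. f t x - g t x) (k t)) =
    (LINT t:{a..b}|lborel. L2ip M (f t) (k t)) - (LINT t:{a..b}|lborel. L2ip M (g t) (k t))"
proof -
  have "case_prod (cut a b (\<lambda>t x. f t x - g t x)) = (\<lambda>z. case_prod (cut a b f) z - case_prod (cut a b g) z)"
    by (auto simp: cut_def scaleR_diff_right)
  then show ?thesis
    unfolding L2L2_ip_integral[OF M L2L2_diff[OF f g] k] L2L2_ip_integral[OF M f k] L2L2_ip_integral[OF M g k]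
    using L2ip_diff_left[OF f[unfolded L2L2_iff[OF M]] g[unfolded L2L2_iff[OF M]] k[unfolded L2L2_iff[OF M]]] by simp
qed

text \<open>Each window integral is controlled by the full time fibre uniformly in \<open>r\<close>,
  so integrating over \<open>[a, t]\<close> costs only a finite factor. This permits splitting the
  time integral of the windowed source terms.\<close>

lemma L2L2_window:
  assumes M: "sigma_finite_measure M" and F: "L2L2 a b M F" and "0 < h" "t + h \<le> b"
  shows "L2L2 a t M (\<lambda>r x. LINT \<tau>:{r..r + h}|lborel. F \<tau> x)" (is "L2L2 a t M ?W")
proof -
  interpret sigma_finite_measure M by fact
  let ?F = "cut a b F"
  have [measurable]: "case_prod ?F \<in> borel_measurable (lborel \<Otimes>\<^sub>M M)" and fin: "L2nn (lborel \<Otimes>\<^sub>M M) (case_prod ?F) < \<infinity>"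
    using F by (auto simp: L2L2_iff[OF M] sq_integrable_iff)
  note mm [measurable] = moving_average_measurable[OF M \<open>case_prod ?F \<in> _\<close>, of h]
  have W: "?W r x = h *\<^sub>R moving_average h ?F r x" if "r \<in> {a..t}" for r x
  proof -
    have "(LINT \<tau>:{r..r + h}|lborel. ?F \<tau> x) = ?W r x"
      using that assms by (intro set_lebesgue_integral_cong) (auto simp: cut_def)
    then show ?thesis
      using \<open>0 < h\<close> by (simp add: moving_average_def)
  qed
  have "case_prod (cut a t ?W) = (\<lambda>z. if a \<le> fst z \<and> fst z \<le> t then h *\<^sub>R case_prod (moving_average h ?F) z else 0)"
    by (auto simp: cut_def W split: split_indicator)
  then have m [measurable]: "case_prod (cut a t ?W) \<in> borel_measurable (lborel \<Otimes>\<^sub>M M)"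
    by simp
  have "L2nn (lborel \<Otimes>\<^sub>M M) (case_prod (cut a t ?W)) = (\<integral>\<^sup>+x. L2nn lborel (\<lambda>r. cut a t ?W r x) \<partial>M)"
    by (rule L2nn_pair(2)[OF M sigma_finite_lborel m])
  also have "\<dots> \<le> (\<integral>\<^sup>+x. (ennreal h * emeasure lborel {a..t}) * L2nn lborel (\<lambda>\<tau>. ?F \<tau> x) \<partial>M)"
  proof (rule nn_integral_mono)
    fix x assume x: "x \<in> space M"
    have "L2nn lborel (\<lambda>r. cut a t ?W r x) \<le> (\<integral>\<^sup>+r. (ennreal h * L2nn lborel (\<lambda>\<tau>. ?F \<tau> x)) * indicator {a..t} r \<partial>lborel)"
      unfolding L2nn_def[of _ "\<lambda>r. cut a t ?W r x"]
    proof (rule nn_integral_mono)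
      fix r
      show "ennreal ((norm (cut a t ?W r x))\<^sup>2) \<le> (ennreal h * L2nn lborel (\<lambda>\<tau>. ?F \<tau> x)) * indicator {a..t} r"
      proof (cases "r \<in> {a..t}")
        case True
        have "?W r x = (LINT \<tau>:{r..r + h}|lborel. ?F \<tau> x)"
          using True assms by (intro set_lebesgue_integral_cong) (auto simp: cut_def)
        then have "ennreal ((norm (cut a t ?W r x))\<^sup>2) \<le> ennreal (r + h - r) * (\<integral>\<^sup>+s\<in>{r..r + h}. ennreal ((norm (?F s x))\<^sup>2) \<partial>lborel)"
          using True x \<open>0 < h\<close> norm_set_integral_sq_le[of "\<lambda>s. ?F s x" r "r + h"] by simp
        also have "\<dots> \<le> ennreal h * L2nn lborel (\<lambda>\<tau>. ?F \<tau> x)"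
          unfolding L2nn_def by (intro mult_mono nn_integral_mono) (auto split: split_indicator)
        finally show ?thesis using True by simp
      qed (simp add: cut_def)
    qed
    also have "\<dots> = (ennreal h * emeasure lborel {a..t}) * L2nn lborel (\<lambda>\<tau>. ?F \<tau> x)"
      by (subst nn_integral_cmult_indicator) (auto simp: mult_ac)
    finally show "L2nn lborel (\<lambda>r. cut a t ?W r x) \<le> (ennreal h * emeasure lborel {a..t}) * L2nn lborel (\<lambda>\<tau>. ?F \<tau> x)" .
  qed
  also have "\<dots> = (ennreal h * emeasure lborel {a..t}) * L2nn (lborel \<Otimes>\<^sub>M M) (case_prod ?F)"
    unfolding L2nn_pair(2)[OF M sigma_finite_lborel \<open>case_prod ?F \<in> _\<close>]
    by (rule nn_integral_cmult) (simp add: L2nn_def)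
  also have "\<dots> < \<infinity>"
    using fin by (simp add: ennreal_mult_less_top emeasure_lborel_Icc_eq)
  finally show ?thesis
    using m by (simp add: L2L2_iff[OF M] sq_integrable_iff)
qed

section \<open>Algebra of the stresses\<close>

lemma bounded_linear_sym_part: "bounded_linear (sym_part :: real ^ 'd::finite ^ 'd \<Rightarrow> _)"
proof -
  have "linear (sym_part :: real ^ 'd ^ 'd \<Rightarrow> _)"
    by (rule linearI) (auto simp: sym_part_def transpose_def vec_eq_iff algebra_simps)
  then show ?thesis by (rule linear_conv_bounded_linear[THEN iffD1])
qed

lemma bounded_linear_divergence: "bounded_linear (divergence :: real ^ 'd::finite ^ 'd \<Rightarrow> _)"
proof -
  have "linear (divergence :: real ^ 'd ^ 'd \<Rightarrow> _)"
    by (rule linearI) (auto simp: divergence_def trace_def sum.distrib sum_distrib_left)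
  then show ?thesis by (rule linear_conv_bounded_linear[THEN iffD1])
qed

lemma inner_matrix: "(A :: real ^ 'd::finite ^ 'd) \<bullet> B = (\<Sum>i\<in>UNIV. \<Sum>j\<in>UNIV. A $ i $ j * B $ i $ j)"
  by (simp add: inner_vec_def)

text \<open>A symmetric matrix is orthogonal to every antisymmetric one, so only the symmetric part
  of \<open>B\<close> is seen.\<close>

lemma sym_part_inner: "sym_part A \<bullet> B = sym_part A \<bullet> sym_part B"
proof -
  have "sym_part A \<bullet> transpose B = sym_part A \<bullet> B"
  proof -
    have "sym_part A \<bullet> transpose B = (\<Sum>i\<in>UNIV. \<Sum>j\<in>UNIV. sym_part A $ i $ j * B $ j $ i)"
      by (simp add: inner_matrix transpose_def)
    also have "\<dots> = (\<Sum>i\<in>UNIV. \<Sum>j\<in>UNIV. sym_part A $ j $ i * B $ j $ i)"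
      by (simp add: sym_part_def transpose_def add.commute)
    also have "\<dots> = sym_part A \<bullet> B"
      unfolding inner_matrix by (rule sum.swap)
    finally show ?thesis .
  qed
  then show ?thesis
    by (simp add: sym_part_def[of B] inner_add_right)
qed

lemma mat_1_inner: "mat 1 \<bullet> (A :: real ^ 'd::finite ^ 'd) = divergence A"
  by (simp add: inner_matrix mat_def divergence_def trace_def if_distrib[of "\<lambda>x. x * _"] cong: if_cong)

text \<open>The pressure meets only the divergence, so it does no work on a solenoidal
  field.\<close>

lemma newton_stress_inner: "newton_stress \<mu> G p \<bullet> A = 2 * \<mu> * (sym_part G \<bullet> sym_part A) - p * divergence A"
  by (simp add: newton_stress_def inner_diff_left mat_1_inner sym_part_inner[of G A])

lemma elastic_stress_inner:
  "elastic_stress L1 L2 G \<bullet> A = 2 * L1 * (sym_part G \<bullet> sym_part A) + L2 * (divergence G * divergence A)"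
  by (simp add: elastic_stress_def inner_add_left mat_1_inner sym_part_inner[of G A])

lemmas sym_part_diff = linear_diff[OF bounded_linear.linear[OF bounded_linear_sym_part]]
  and divergence_diff = linear_diff[OF bounded_linear.linear[OF bounded_linear_divergence]]

lemma newton_stress_diff: "newton_stress \<mu> (G - G') (p - p') = newton_stress \<mu> G p - newton_stress \<mu> G' p'"
  by (simp add: newton_stress_def sym_part_diff scaleR_diff_right scaleR_diff_left)

lemma elastic_stress_diff: "elastic_stress L1 L2 (G - G') = elastic_stress L1 L2 G - elastic_stress L1 L2 G'"
  by (simp add: elastic_stress_def sym_part_diff divergence_diff scaleR_diff_right scaleR_diff_left right_diff_distrib)

section \<open>One subdomain with its interface: restriction and linearity of solutions\<close>

locale domain_with_interface =
  fixes Om Sig :: "(real ^ 'd::finite) set" and n :: "real ^ 'd \<Rightarrow> real ^ 'd"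
  assumes dom: "lipschitz_domain Om" and nrm: "normal_field Om n"
    and closed_Sig: "closed Sig" and Sig_sub: "Sig \<subseteq> frontier Om"
begin

lemma vol_sf: "sigma_finite_measure (vol Om)"
  using lipschitz_domain_finite_vol[OF dom] by (simp add: finite_measure_def)

lemma surf_sf: "sigma_finite_measure (surf Sig)"
  using lipschitz_domain_finite_surf[OF dom Sig_sub closed_Sig] by (simp add: finite_measure_def)

lemma H1_sq_integrable:
  assumes "H1_with_trace Om n \<phi> \<Phi>"
  shows "sq_integrable (vol Om) \<phi>" "sq_integrable (vol Om) \<Phi>" "sq_integrable (surf Sig) \<phi>"
  using assms sq_integrable_surf_subset[OF closed_Sig frontier_closed Sig_sub] by (auto simp: H1_with_trace_def)

text \<open>The definition has one time integral of a difference. Splitting it requires both parts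
  to be integrable in time, which follows from square integrability of the stress in the domain and
  of the traction on the interface.\<close>

lemma momentum_balance_iff:
  assumes \<sigma>: "L2L2 a b (vol Om) \<sigma>" and \<sigma>n: "L2L2 a b (surf Sig) (\<lambda>t x. \<sigma> t x *v n x)"
  shows "momentum_balance \<rho> Om Sig n a b v \<sigma> \<longleftrightarrow>
    (\<forall>\<phi> \<Phi>. H1_with_trace Om n \<phi> \<Phi> \<and> (AE x in surf (frontier Om - Sig). \<phi> x = 0) \<longrightarrow>
        (\<forall>s t. a \<le> s \<and> s \<le> t \<and> t \<le> b \<longrightarrow>
           \<rho> * L2ip (vol Om) (v t) \<phi> - \<rho> * L2ip (vol Om) (v s) \<phi> =
           (LINT r:{s..t}|lborel. L2ip (surf Sig) (\<lambda>x. \<sigma> r x *v n x) \<phi>) - (LINT r:{s..t}|lborel. L2ip (vol Om) (\<sigma> r) \<Phi>)))"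
proof -
  have *: "(LINT r:{s..t}|lborel. L2ip (surf Sig) (\<lambda>x. \<sigma> r x *v n x) \<phi> - L2ip (vol Om) (\<sigma> r) \<Phi>) =
      (LINT r:{s..t}|lborel. L2ip (surf Sig) (\<lambda>x. \<sigma> r x *v n x) \<phi>) - (LINT r:{s..t}|lborel. L2ip (vol Om) (\<sigma> r) \<Phi>)"
    if \<phi>: "H1_with_trace Om n \<phi> \<Phi>" and st: "a \<le> s" "s \<le> t" "t \<le> b" for \<phi> \<Phi> s t
    using H1_sq_integrable[OF \<phi>] st
    by (intro set_integral_diff L2L2_ip_integrable surf_sf vol_sf L2L2_const L2L2_subinterval[OF surf_sf \<sigma>n] L2L2_subinterval[OF vol_sf \<sigma>])
  show ?thesis
    unfolding momentum_balance_def L2ip_def[symmetric]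
    by (intro all_cong1 imp_cong refl) (elim conjE, simp only: *)
qed

lemma momentum_balance_diff:
  assumes "CL2 a b (vol Om) v" "CL2 a b (vol Om) v'"
    and \<sigma>: "L2L2 a b (vol Om) \<sigma>" "L2L2 a b (surf Sig) (\<lambda>t x. \<sigma> t x *v n x)"
    and \<sigma>': "L2L2 a b (vol Om) \<sigma>'" "L2L2 a b (surf Sig) (\<lambda>t x. \<sigma>' t x *v n x)"
    and mb: "momentum_balance \<rho> Om Sig n a b v \<sigma>" "momentum_balance \<rho> Om Sig n a b v' \<sigma>'"
  shows "L2L2 a b (surf Sig) (\<lambda>t x. (\<sigma> t x - \<sigma>' t x) *v n x)"
    and "momentum_balance \<rho> Om Sig n a b (\<lambda>t x. v t x - v' t x) (\<lambda>t x. \<sigma> t x - \<sigma>' t x)"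
proof -
  have eq: "(\<lambda>x. (\<sigma> t x - \<sigma>' t x) *v n x) = (\<lambda>x. \<sigma> t x *v n x - \<sigma>' t x *v n x)" for t
    by (simp add: matrix_vector_mult_diff_rdistrib)
  show d: "L2L2 a b (surf Sig) (\<lambda>t x. (\<sigma> t x - \<sigma>' t x) *v n x)"
    unfolding eq by (rule L2L2_diff[OF \<sigma>(2) \<sigma>'(2)])
  have sqv: "sq_integrable (vol Om) (v t)" "sq_integrable (vol Om) (v' t)" if "t \<in> {a..b}" for t
    using that assms(1,2) by (auto simp: CL2_def)
  show "momentum_balance \<rho> Om Sig n a b (\<lambda>t x. v t x - v' t x) (\<lambda>t x. \<sigma> t x - \<sigma>' t x)"
    unfolding momentum_balance_iff[OF L2L2_diff[OF \<sigma>(1) \<sigma>'(1)] d]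
  proof (intro allI impI, elim conjE)
    fix \<phi> \<Phi> s t
    assume \<phi>: "H1_with_trace Om n \<phi> \<Phi>" "AE x in surf (frontier Om - Sig). \<phi> x = 0" and st: "a \<le> s" "s \<le> t" "t \<le> b"
    note sq = H1_sq_integrable[OF \<phi>(1)]
    have e1: "(LINT r:{s..t}|lborel. L2ip (surf Sig) (\<lambda>x. (\<sigma> r x - \<sigma>' r x) *v n x) \<phi>) =
      (LINT r:{s..t}|lborel. L2ip (surf Sig) (\<lambda>x. \<sigma> r x *v n x) \<phi>) - (LINT r:{s..t}|lborel. L2ip (surf Sig) (\<lambda>x. \<sigma>' r x *v n x) \<phi>)"
      unfolding eq using st sq
      by (intro L2L2_ip_integral_diff surf_sf L2L2_const L2L2_subinterval[OF surf_sf \<sigma>(2)] L2L2_subinterval[OF surf_sf \<sigma>'(2)])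
    have e2: "(LINT r:{s..t}|lborel. L2ip (vol Om) (\<lambda>x. \<sigma> r x - \<sigma>' r x) \<Phi>) =
      (LINT r:{s..t}|lborel. L2ip (vol Om) (\<sigma> r) \<Phi>) - (LINT r:{s..t}|lborel. L2ip (vol Om) (\<sigma>' r) \<Phi>)"
      using st sq
      by (intro L2L2_ip_integral_diff vol_sf L2L2_const L2L2_subinterval[OF vol_sf \<sigma>(1)] L2L2_subinterval[OF vol_sf \<sigma>'(1)])
    have e3: "L2ip (vol Om) (\<lambda>x. v r x - v' r x) \<phi> = L2ip (vol Om) (v r) \<phi> - L2ip (vol Om) (v' r) \<phi>" if "r \<in> {a..b}" for r
      by (rule L2ip_diff_left[OF sqv(1)[OF that] sqv(2)[OF that] sq(1)])
    have "\<rho> * L2ip (vol Om) (v t) \<phi> - \<rho> * L2ip (vol Om) (v s) \<phi> =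
           (LINT r:{s..t}|lborel. L2ip (surf Sig) (\<lambda>x. \<sigma> r x *v n x) \<phi>) - (LINT r:{s..t}|lborel. L2ip (vol Om) (\<sigma> r) \<Phi>)"
      using mb(1)[unfolded momentum_balance_iff[OF \<sigma>]] \<phi> st by blast
    moreover have "\<rho> * L2ip (vol Om) (v' t) \<phi> - \<rho> * L2ip (vol Om) (v' s) \<phi> =
           (LINT r:{s..t}|lborel. L2ip (surf Sig) (\<lambda>x. \<sigma>' r x *v n x) \<phi>) - (LINT r:{s..t}|lborel. L2ip (vol Om) (\<sigma>' r) \<Phi>)"
      using mb(2)[unfolded momentum_balance_iff[OF \<sigma>']] \<phi> st by blast
    ultimately show "\<rho> * L2ip (vol Om) (\<lambda>x. v t x - v' t x) \<phi> - \<rho> * L2ip (vol Om) (\<lambda>x. v s x - v' s x) \<phi> =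
        (LINT r:{s..t}|lborel. L2ip (surf Sig) (\<lambda>x. (\<sigma> r x - \<sigma>' r x) *v n x) \<phi>)
        - (LINT r:{s..t}|lborel. L2ip (vol Om) (\<lambda>x. \<sigma> r x - \<sigma>' r x) \<Phi>)"
      unfolding e1 e2 using st e3[of s] e3[of t] by (simp add: right_diff_distrib)
  qed
qed

text \<open>Linearity: the error solves the same homogeneous Stokes system, so whatever is proved
  for solutions applies to errors. The interface is left open here, as no condition on
  \<open>Sig\<close> is part of this notion of solution.\<close>

lemma fluid_solution_diff:
  assumes f1: "fluid_solution \<rho> \<mu> Om Sig n a b u Du p \<sigma>" and f2: "fluid_solution \<rho> \<mu> Om Sig n a b u' Du' p' \<sigma>'"
  shows "fluid_solution \<rho> \<mu> Om Sig n a b (\<lambda>t x. u t x - u' t x) (\<lambda>t x. Du t x - Du' t x) (\<lambda>t x. p t x - p' t x) (\<lambda>t x. \<sigma> t x - \<sigma>' t x)"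
  unfolding fluid_solution_def
proof (intro conjI)
  note F1 = f1[unfolded fluid_solution_def] and F2 = f2[unfolded fluid_solution_def]
  show "CL2 a b (vol Om) (\<lambda>t x. u t x - u' t x)"
    using F1 F2 by (intro CL2_diff) auto
  show "L2L2 a b (vol Om) (\<lambda>t x. Du t x - Du' t x)" "L2L2 a b (vol Om) (\<lambda>t x. p t x - p' t x)"
    "L2L2 a b (vol Om) (\<lambda>t x. \<sigma> t x - \<sigma>' t x)" "L2L2 a b (surf Sig) (\<lambda>t x. u t x - u' t x)"
    using F1 F2 by (intro L2L2_diff; simp)+
  show "L2L2 a b (surf Sig) (\<lambda>t x. (\<sigma> t x - \<sigma>' t x) *v n x)"
    "momentum_balance \<rho> Om Sig n a b (\<lambda>t x. u t x - u' t x) (\<lambda>t x. \<sigma> t x - \<sigma>' t x)"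
    by (rule momentum_balance_diff[of a b u u' \<sigma> \<sigma>' \<rho>]; use F1 F2 in simp)+
  have "ae_time a b (\<lambda>t. H1_with_trace Om n (u t) (Du t) \<and> H1_with_trace Om n (u' t) (Du' t))"
    using F1 F2 by (intro ae_time_conj) auto
  then show "ae_time a b (\<lambda>t. H1_with_trace Om n (\<lambda>x. u t x - u' t x) (\<lambda>x. Du t x - Du' t x))"
    unfolding ae_time_def by eventually_elim (auto intro: H1_with_trace_diff[OF dom nrm])
  show "ae_time a b (\<lambda>t. AE x in surf (frontier Om - Sig). u t x - u' t x = 0)"
    by (rule ae_time_AE_mp2[of a b "\<lambda>t x. u t x = 0" "surf (frontier Om - Sig)" "\<lambda>t x. u' t x = 0"]) (use F1 F2 in auto)
  show "ae_time a b (\<lambda>t. AE x in vol Om. divergence (Du t x - Du' t x) = 0)"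
    by (rule ae_time_AE_mp2[of a b "\<lambda>t x. divergence (Du t x) = 0" "vol Om" "\<lambda>t x. divergence (Du' t x) = 0"])
      (use F1 F2 in \<open>auto simp: divergence_diff\<close>)
  show "ae_time a b (\<lambda>t. AE x in vol Om. \<sigma> t x - \<sigma>' t x = newton_stress \<mu> (Du t x - Du' t x) (p t x - p' t x))"
    by (rule ae_time_AE_mp2[of a b "\<lambda>t x. \<sigma> t x = newton_stress \<mu> (Du t x) (p t x)" "vol Om"
          "\<lambda>t x. \<sigma>' t x = newton_stress \<mu> (Du' t x) (p' t x)"])
      (use F1 F2 in \<open>auto simp: newton_stress_diff\<close>)
qed

lemma momentum_balance_subinterval:
  assumes "momentum_balance \<rho> Om Sig n a b v \<sigma>" "a \<le> a'" "b' \<le> b"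
  shows "momentum_balance \<rho> Om Sig n a' b' v \<sigma>"
  unfolding momentum_balance_def
  by (intro allI impI assms(1)[unfolded momentum_balance_def, rule_format]) (use assms(2,3) in auto)

lemma fluid_solution_subinterval:
  assumes "fluid_solution \<rho> \<mu> Om Sig n a b u Du p \<sigma>" "a \<le> a'" "b' \<le> b"
  shows "fluid_solution \<rho> \<mu> Om Sig n a' b' u Du p \<sigma>"
proof -
  note F = assms(1)[unfolded fluid_solution_def]
  show ?thesis
    unfolding fluid_solution_def
    by (intro conjI CL2_subinterval[OF vol_sf _ assms(2,3)] L2L2_subinterval[OF vol_sf _ assms(2,3)]
      L2L2_subinterval[OF surf_sf _ assms(2,3)] ae_time_subinterval[OF _ assms(2,3)] momentum_balance_subinterval[OF _ assms(2,3)];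
      use F in simp)
qed

lemma solid_solution_subinterval:
  assumes "solid_solution \<rho> L1 L2 Om Sig n a b \<eta> D\<eta> v \<sigma>" "a \<le> a'" "b' \<le> b"
  shows "solid_solution \<rho> L1 L2 Om Sig n a' b' \<eta> D\<eta> v \<sigma>"
proof -
  have td: "has_time_derivative a' b' M \<eta> v" if td: "has_time_derivative a b M \<eta> v" and M: "sigma_finite_measure M" for M
    unfolding has_time_derivative_def
  proof (intro conjI allI impI)
    show "L2L2 a' b' M v"
      using td assms(2,3) L2L2_subinterval[OF M] by (auto simp: has_time_derivative_def)
    show "AE x in M. \<eta> t x - \<eta> s x = (LINT r:{s..t}|lborel. v r x)" if "a' \<le> s \<and> s \<le> t \<and> t \<le> b'" for s t
      using td that assms(2,3) by (auto simp: has_time_derivative_def)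
  qed
  note F = assms(1)[unfolded solid_solution_def]
  show ?thesis
    unfolding solid_solution_def
    by (intro conjI ballI CL2_subinterval[OF vol_sf _ assms(2,3)] L2L2_subinterval[OF vol_sf _ assms(2,3)]
        L2L2_subinterval[OF surf_sf _ assms(2,3)] ae_time_subinterval[OF _ assms(2,3)]
        momentum_balance_subinterval[OF _ assms(2,3)] td vol_sf surf_sf; use F assms(2,3) in simp)
qed

end

lemma has_time_derivative_diff:
  assumes M: "sigma_finite_measure M" and f: "has_time_derivative a b M f f'" and g: "has_time_derivative a b M g g'"
  shows "has_time_derivative a b M (\<lambda>t x. f t x - g t x) (\<lambda>t x. f' t x - g' t x)"
  unfolding has_time_derivative_def
proof (intro conjI allI impI)
  have f': "L2L2 a b M f'" and g': "L2L2 a b M g'"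
    using f g by (auto simp: has_time_derivative_def)
  then show "L2L2 a b M (\<lambda>t x. f' t x - g' t x)" by (rule L2L2_diff)
  fix s t assume st: "a \<le> s \<and> s \<le> t \<and> t \<le> b"
  have "AE x in M. set_integrable lborel {s..t} (\<lambda>r. f' r x)" "AE x in M. set_integrable lborel {s..t} (\<lambda>r. g' r x)"
    using L2L2_ae_set_integrable[OF M L2L2_subinterval[OF M f', of s t]]
      L2L2_ae_set_integrable[OF M L2L2_subinterval[OF M g', of s t]] st by simp_all
  moreover have "AE x in M. f t x - f s x = (LINT r:{s..t}|lborel. f' r x)" "AE x in M. g t x - g s x = (LINT r:{s..t}|lborel. g' r x)"
    using st f g by (auto simp: has_time_derivative_def)
  ultimately show "AE x in M. f t x - g t x - (f s x - g s x) = (LINT r:{s..t}|lborel. f' r x - g' r x)"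
    by eventually_elim (simp add: algebra_simps)
qed

lemma (in domain_with_interface) solid_solution_diff:
  assumes f1: "solid_solution \<rho> L1 L2 Om Sig n a b \<eta> D\<eta> v \<sigma>" and f2: "solid_solution \<rho> L1 L2 Om Sig n a b \<eta>' D\<eta>' v' \<sigma>'"
  shows "solid_solution \<rho> L1 L2 Om Sig n a b (\<lambda>t x. \<eta> t x - \<eta>' t x) (\<lambda>t x. D\<eta> t x - D\<eta>' t x) (\<lambda>t x. v t x - v' t x) (\<lambda>t x. \<sigma> t x - \<sigma>' t x)"
  unfolding solid_solution_def
proof (intro conjI ballI)
  note F1 = f1[unfolded solid_solution_def] and F2 = f2[unfolded solid_solution_def]
  show "CL2 a b (vol Om) (\<lambda>t x. \<eta> t x - \<eta>' t x)" "CL2 a b (vol Om) (\<lambda>t x. D\<eta> t x - D\<eta>' t x)" "CL2 a b (vol Om) (\<lambda>t x. v t x - v' t x)"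
    using F1 F2 by (intro CL2_diff; simp)+
  show "L2L2 a b (vol Om) (\<lambda>t x. \<sigma> t x - \<sigma>' t x)"
    using F1 F2 by (intro L2L2_diff; simp)
  show "L2L2 a b (surf Sig) (\<lambda>t x. (\<sigma> t x - \<sigma>' t x) *v n x)"
    "momentum_balance \<rho> Om Sig n a b (\<lambda>t x. v t x - v' t x) (\<lambda>t x. \<sigma> t x - \<sigma>' t x)"
    by (rule momentum_balance_diff[of a b v v' \<sigma> \<sigma>' \<rho>]; use F1 F2 in simp)+
  show "has_time_derivative a b (vol Om) (\<lambda>t x. \<eta> t x - \<eta>' t x) (\<lambda>t x. v t x - v' t x)"
    "has_time_derivative a b (surf Sig) (\<lambda>t x. \<eta> t x - \<eta>' t x) (\<lambda>t x. v t x - v' t x)"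
    by (rule has_time_derivative_diff[OF vol_sf] has_time_derivative_diff[OF surf_sf]; use F1 F2 in simp)+
  show "H1_with_trace Om n (\<lambda>x. \<eta> t x - \<eta>' t x) (\<lambda>x. D\<eta> t x - D\<eta>' t x)" if "t \<in> {a..b}" for t
    by (rule H1_with_trace_diff[OF dom nrm]; use F1 F2 that in simp)
  show "AE x in surf (frontier Om - Sig). \<eta> t x - \<eta>' t x = 0" if t: "t \<in> {a..b}" for t
  proof -
    have "\<forall>t\<in>{a..b}. AE x in surf (frontier Om - Sig). \<eta> t x = 0" "\<forall>t\<in>{a..b}. AE x in surf (frontier Om - Sig). \<eta>' t x = 0"
      using F1 F2 by simp_all
    then have "AE x in surf (frontier Om - Sig). \<eta> t x = 0" "AE x in surf (frontier Om - Sig). \<eta>' t x = 0"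
      using t by blast+
    then show ?thesis by eventually_elim simp
  qed
  show "ae_time a b (\<lambda>t. AE x in vol Om. \<sigma> t x - \<sigma>' t x = elastic_stress L1 L2 (D\<eta> t x - D\<eta>' t x))"
    by (rule ae_time_AE_mp2[of a b "\<lambda>t x. \<sigma> t x = elastic_stress L1 L2 (D\<eta> t x)" "vol Om"
          "\<lambda>t x. \<sigma>' t x = elastic_stress L1 L2 (D\<eta>' t x)"])
      (use F1 F2 in \<open>auto simp: elastic_stress_diff\<close>)
qed


section \<open>Energy balance on a time interval\<close>

context domain_with_interface
begin

text \<open>Since the velocity is solenoidal, the pressure part of the stress drops out and only the
  viscous part does work.\<close>

lemma fluid_dissipation:
  assumes "fluid_solution \<rho> \<mu> Om Sig n a b u Du p \<sigma>"
  shows "(LINT s:{a..b}|lborel. L2ip (vol Om) (\<sigma> s) (Du s))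
     = 2 * \<mu> * (LINT s:{a..b}|lborel. L2sq (vol Om) (\<lambda>x. sym_part (Du s x)))"
proof -
  note F = assms[unfolded fluid_solution_def]
  have Du: "L2L2 a b (vol Om) Du" and \<sigma>: "L2L2 a b (vol Om) \<sigma>" using F by auto
  have sym: "L2L2 a b (vol Om) (\<lambda>t x. sym_part (Du t x))"
    by (rule L2L2_linear[OF bounded_linear_sym_part Du])
  have "(LINT s:{a..b}|lborel. L2ip (vol Om) (\<sigma> s) (Du s))
      = (LINT s:{a..b}|lborel. 2 * \<mu> * L2ip (vol Om) (\<lambda>x. sym_part (Du s x)) (\<lambda>x. sym_part (Du s x)))"
  proof (rule set_integral_cong_ae_time)
    show "set_integrable lborel {a..b} (\<lambda>s. L2ip (vol Om) (\<sigma> s) (Du s))"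
      by (rule L2L2_ip_integrable[OF vol_sf \<sigma> Du])
    show "set_integrable lborel {a..b} (\<lambda>s. 2 * \<mu> * L2ip (vol Om) (\<lambda>x. sym_part (Du s x)) (\<lambda>x. sym_part (Du s x)))"
      by (intro set_integrable_mult_right) (rule L2L2_ip_integrable[OF vol_sf sym sym])
    have "ae_time a b (\<lambda>t. ((AE x in vol Om. divergence (Du t x) = 0) \<and> (AE x in vol Om. \<sigma> t x = newton_stress \<mu> (Du t x) (p t x)))
        \<and> sq_integrable (vol Om) (Du t) \<and> sq_integrable (vol Om) (\<sigma> t))"
      using F L2L2_ae_sq_integrable[OF vol_sf Du] L2L2_ae_sq_integrable[OF vol_sf \<sigma>] by (intro ae_time_conj) auto
    then show "ae_time a b (\<lambda>s. L2ip (vol Om) (\<sigma> s) (Du s) = 2 * \<mu> * L2ip (vol Om) (\<lambda>x. sym_part (Du s x)) (\<lambda>x. sym_part (Du s x)))"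
      unfolding ae_time_def
    proof eventually_elim
      case (elim t)
      have sq: "sq_integrable (vol Om) (\<lambda>x. sym_part (Du t x))"
        using elim by (intro sq_integrable_linear[OF bounded_linear_sym_part]) auto
      have "L2ip (vol Om) (\<sigma> t) (Du t) = (\<integral>x. 2 * \<mu> * (sym_part (Du t x) \<bullet> sym_part (Du t x)) \<partial>vol Om)"
        unfolding L2ip_def
      proof (rule integral_cong_AE)
        show "(\<lambda>x. \<sigma> t x \<bullet> Du t x) \<in> borel_measurable (vol Om)"
          using elim by (auto simp: sq_integrable_def)
        show "(\<lambda>x. 2 * \<mu> * (sym_part (Du t x) \<bullet> sym_part (Du t x))) \<in> borel_measurable (vol Om)"
          using sq by (auto simp: sq_integrable_def)
        have "AE x in vol Om. divergence (Du t x) = 0" "AE x in vol Om. \<sigma> t x = newton_stress \<mu> (Du t x) (p t x)"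
          using elim by auto
        then show "AE x in vol Om. \<sigma> t x \<bullet> Du t x = 2 * \<mu> * (sym_part (Du t x) \<bullet> sym_part (Du t x))"
          by eventually_elim (simp add: newton_stress_inner)
      qed
      then show ?case by (simp add: L2ip_def)
    qed
  qed
  then show ?thesis by (simp add: L2ip_self)
qed

text \<open>The increment of the weak equation from \<open>r\<close> to \<open>r + h\<close> is
  tested with \<open>u q\<close> and then integrated over \<open>q\<close> in the same window. The
  velocity is an admissible test function at almost every time, which is enough because
  \<open>q\<close> is integrated.\<close>

lemma fluid_energy:
  assumes "a < b" and sol: "fluid_solution \<rho> \<mu> Om Sig n a b u Du p \<sigma>"
  shows "\<rho> / 2 * L2sq (vol Om) (u b) + 2 * \<mu> * (LINT s:{a..b}|lborel. L2sq (vol Om) (\<lambda>x. sym_part (Du s x)))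
    = \<rho> / 2 * L2sq (vol Om) (u a) + (LINT s:{a..b}|lborel. L2ip (surf Sig) (\<lambda>x. \<sigma> s x *v n x) (u s))"
proof -
  note F = sol[unfolded fluid_solution_def]
  have u: "CL2 a b (vol Om) u" and Du: "L2L2 a b (vol Om) Du" and \<sigma>: "L2L2 a b (vol Om) \<sigma>"
    and us: "L2L2 a b (surf Sig) u" and \<sigma>n: "L2L2 a b (surf Sig) (\<lambda>t x. \<sigma> t x *v n x)"
    and mb: "momentum_balance \<rho> Om Sig n a b u \<sigma>"
    using F by auto
  have uv: "L2L2 a b (vol Om) u" and squ: "t \<in> {a..b} \<Longrightarrow> sq_integrable (vol Om) (u t)" for t
    using u by (auto simp: CL2_def)
  \<comment> \<open>Kernel of the kinetic energy only; viscous work is not the increment of an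
    energy and stays among the source terms in \<open>?J\<close>.\<close>
  define G where "G = (\<lambda>x y. \<rho> * L2ip (vol Om) (u x) (u y))"
  let ?S = "\<lambda>h r x. LINT \<tau>:{r..r + h}|lborel. \<sigma> \<tau> x *v n x" and ?U = "\<lambda>h r x. LINT \<tau>:{r..r + h}|lborel. u \<tau> x"
  let ?T = "\<lambda>h r x. LINT \<tau>:{r..r + h}|lborel. \<sigma> \<tau> x" and ?D = "\<lambda>h r x. LINT \<tau>:{r..r + h}|lborel. Du \<tau> x"
  let ?J = "\<lambda>h r. L2ip (surf Sig) (?S h r) (?U h r) - L2ip (vol Om) (?T h r) (?D h r)"
  have test: "ae_time a b (\<lambda>q. H1_with_trace Om n (u q) (Du q) \<and> (AE x in surf (frontier Om - Sig). u q x = 0))"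
    using F by (intro ae_time_conj) auto
  have "(G b b - G a a) / 2 = (LINT r:{a..b}|lborel. L2ip (surf Sig) (\<lambda>x. \<sigma> r x *v n x) (u r) - L2ip (vol Om) (\<sigma> r) (Du r))"
  proof (rule kernel_energy_identity[OF \<open>a < b\<close>, where G = G and J = ?J])
    show "continuous_on ({a..b} \<times> {a..b}) (\<lambda>z. G (fst z) (snd z))"
      unfolding G_def by (intro continuous_intros CL2_ip_continuous u)
    show "G x y = G y x" for x y
      by (simp add: G_def L2ip_commute)
    show "set_integrable lborel {a..b} (\<lambda>r. L2ip (surf Sig) (\<lambda>x. \<sigma> r x *v n x) (u r) - L2ip (vol Om) (\<sigma> r) (Du r))"
      by (intro set_integral_diff(1) L2L2_ip_integrable[OF surf_sf \<sigma>n us] L2L2_ip_integrable[OF vol_sf \<sigma> Du])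
  next
    fix r h assume rh: "a \<le> r" "0 < h" "r + h \<le> b"
    have sub: "L2L2 r (r + h) (surf Sig) u" "L2L2 r (r + h) (vol Om) u" "L2L2 r (r + h) (vol Om) Du"
      "L2L2 r (r + h) (surf Sig) (\<lambda>t x. \<sigma> t x *v n x)" "L2L2 r (r + h) (vol Om) \<sigma>"
      using rh by (auto intro: L2L2_subinterval[OF surf_sf us] L2L2_subinterval[OF vol_sf uv] L2L2_subinterval[OF vol_sf Du]
          L2L2_subinterval[OF surf_sf \<sigma>n] L2L2_subinterval[OF vol_sf \<sigma>])
    have le: "r \<le> r + h" using rh by simp
    have S: "sq_integrable (surf Sig) (?S h r)"
      by (rule sq_integrable_time_integral[OF surf_sf sub(4) sq_integrable_zero le])
    have T: "sq_integrable (vol Om) (?T h r)"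
      by (rule sq_integrable_time_integral[OF vol_sf sub(5) sq_integrable_zero le])
    have i1: "set_integrable lborel {r..r + h} (\<lambda>q. L2ip (surf Sig) (u q) (?S h r))"
      by (rule L2L2_ip_integrable[OF surf_sf sub(1) L2L2_const[OF surf_sf S]])
    have i2: "set_integrable lborel {r..r + h} (\<lambda>q. L2ip (vol Om) (Du q) (?T h r))"
      by (rule L2L2_ip_integrable[OF vol_sf sub(3) L2L2_const[OF vol_sf T]])
    have i3: "set_integrable lborel {r..r + h} (\<lambda>q. G t q)" if "t \<in> {a..b}" for t
      unfolding G_def
      by (intro set_integrable_mult_right L2L2_ip_integrable[OF vol_sf L2L2_const[OF vol_sf squ[OF that]] sub(2)])
    have "(LINT q:{r..r + h}|lborel. G (r + h) q - G r q) =
        (LINT q:{r..r + h}|lborel. L2ip (surf Sig) (u q) (?S h r) - L2ip (vol Om) (Du q) (?T h r))"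
    proof (rule set_integral_cong_ae_time)
      show "set_integrable lborel {r..r + h} (\<lambda>q. G (r + h) q - G r q)"
        using rh by (intro set_integral_diff(1) i3) auto
      show "set_integrable lborel {r..r + h} (\<lambda>q. L2ip (surf Sig) (u q) (?S h r) - L2ip (vol Om) (Du q) (?T h r))"
        by (intro set_integral_diff(1) i1 i2)
      \<comment> \<open>For such \<open>q\<close> the equation holds with test function
        \<open>u q\<close>, and Fubini moves the integral over \<tau> onto traction and
        stress.\<close>
      have "ae_time r (r + h) (\<lambda>q. H1_with_trace Om n (u q) (Du q) \<and> (AE x in surf (frontier Om - Sig). u q x = 0))"
        using rh by (intro ae_time_subinterval[OF test]) auto
      then show "ae_time r (r + h) (\<lambda>q. G (r + h) q - G r q = L2ip (surf Sig) (u q) (?S h r) - L2ip (vol Om) (Du q) (?T h r))"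
        unfolding ae_time_def
      proof eventually_elim
        case (elim q)
        then have "G (r + h) q - G r q = (LINT \<tau>:{r..r + h}|lborel. L2ip (surf Sig) (\<lambda>x. \<sigma> \<tau> x *v n x) (u q))
            - (LINT \<tau>:{r..r + h}|lborel. L2ip (vol Om) (\<sigma> \<tau>) (Du q))"
          using mb[unfolded momentum_balance_iff[OF \<sigma> \<sigma>n], rule_format, of "u q" "Du q" r "r + h"] rh
          by (simp add: G_def)
        also have "(LINT \<tau>:{r..r + h}|lborel. L2ip (surf Sig) (\<lambda>x. \<sigma> \<tau> x *v n x) (u q)) = L2ip (surf Sig) (u q) (?S h r)"
          using L2ip_time_integral[OF surf_sf sub(4) H1_sq_integrable(3) le, of "u q" "Du q"] elim
          by (simp add: L2ip_commute)
        also have "(LINT \<tau>:{r..r + h}|lborel. L2ip (vol Om) (\<sigma> \<tau>) (Du q)) = L2ip (vol Om) (Du q) (?T h r)"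
          using L2ip_time_integral[OF vol_sf sub(5) H1_sq_integrable(2) le, of "u q" "Du q"] elim
          by (simp add: L2ip_commute)
        finally show ?case .
      qed
    qed
    also have "\<dots> = (LINT q:{r..r + h}|lborel. L2ip (surf Sig) (u q) (?S h r)) - (LINT q:{r..r + h}|lborel. L2ip (vol Om) (Du q) (?T h r))"
      by (rule set_integral_diff(2)[OF i1 i2])
    also have "\<dots> = L2ip (surf Sig) (?U h r) (?S h r) - L2ip (vol Om) (?D h r) (?T h r)"
      unfolding L2ip_time_integral[OF surf_sf sub(1) S le] L2ip_time_integral[OF vol_sf sub(3) T le] ..
    finally show "(LINT q:{r..r + h}|lborel. G (r + h) q - G r q) = ?J h r"
      by (simp add: L2ip_commute)
  next
    fix t and h :: "nat \<Rightarrow> real"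
    assume t: "a \<le> t" "t < b" and h: "h \<longlonglongrightarrow> 0" "\<And>i. 0 < h i \<and> t + h i \<le> b"
    have "(\<lambda>i. 1 / (h i)\<^sup>2 * (LINT r:{a..t}|lborel. L2ip (surf Sig) (?S (h i) r) (?U (h i) r))
          - 1 / (h i)\<^sup>2 * (LINT r:{a..t}|lborel. L2ip (vol Om) (?T (h i) r) (?D (h i) r)))
        \<longlonglongrightarrow> (LINT r:{a..t}|lborel. L2ip (surf Sig) (\<lambda>x. \<sigma> r x *v n x) (u r)) - (LINT r:{a..t}|lborel. L2ip (vol Om) (\<sigma> r) (Du r))"
      by (intro tendsto_diff L2L2_ip_average_limit[OF surf_sf \<sigma>n us t(1) h] L2L2_ip_average_limit[OF vol_sf \<sigma> Du t(1) h])
    also have "(\<lambda>i. 1 / (h i)\<^sup>2 * (LINT r:{a..t}|lborel. L2ip (surf Sig) (?S (h i) r) (?U (h i) r))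
          - 1 / (h i)\<^sup>2 * (LINT r:{a..t}|lborel. L2ip (vol Om) (?T (h i) r) (?D (h i) r)))
        = (\<lambda>i. 1 / (h i)\<^sup>2 * (LINT r:{a..t}|lborel. ?J (h i) r))"
    proof
      fix i
      have hi: "0 < h i" "t + h i \<le> b" using h(2)[of i] by auto
      have "(LINT r:{a..t}|lborel. ?J (h i) r) = (LINT r:{a..t}|lborel. L2ip (surf Sig) (?S (h i) r) (?U (h i) r))
          - (LINT r:{a..t}|lborel. L2ip (vol Om) (?T (h i) r) (?D (h i) r))"
        by (intro set_integral_diff(2) L2L2_ip_integrable surf_sf vol_sf L2L2_window[OF surf_sf \<sigma>n hi] L2L2_window[OF surf_sf us hi]
            L2L2_window[OF vol_sf \<sigma> hi] L2L2_window[OF vol_sf Du hi])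
      then show "1 / (h i)\<^sup>2 * (LINT r:{a..t}|lborel. L2ip (surf Sig) (?S (h i) r) (?U (h i) r))
          - 1 / (h i)\<^sup>2 * (LINT r:{a..t}|lborel. L2ip (vol Om) (?T (h i) r) (?D (h i) r)) = 1 / (h i)\<^sup>2 * (LINT r:{a..t}|lborel. ?J (h i) r)"
        by (simp only: right_diff_distrib)
    qed
    also have "(LINT r:{a..t}|lborel. L2ip (surf Sig) (\<lambda>x. \<sigma> r x *v n x) (u r)) - (LINT r:{a..t}|lborel. L2ip (vol Om) (\<sigma> r) (Du r))
        = (LINT r:{a..t}|lborel. L2ip (surf Sig) (\<lambda>x. \<sigma> r x *v n x) (u r) - L2ip (vol Om) (\<sigma> r) (Du r))"
      using t by (intro set_integral_diff(2)[symmetric] L2L2_ip_integrable surf_sf vol_sf L2L2_subinterval[OF surf_sf \<sigma>n] L2L2_subinterval[OF surf_sf us]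
            L2L2_subinterval[OF vol_sf \<sigma>] L2L2_subinterval[OF vol_sf Du]) auto
    finally show "(\<lambda>i. 1 / (h i)\<^sup>2 * (LINT r:{a..t}|lborel. ?J (h i) r)) \<longlonglongrightarrow>
        (LINT r:{a..t}|lborel. L2ip (surf Sig) (\<lambda>x. \<sigma> r x *v n x) (u r) - L2ip (vol Om) (\<sigma> r) (Du r))" .
  qed
  also have "\<dots> = (LINT r:{a..b}|lborel. L2ip (surf Sig) (\<lambda>x. \<sigma> r x *v n x) (u r)) - (LINT r:{a..b}|lborel. L2ip (vol Om) (\<sigma> r) (Du r))"
    by (intro set_integral_diff(2) L2L2_ip_integrable[OF surf_sf \<sigma>n us] L2L2_ip_integrable[OF vol_sf \<sigma> Du])
  also note fluid_dissipation[OF sol]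
  finally show ?thesis
    by (simp add: G_def L2ip_self field_simps)
qed

text \<open>The symmetric bilinear form obtained by polarising \<open>S_norm_sq\<close>; the kernel
  needs its values at two different times.\<close>

definition elastic_form :: "real \<Rightarrow> real \<Rightarrow> (real ^ 'd \<Rightarrow> real ^ 'd ^ 'd) \<Rightarrow> (real ^ 'd \<Rightarrow> real ^ 'd ^ 'd) \<Rightarrow> real" where
  "elastic_form L1 L2 A B = 2 * L1 * L2ip (vol Om) (\<lambda>x. sym_part (A x)) (\<lambda>x. sym_part (B x))
     + L2 * L2ip (vol Om) (\<lambda>x. divergence (A x)) (\<lambda>x. divergence (B x))"

lemma elastic_form_self: "elastic_form L1 L2 A A = S_norm_sq L1 L2 Om A"
  by (simp add: elastic_form_def S_norm_sq_def L2ip_self)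

lemma elastic_form_commute: "elastic_form L1 L2 A B = elastic_form L1 L2 B A"
  by (simp add: elastic_form_def L2ip_commute)

lemma elastic_form_stress:
  assumes A: "sq_integrable (vol Om) A" and B: "sq_integrable (vol Om) B" and \<sigma>: "\<sigma> \<in> borel_measurable (vol Om)"
    and eq: "AE x in vol Om. \<sigma> x = elastic_stress L1 L2 (A x)"
  shows "L2ip (vol Om) \<sigma> B = elastic_form L1 L2 A B"
proof -
  note sq = sq_integrable_linear[OF bounded_linear_sym_part A] sq_integrable_linear[OF bounded_linear_sym_part B]
    sq_integrable_linear[OF bounded_linear_divergence A] sq_integrable_linear[OF bounded_linear_divergence B]
  have int: "integrable (vol Om) (\<lambda>x. sym_part (A x) \<bullet> sym_part (B x))" "integrable (vol Om) (\<lambda>x. divergence (A x) * divergence (B x))"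
    using sq_integrable_inner[OF sq(1,2)] sq_integrable_inner[OF sq(3,4)] by simp_all
  have "L2ip (vol Om) \<sigma> B = (\<integral>x. 2 * L1 * (sym_part (A x) \<bullet> sym_part (B x)) + L2 * (divergence (A x) * divergence (B x)) \<partial>vol Om)"
    unfolding L2ip_def
  proof (rule integral_cong_AE)
    show "(\<lambda>x. \<sigma> x \<bullet> B x) \<in> borel_measurable (vol Om)"
      using \<sigma> B by (auto simp: sq_integrable_def)
    show "(\<lambda>x. 2 * L1 * (sym_part (A x) \<bullet> sym_part (B x)) + L2 * (divergence (A x) * divergence (B x))) \<in> borel_measurable (vol Om)"
      using int[THEN borel_measurable_integrable] by simp
    show "AE x in vol Om. \<sigma> x \<bullet> B x = 2 * L1 * (sym_part (A x) \<bullet> sym_part (B x)) + L2 * (divergence (A x) * divergence (B x))"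
      using eq by eventually_elim (simp add: elastic_stress_inner)
  qed
  also have "\<dots> = elastic_form L1 L2 A B"
    using int by (simp add: elastic_form_def L2ip_def)
  finally show ?thesis .
qed

text \<open>The velocity \<open>v\<close> is not an admissible test function, since it has no spatial derivatives. Averaged over
  \<open>[r, r + h]\<close> it is: the average is the difference quotient of the displacement.\<close>

lemma solid_energy:
  assumes "a < b" and sol: "solid_solution \<rho> L1 L2 Om Sig n a b \<eta> D\<eta> v \<sigma>"
  shows "\<rho> / 2 * L2sq (vol Om) (v b) + 1 / 2 * S_norm_sq L1 L2 Om (D\<eta> b)
    = \<rho> / 2 * L2sq (vol Om) (v a) + 1 / 2 * S_norm_sq L1 L2 Om (D\<eta> a)
      + (LINT s:{a..b}|lborel. L2ip (surf Sig) (\<lambda>x. \<sigma> s x *v n x) (v s))"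
proof -
  note F = sol[unfolded solid_solution_def]
  have v: "CL2 a b (vol Om) v" and D\<eta>: "CL2 a b (vol Om) D\<eta>" and \<sigma>: "L2L2 a b (vol Om) \<sigma>"
    and \<sigma>n: "L2L2 a b (surf Sig) (\<lambda>t x. \<sigma> t x *v n x)"
    and td: "has_time_derivative a b (vol Om) \<eta> v" "has_time_derivative a b (surf Sig) \<eta> v"
    and mb: "momentum_balance \<rho> Om Sig n a b v \<sigma>"
    using F by auto
  have vs: "L2L2 a b (surf Sig) v" and vv: "L2L2 a b (vol Om) v" and D: "L2L2 a b (vol Om) D\<eta>"
    and sqv: "t \<in> {a..b} \<Longrightarrow> sq_integrable (vol Om) (v t)" and sqD: "t \<in> {a..b} \<Longrightarrow> sq_integrable (vol Om) (D\<eta> t)" for t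
    using v D\<eta> td(2) by (auto simp: CL2_def has_time_derivative_def)
  have H1: "t \<in> {a..b} \<Longrightarrow> H1_with_trace Om n (\<eta> t) (D\<eta> t)" for t
    using F by auto
  define A where "A = (\<lambda>x y. elastic_form L1 L2 (D\<eta> x) (D\<eta> y))"
  \<comment> \<open>Unlike in the fluid, the work of the internal stress is an energy increment and
    is absorbed into the kernel. The source consists of the interface power alone.\<close>
  define G where "G = (\<lambda>x y. \<rho> * L2ip (vol Om) (v x) (v y) + A x y)"
  have contA: "continuous_on ({a..b} \<times> {a..b}) (\<lambda>z. A (fst z) (snd z))"
    unfolding A_def elastic_form_def
    by (intro continuous_intros CL2_ip_continuous CL2_linear[OF bounded_linear_sym_part D\<eta>] CL2_linear[OF bounded_linear_divergence D\<eta>])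
  have symA: "A x y = A y x" for x y
    by (simp add: A_def elastic_form_commute)
  let ?S = "\<lambda>h r x. LINT \<tau>:{r..r + h}|lborel. \<sigma> \<tau> x *v n x" and ?V = "\<lambda>h r x. LINT \<tau>:{r..r + h}|lborel. v \<tau> x"
  have "(G b b - G a a) / 2 = (LINT r:{a..b}|lborel. L2ip (surf Sig) (\<lambda>x. \<sigma> r x *v n x) (v r))"
  proof (rule kernel_energy_identity[OF \<open>a < b\<close>, where G = G and J = "\<lambda>h r. L2ip (surf Sig) (?S h r) (?V h r)"])
    show "continuous_on ({a..b} \<times> {a..b}) (\<lambda>z. G (fst z) (snd z))"
      unfolding G_def by (intro continuous_intros CL2_ip_continuous v contA)
    show "G x y = G y x" for x y
      by (simp add: G_def L2ip_commute symA)
    show "set_integrable lborel {a..b} (\<lambda>r. L2ip (surf Sig) (\<lambda>x. \<sigma> r x *v n x) (v r))"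
      by (rule L2L2_ip_integrable[OF surf_sf \<sigma>n vs])
    show "(\<lambda>i. 1 / (h i)\<^sup>2 * (LINT r:{a..t}|lborel. L2ip (surf Sig) (?S (h i) r) (?V (h i) r)))
        \<longlonglongrightarrow> (LINT r:{a..t}|lborel. L2ip (surf Sig) (\<lambda>x. \<sigma> r x *v n x) (v r))"
      if "a \<le> t" "t < b" "h \<longlonglongrightarrow> 0" "\<And>i. 0 < h i \<and> t + h i \<le> b" for t h
      by (rule L2L2_ip_average_limit[OF surf_sf \<sigma>n vs that(1,3,4)])
  next
    fix r h assume rh: "a \<le> r" "0 < h" "r + h \<le> b"
    have le: "r \<le> r + h" and I: "r \<in> {a..b}" "r + h \<in> {a..b}" using rh by auto
    have sub: "L2L2 r (r + h) (vol Om) v" "L2L2 r (r + h) (surf Sig) (\<lambda>t x. \<sigma> t x *v n x)" "L2L2 r (r + h) (vol Om) \<sigma>"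
      "L2L2 r (r + h) (surf Sig) v"
      using rh by (auto intro: L2L2_subinterval[OF vol_sf vv] L2L2_subinterval[OF surf_sf vs]
          L2L2_subinterval[OF surf_sf \<sigma>n] L2L2_subinterval[OF vol_sf \<sigma>])
    note sq\<eta> = H1_sq_integrable[OF H1[OF I(1)]] H1_sq_integrable[OF H1[OF I(2)]]
    have S: "sq_integrable (surf Sig) (?S h r)"
      by (rule sq_integrable_time_integral[OF surf_sf sub(2) sq_integrable_zero le])
    have Vv: "sq_integrable (vol Om) (?V h r)"
      by (rule sq_integrable_time_integral[OF vol_sf sub(1) sq_integrable_zero le])
    have Vs: "sq_integrable (surf Sig) (?V h r)"
      by (rule sq_integrable_time_integral[OF surf_sf sub(4) sq_integrable_zero le])
    have iV: "set_integrable lborel {r..r + h} (\<lambda>q. \<rho> * L2ip (vol Om) (v t) (v q))" if "t \<in> {a..b}" for t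
      by (intro set_integrable_mult_right L2L2_ip_integrable[OF vol_sf L2L2_const[OF vol_sf sqv[OF that]] sub(1)])
    have iA: "set_integrable lborel {r..r + h} (\<lambda>q. A t q)" if t: "t \<in> {a..b}" for t
    proof (rule borel_integrable_atLeastAtMost')
      show "continuous_on {r..r + h} (A t)"
        by (rule continuous_on_compose2[OF contA, of "{r..r + h}" "\<lambda>q. (t, q)", simplified])
          (use t rh in \<open>auto intro!: continuous_intros\<close>)
    qed
    \<comment> \<open>The work of the stress at time \<tau> on the gradient at time \<open>t\<close>
      is the elastic kernel, by the constitutive law and symmetry.\<close>
    have stress: "(LINT \<tau>:{r..r + h}|lborel. L2ip (vol Om) (\<sigma> \<tau>) (D\<eta> t)) = (LINT q:{r..r + h}|lborel. A t q)" if t: "t \<in> {a..b}" for t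
    proof (rule set_integral_cong_ae_time)
      show "set_integrable lborel {r..r + h} (\<lambda>\<tau>. L2ip (vol Om) (\<sigma> \<tau>) (D\<eta> t))"
        by (rule L2L2_ip_integrable[OF vol_sf sub(3) L2L2_const[OF vol_sf sqD[OF t]]])
      show "set_integrable lborel {r..r + h} (\<lambda>q. A t q)"
        by (rule iA[OF t])
      have "ae_time r (r + h) (\<lambda>\<tau>. AE x in vol Om. \<sigma> \<tau> x = elastic_stress L1 L2 (D\<eta> \<tau> x))"
        using F rh by (auto intro: ae_time_subinterval)
      then show "ae_time r (r + h) (\<lambda>\<tau>. L2ip (vol Om) (\<sigma> \<tau>) (D\<eta> t) = A t \<tau>)"
        unfolding ae_time_iff
      proof eventually_elim
        case (elim \<tau>)
        show ?case
        proof
          assume "\<tau> \<in> {r..r + h}"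
          then have \<tau>: "\<tau> \<in> {a..b}" using rh by auto
          have "L2ip (vol Om) (\<sigma> \<tau>) (D\<eta> t) = A \<tau> t"
            unfolding A_def using elim \<open>\<tau> \<in> {r..r + h}\<close>
            by (intro elastic_form_stress sqD \<tau> t L2L2_section[OF \<sigma>]) auto
          then show "L2ip (vol Om) (\<sigma> \<tau>) (D\<eta> t) = A t \<tau>"
            by (simp add: symA)
        qed
      qed
    qed
    have bal: "\<rho> * L2ip (vol Om) (v (r + h)) (\<eta> t) - \<rho> * L2ip (vol Om) (v r) (\<eta> t) =
        L2ip (surf Sig) (?S h r) (\<eta> t) - (LINT q:{r..r + h}|lborel. A t q)" if t: "t \<in> {a..b}" for t
    proof -
      have "AE x in surf (frontier Om - Sig). \<eta> t x = 0"
        using F t by auto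
      then have "\<rho> * L2ip (vol Om) (v (r + h)) (\<eta> t) - \<rho> * L2ip (vol Om) (v r) (\<eta> t) =
          (LINT \<tau>:{r..r + h}|lborel. L2ip (surf Sig) (\<lambda>x. \<sigma> \<tau> x *v n x) (\<eta> t)) - (LINT \<tau>:{r..r + h}|lborel. L2ip (vol Om) (\<sigma> \<tau>) (D\<eta> t))"
        using mb[unfolded momentum_balance_iff[OF \<sigma> \<sigma>n], rule_format, of "\<eta> t" "D\<eta> t" r "r + h"] rh H1[OF t] by simp
      then show ?thesis
        unfolding stress[OF t] L2ip_time_integral[OF surf_sf sub(2) H1_sq_integrable(3)[OF H1[OF t]] le] .
    qed
    \<comment> \<open>The window integral of the velocity is the increment of the displacement,
      whose two end values are admissible test functions.\<close>
    have diff_vol: "L2ip (vol Om) f (?V h r) = L2ip (vol Om) f (\<eta> (r + h)) - L2ip (vol Om) f (\<eta> r)"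
      if f: "sq_integrable (vol Om) f" for f
    proof -
      have "AE x in vol Om. \<eta> (r + h) x - \<eta> r x = ?V h r x"
        using td(1)[unfolded has_time_derivative_def, THEN conjunct2, rule_format, of r "r + h"] rh by simp
      then have "AE x in vol Om. ?V h r x = \<eta> (r + h) x - \<eta> r x"
        by eventually_elim simp
      then have "L2ip (vol Om) f (?V h r) = L2ip (vol Om) f (\<lambda>x. \<eta> (r + h) x - \<eta> r x)"
        using f Vv sq\<eta> by (intro L2ip_cong_AE sq_integrable_measurable sq_integrable_diff) auto
      then show ?thesis
        using f sq\<eta> by (simp add: L2ip_diff_right)
    qed
    have diff_surf: "L2ip (surf Sig) f (?V h r) = L2ip (surf Sig) f (\<eta> (r + h)) - L2ip (surf Sig) f (\<eta> r)"
      if f: "sq_integrable (surf Sig) f" for f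
    proof -
      have "AE x in surf Sig. \<eta> (r + h) x - \<eta> r x = ?V h r x"
        using td(2)[unfolded has_time_derivative_def, THEN conjunct2, rule_format, of r "r + h"] rh by simp
      then have "AE x in surf Sig. ?V h r x = \<eta> (r + h) x - \<eta> r x"
        by eventually_elim simp
      then have "L2ip (surf Sig) f (?V h r) = L2ip (surf Sig) f (\<lambda>x. \<eta> (r + h) x - \<eta> r x)"
        using f Vs sq\<eta> by (intro L2ip_cong_AE sq_integrable_measurable sq_integrable_diff) auto
      then show ?thesis
        using f sq\<eta> by (simp add: L2ip_diff_right)
    qed
    have kin: "(LINT q:{r..r + h}|lborel. \<rho> * L2ip (vol Om) (v t) (v q)) = \<rho> * L2ip (vol Om) (v t) (\<eta> (r + h)) - \<rho> * L2ip (vol Om) (v t) (\<eta> r)"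
      if t: "t \<in> {a..b}" for t
      using L2ip_time_integral[OF vol_sf sub(1) sqv[OF t] le] diff_vol[OF sqv[OF t]]
      by (simp add: L2ip_commute[of _ _ "v t"] right_diff_distrib)
    have "(LINT q:{r..r + h}|lborel. G (r + h) q - G r q) =
        ((LINT q:{r..r + h}|lborel. \<rho> * L2ip (vol Om) (v (r + h)) (v q)) + (LINT q:{r..r + h}|lborel. A (r + h) q))
        - ((LINT q:{r..r + h}|lborel. \<rho> * L2ip (vol Om) (v r) (v q)) + (LINT q:{r..r + h}|lborel. A r q))"
      unfolding G_def using iV[OF I(1)] iV[OF I(2)] iA[OF I(1)] iA[OF I(2)]
      by (simp only: set_integral_diff(2) set_integral_add)
    \<comment> \<open>Subtracting the balances tested with \<eta> at \<open>r + h\<close> and at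
      \<open>r\<close> reproduces both the kinetic and the elastic part of the kernel increment,
      leaving the traction against the displacement increment.\<close>
    also have "\<dots> = L2ip (surf Sig) (?S h r) (\<eta> (r + h)) - L2ip (surf Sig) (?S h r) (\<eta> r)"
      unfolding kin[OF I(1)] kin[OF I(2)] using bal[OF I(1)] bal[OF I(2)] by linarith
    also have "\<dots> = L2ip (surf Sig) (?S h r) (?V h r)"
      by (rule diff_surf[OF S, symmetric])
    finally show "(LINT q:{r..r + h}|lborel. G (r + h) q - G r q) = L2ip (surf Sig) (?S h r) (?V h r)" .
  qed
  then show ?thesis
    by (simp add: G_def A_def elastic_form_self L2ip_self field_simps)
qed

end

section \<open>Time averages and the Robin coupling\<close>

text \<open>No measurability of \<open>f\<close> is assumed: if the square is not integrable,
  \<open>L2sq M f\<close> is 0 and the bound is trivial.\<close>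

lemma L2sq_le_of_L2nn_le:
  assumes "L2nn M f \<le> ennreal c" "0 \<le> c"
  shows "L2sq M f \<le> c"
proof (cases "integrable M (\<lambda>x. (norm (f x))\<^sup>2)")
  case True
  then show ?thesis
    using assms by (simp add: L2sq_def L2nn_def nn_integral_eq_integral)
next
  case False
  then show ?thesis
    using assms(2) by (simp add: L2sq_def not_integrable_integral_eq)
qed

lemma L2sq_set_integrable:
  "sigma_finite_measure M \<Longrightarrow> L2L2 a b M f \<Longrightarrow> set_integrable lborel {a..b} (\<lambda>t. L2sq M (f t))"
  using L2L2_ip_integrable[of M a b f f] by (simp add: L2ip_self)

lemma L2nn_average_le:
  assumes M: "sigma_finite_measure M" and f: "L2L2 a b M f" and "a < b"
  shows "L2nn M (\<lambda>x. (1 / (b - a)) *\<^sub>R (LINT s:{a..b}|lborel. f s x))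
    \<le> ennreal (1 / (b - a)) * ennreal (LINT r:{a..b}|lborel. L2sq M (f r))"
proof -
  have "L2nn M (\<lambda>x. (1 / (b - a)) *\<^sub>R (LINT s:{a..b}|lborel. f s x))
      = ennreal ((1 / (b - a))\<^sup>2) * L2nn M (\<lambda>x. LINT s:{a..b}|lborel. f s x)"
  proof -
    have "(\<lambda>x. LINT s:{a..b}|lborel. f s x) \<in> borel_measurable M"
      using sq_integrable_time_integral[OF M f sq_integrable_zero] \<open>a < b\<close> by (simp add: sq_integrable_def)
    then show ?thesis
      unfolding L2nn_def ennreal_norm_scaleR_sq by (intro nn_integral_cmult) simp
  qed
  also have "\<dots> \<le> ennreal ((1 / (b - a))\<^sup>2) * (ennreal (b - a) * ennreal (LINT r:{a..b}|lborel. L2sq M (f r)))"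
    using \<open>a < b\<close> by (intro mult_left_mono L2nn_time_integral_le M f) auto
  also have "\<dots> = ennreal (1 / (b - a)) * ennreal (LINT r:{a..b}|lborel. L2sq M (f r))"
    using \<open>a < b\<close> by (intro ennreal_inverse_sq_mult) simp
  finally show ?thesis .
qed

lemma sq_integrable_average:
  assumes M: "sigma_finite_measure M" and f: "L2L2 a b M f" and "a < b"
  shows "sq_integrable M (\<lambda>x. (1 / (b - a)) *\<^sub>R (LINT s:{a..b}|lborel. f s x))"
  using sq_integrable_time_integral[OF M f sq_integrable_zero] \<open>a < b\<close> by (intro sq_integrable_scaleR) auto

lemma L2nn_increment_le:
  assumes M: "sigma_finite_measure M" and V: "has_time_derivative a b M V V'" and "a \<le> s" "s \<le> t" "t \<le> b"
  shows "L2nn M (\<lambda>x. V t x - V s x) \<le> ennreal (t - s) * ennreal (LINT r:{s..t}|lborel. L2sq M (V' r))"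
proof -
  have V': "L2L2 s t M V'"
    by (rule L2L2_subinterval[OF M V[unfolded has_time_derivative_def, THEN conjunct1]]) (use assms(3-5) in auto)
  have "AE x in M. V t x - V s x = (LINT r:{s..t}|lborel. V' r x)"
    using V[unfolded has_time_derivative_def, THEN conjunct2, rule_format, of s t] assms by simp
  then have "L2nn M (\<lambda>x. V t x - V s x) = L2nn M (\<lambda>x. LINT r:{s..t}|lborel. V' r x)"
    by (rule L2nn_cong_AE)
  then show ?thesis
    using L2nn_time_integral_le[OF M V' \<open>s \<le> t\<close>] by simp
qed

lemma L2L2_sq_integral_mono:
  assumes M: "sigma_finite_measure M" and f: "L2L2 a b M f" and "a \<le> a'" "b' \<le> b"
  shows "(LINT r:{a'..b'}|lborel. L2sq M (f r)) \<le> (LINT r:{a..b}|lborel. L2sq M (f r))"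
  unfolding set_lebesgue_integral_def
proof (rule integral_mono)
  show "integrable lborel (\<lambda>r. indicator {a'..b'} r *\<^sub>R L2sq M (f r))" "integrable lborel (\<lambda>r. indicator {a..b} r *\<^sub>R L2sq M (f r))"
    using L2sq_set_integrable[OF M L2L2_subinterval[OF M f assms(3,4)]] L2sq_set_integrable[OF M f] by (auto simp: set_integrable_def)
qed (use assms in \<open>auto split: split_indicator\<close>)

text \<open>By Jensen the squared distance to the average is at most the mean over \<open>s\<close>
  of the squared increments from \<open>s\<close> to \<open>t\<close>. Each of these is bounded by
  Cauchy-Schwarz through the derivative on \<open>[s, t]\<close>, enlarged to
  \<open>[a, t]\<close>.\<close>

lemma L2nn_lag_average_le:
  assumes M: "sigma_finite_measure M" and VL: "L2L2 0 T M V" and V: "has_time_derivative 0 T M V V'"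
    and "0 \<le> a" "a < b" "b \<le> t" "t \<le> T"
  shows "L2nn M (\<lambda>x. V t x - (1 / (b - a)) *\<^sub>R (LINT s:{a..b}|lborel. V s x))
    \<le> ennreal (t - a) * ennreal (LINT r:{a..t}|lborel. L2sq M (V' r))" (is "?L \<le> ?R")
proof -
  define R where "R = ?R"
  interpret sigma_finite_measure M by fact
  interpret pair_sigma_finite lborel M ..
  have Vab: "L2L2 a b M V"
    using assms by (intro L2L2_subinterval[OF M VL]) auto
  let ?F = "cut a b V"
  have [measurable]: "case_prod ?F \<in> borel_measurable (lborel \<Otimes>\<^sub>M M)"
    using Vab by (simp add: L2L2_iff[OF M] sq_integrable_def)
  have [measurable]: "V t \<in> borel_measurable M"
    using assms by (intro L2L2_section[OF VL]) auto
  have "?L \<le> (\<integral>\<^sup>+x. ennreal (1 / (b - a)) * (\<integral>\<^sup>+s. ennreal ((norm (V t x - ?F s x))\<^sup>2) * indicator {a..b} s \<partial>lborel) \<partial>M)"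
    unfolding L2nn_def
  proof (rule nn_integral_mono_AE)
    show "AE x in M. ennreal ((norm (V t x - (1 / (b - a)) *\<^sub>R (LINT s:{a..b}|lborel. V s x)))\<^sup>2)
        \<le> ennreal (1 / (b - a)) * (\<integral>\<^sup>+s. ennreal ((norm (V t x - ?F s x))\<^sup>2) * indicator {a..b} s \<partial>lborel)"
      using L2L2_ae_set_integrable[OF M Vab] AE_space
    proof eventually_elim
      case (elim x)
      have [measurable]: "(\<lambda>s. ?F s x) \<in> borel_measurable borel"
        using elim(2) by simp
      have F: "set_integrable lborel {a..b} (\<lambda>s. ?F s x)"
        using elim(1) by (rule set_integrable_cong[THEN iffD1, rotated -1]) auto
      have V: "(LINT s:{a..b}|lborel. ?F s x) = (LINT s:{a..b}|lborel. V s x)"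
        by (intro set_lebesgue_integral_cong) auto
      show ?case
        using norm_average_diff_sq_le[OF _ F \<open>a < b\<close>, of "V t x"] unfolding V by simp
    qed
  qed
  also have "\<dots> = ennreal (1 / (b - a)) * (\<integral>\<^sup>+x. \<integral>\<^sup>+s. ennreal ((norm (V t x - ?F s x))\<^sup>2) * indicator {a..b} s \<partial>lborel \<partial>M)"
    by (rule nn_integral_cmult) simp
  finally have A: "?L \<le> ennreal (1 / (b - a)) * (\<integral>\<^sup>+x. \<integral>\<^sup>+s. ennreal ((norm (V t x - ?F s x))\<^sup>2) * indicator {a..b} s \<partial>lborel \<partial>M)" .
  have "(\<integral>\<^sup>+x. \<integral>\<^sup>+s. ennreal ((norm (V t x - ?F s x))\<^sup>2) * indicator {a..b} s \<partial>lborel \<partial>M)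
      = (\<integral>\<^sup>+s. \<integral>\<^sup>+x. ennreal ((norm (V t x - ?F s x))\<^sup>2) * indicator {a..b} s \<partial>M \<partial>lborel)"
    by (rule Fubini') measurable
  also have "\<dots> \<le> (\<integral>\<^sup>+s. R * indicator {a..b} s \<partial>lborel)"
  proof (rule nn_integral_mono)
    fix s
    show "(\<integral>\<^sup>+x. ennreal ((norm (V t x - ?F s x))\<^sup>2) * indicator {a..b} s \<partial>M) \<le> R * indicator {a..b} s"
    proof (cases "s \<in> {a..b}")
      case True
      then have st: "0 \<le> s" "s \<le> t" "a \<le> s" using assms by auto
      have "(\<integral>\<^sup>+x. ennreal ((norm (V t x - ?F s x))\<^sup>2) * indicator {a..b} s \<partial>M) = L2nn M (\<lambda>x. V t x - V s x)"
        using True by (simp add: L2nn_def)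
      also have "\<dots> \<le> ennreal (t - s) * ennreal (LINT r:{s..t}|lborel. L2sq M (V' r))"
        by (rule L2nn_increment_le[OF M V st(1,2) \<open>t \<le> T\<close>])
      also have "\<dots> \<le> R"
        unfolding R_def
      proof (intro mult_mono ennreal_leI)
        have "L2L2 a t M V'"
          by (rule L2L2_subinterval[OF M V[unfolded has_time_derivative_def, THEN conjunct1]]) (use assms(4-7) in auto)
        then show "(LINT r:{s..t}|lborel. L2sq M (V' r)) \<le> (LINT r:{a..t}|lborel. L2sq M (V' r))"
          using st by (intro L2L2_sq_integral_mono[OF M]) auto
      qed (use st in auto)
      finally show ?thesis using True by simp
    qed simp
  qed
  also have "\<dots> = R * ennreal (b - a)"
    using \<open>a < b\<close> by (subst nn_integral_cmult_indicator) auto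
  finally have B: "(\<integral>\<^sup>+x. \<integral>\<^sup>+s. ennreal ((norm (V t x - ?F s x))\<^sup>2) * indicator {a..b} s \<partial>lborel \<partial>M) \<le> R * ennreal (b - a)" .
  have "?L \<le> ennreal (1 / (b - a)) * (R * ennreal (b - a))"
    by (rule order_trans[OF A mult_left_mono[OF B]]) simp
  also have "\<dots> = (ennreal (1 / (b - a)) * ennreal (b - a)) * R"
    by (simp only: mult.assoc mult.commute[of R])
  also have "ennreal (1 / (b - a)) * ennreal (b - a) = 1"
    using \<open>a < b\<close> by (subst ennreal_mult'[symmetric]) auto
  finally show ?thesis
    by (simp only: R_def mult_1_left)
qed


section \<open>The interface inequality behind the Robin conditions\<close>

lemma robin_identity:
  fixes e g s w :: "'b::real_inner"
  assumes "lam > 0"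
  shows "g \<bullet> e + s \<bullet> w + 1 / (2 * lam) * (norm g)\<^sup>2 + lam / 2 * (norm e)\<^sup>2 =
    1 / (2 * lam) * (norm (lam *\<^sub>R e + g - lam *\<^sub>R w))\<^sup>2 + lam / 2 * (norm (e + (1 / lam) *\<^sub>R (s + g)))\<^sup>2
    - lam / 2 * (norm (e + (1 / lam) *\<^sub>R (s + g) - w))\<^sup>2"
proof -
  let ?q = "e + (1 / lam) *\<^sub>R (s + g)"
  \<comment> \<open>The squares of \<open>?q\<close> cancel, so this difference is linear in
    \<open>?q\<close> and can be matched with the expansion of the other square.\<close>
  have 1: "(norm ?q)\<^sup>2 - (norm (?q - w))\<^sup>2 = 2 * (e \<bullet> w) + 2 / lam * (s \<bullet> w + g \<bullet> w) - w \<bullet> w"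
    by (simp add: power2_norm_eq_inner inner_diff_left inner_diff_right inner_add_left inner_commute algebra_simps)
  have 2: "(norm (lam *\<^sub>R e + g - lam *\<^sub>R w))\<^sup>2 = lam * lam * (e \<bullet> e) + g \<bullet> g + lam * lam * (w \<bullet> w)
      + 2 * lam * (g \<bullet> e) - 2 * lam * lam * (e \<bullet> w) - 2 * lam * (g \<bullet> w)"
    by (simp add: power2_norm_eq_inner inner_diff_left inner_diff_right inner_add_left inner_add_right inner_commute algebra_simps)
  have "lam / 2 * (norm ?q)\<^sup>2 - lam / 2 * (norm (?q - w))\<^sup>2 = lam / 2 * ((norm ?q)\<^sup>2 - (norm (?q - w))\<^sup>2)"
    by (rule right_diff_distrib[symmetric])
  also have "\<dots> = lam * (e \<bullet> w) + s \<bullet> w + g \<bullet> w - lam / 2 * (w \<bullet> w)"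
    unfolding 1 using assms by (simp add: field_simps)
  finally have 3: "lam / 2 * (norm ?q)\<^sup>2 - lam / 2 * (norm (?q - w))\<^sup>2 = lam * (e \<bullet> w) + s \<bullet> w + g \<bullet> w - lam / 2 * (w \<bullet> w)" .
  have "1 / (2 * lam) * (norm (lam *\<^sub>R e + g - lam *\<^sub>R w))\<^sup>2 = lam / 2 * (e \<bullet> e) + 1 / (2 * lam) * (g \<bullet> g)
      + lam / 2 * (w \<bullet> w) + g \<bullet> e - lam * (e \<bullet> w) - g \<bullet> w"
    unfolding 2 using assms by (simp add: field_simps)
  then show ?thesis
    using 3 unfolding power2_norm_eq_inner[of g] power2_norm_eq_inner[of e] by linarith
qed

text \<open>Here \<open>gt\<close> and \<open>et\<close> are arbitrary comparison values; they will
  be the averaged traction and velocity errors of the previous slab. The last term of the identity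
  is the numerical dissipation of the splitting, which pays for the term with
  \<open>norm (w - et)\<close> on the left.\<close>

lemma robin_inequality_pointwise:
  fixes e g s w gt et :: "'b::real_inner"
  assumes "lam > 0" "c > 0"
  shows "g \<bullet> e + s \<bullet> w + 1 / (2 * lam) * (norm g)\<^sup>2 + lam / 2 * (norm e)\<^sup>2 + lam / 4 * (norm (w - et))\<^sup>2
    \<le> (1 + c) * (1 / (2 * lam) * (norm gt)\<^sup>2 + lam / 2 * (norm et)\<^sup>2)
      + (2 + 1 / c) * (1 / (2 * lam) * (norm (lam *\<^sub>R e + g - lam *\<^sub>R w - gt))\<^sup>2 + lam / 2 * (norm (e + (1 / lam) *\<^sub>R (s + g) - et))\<^sup>2)"
proof -
  define gh where "gh = lam *\<^sub>R e + g - lam *\<^sub>R w"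
  define eh where "eh = e + (1 / lam) *\<^sub>R (s + g)"
  have scale: "k * x \<le> A * (k * y) + B * (k * z)" if "x \<le> A * y + B * z" "0 \<le> k" for k x A y B z :: real
    using mult_left_mono[OF that] by (simp add: algebra_simps)
  define p q r t where "p = 1 / (2 * lam) * (norm gt)\<^sup>2" and "q = lam / 2 * (norm et)\<^sup>2"
    and "r = 1 / (2 * lam) * (norm (gh - gt))\<^sup>2" and "t = lam / 2 * (norm (eh - et))\<^sup>2"
  have "(norm gh)\<^sup>2 \<le> (1 + c) * (norm gt)\<^sup>2 + (1 + 1 / c) * (norm (gh - gt))\<^sup>2"
    using norm_add_sq_Young[OF assms(2), of gt "gh - gt"] by simp
  \<comment> \<open>Enlarged only so that both remainders carry the same factor.\<close>
  also have "\<dots> \<le> (1 + c) * (norm gt)\<^sup>2 + (2 + 1 / c) * (norm (gh - gt))\<^sup>2"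
    using assms(2) by (intro add_left_mono mult_right_mono) auto
  finally have 1: "1 / (2 * lam) * (norm gh)\<^sup>2 \<le> (1 + c) * p + (2 + 1 / c) * r"
    unfolding p_def r_def using assms(1) by (intro scale) auto
  have 2: "lam / 2 * (norm eh)\<^sup>2 \<le> (1 + c) * q + (1 + 1 / c) * t"
    unfolding q_def t_def using norm_add_sq_Young[OF assms(2), of et "eh - et"] assms(1) by (intro scale) auto
  \<comment> \<open>Inserting \<open>eh\<close> splits the term in two. The part with
    \<open>eh - w\<close> is consumed by the dissipation; the part with \<open>eh - et\<close> adds
    one more \<open>t\<close>, which turns 1 + 1/c into 2 + 1/c.\<close>
  have "lam / 4 * (norm (w - et))\<^sup>2 \<le> 2 * (lam / 4 * (norm (eh - et))\<^sup>2) + 2 * (lam / 4 * (norm (eh - w))\<^sup>2)"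
    using norm_diff_sq_le[of "eh - et" "eh - w"] assms(1) by (intro scale) auto
  then have 3: "lam / 4 * (norm (w - et))\<^sup>2 \<le> t + lam / 2 * (norm (eh - w))\<^sup>2"
    by (simp add: t_def)
  have 4: "(1 + c) * (p + q) = (1 + c) * p + (1 + c) * q" "(2 + 1 / c) * (r + t) = (2 + 1 / c) * r + (1 + 1 / c) * t + t"
    by (simp_all add: algebra_simps add_divide_distrib)
  show ?thesis
    unfolding robin_identity[OF assms(1)] gh_def[symmetric] eh_def[symmetric] p_def[symmetric] q_def[symmetric] r_def[symmetric] t_def[symmetric] 4
    using 1 2 3 by linarith
qed

lemma robin_inequality:
  fixes e g s w gt et :: "'a \<Rightarrow> 'b::euclidean_space"
  assumes lc: "lam > 0" "c > 0"
    and sq: "sq_integrable P e" "sq_integrable P g" "sq_integrable P s" "sq_integrable P w" "sq_integrable P gt" "sq_integrable P et"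
  shows "L2ip P g e + L2ip P s w + 1 / (2 * lam) * L2sq P g + lam / 2 * L2sq P e + lam / 4 * L2sq P (\<lambda>x. w x - et x)
    \<le> (1 + c) * (1 / (2 * lam) * L2sq P gt + lam / 2 * L2sq P et)
      + (2 + 1 / c) * (1 / (2 * lam) * L2sq P (\<lambda>x. lam *\<^sub>R e x + g x - lam *\<^sub>R w x - gt x)
        + lam / 2 * L2sq P (\<lambda>x. e x + (1 / lam) *\<^sub>R (s x + g x) - et x))"
proof -
  have nsq: "integrable P (\<lambda>x. (norm (f x))\<^sup>2)" if "sq_integrable P f" for f :: "'a \<Rightarrow> 'b"
    using that by (simp add: sq_integrable_def)
  have q1: "sq_integrable P (\<lambda>x. w x - et x)" and q2: "sq_integrable P (\<lambda>x. lam *\<^sub>R e x + g x - lam *\<^sub>R w x - gt x)"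
    and q3: "sq_integrable P (\<lambda>x. e x + (1 / lam) *\<^sub>R (s x + g x) - et x)"
    by (intro sq_integrable_diff sq_integrable_add sq_integrable_scaleR sq)+
  note int = sq[THEN nsq] q1[THEN nsq] q2[THEN nsq] q3[THEN nsq] sq_integrable_inner[OF sq(2,1)] sq_integrable_inner[OF sq(3,4)]
  have "(\<integral>x. g x \<bullet> e x + s x \<bullet> w x + 1 / (2 * lam) * (norm (g x))\<^sup>2 + lam / 2 * (norm (e x))\<^sup>2 + lam / 4 * (norm (w x - et x))\<^sup>2 \<partial>P)
    \<le> (\<integral>x. (1 + c) * (1 / (2 * lam) * (norm (gt x))\<^sup>2 + lam / 2 * (norm (et x))\<^sup>2)
      + (2 + 1 / c) * (1 / (2 * lam) * (norm (lam *\<^sub>R e x + g x - lam *\<^sub>R w x - gt x))\<^sup>2 + lam / 2 * (norm (e x + (1 / lam) *\<^sub>R (s x + g x) - et x))\<^sup>2) \<partial>P)"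
    by (intro integral_mono robin_inequality_pointwise[OF lc] Bochner_Integration.integrable_add integrable_mult_right int)
  then show ?thesis
    using int unfolding L2sq_def L2ip_def by simp
qed

text \<open>The previous inequality on the product space, applied to extensions by zero. Since
  \<open>gt\<close> and \<open>et\<close> do not depend on time, their norms acquire the length of
  the slab.\<close>

lemma robin_slab_inequality:
  fixes e g s w :: "real \<Rightarrow> 'a \<Rightarrow> 'b::euclidean_space"
  assumes M: "sigma_finite_measure M" and lc: "lam > 0" "c > 0" and "a \<le> b"
    and L: "L2L2 a b M e" "L2L2 a b M g" "L2L2 a b M s" "L2L2 a b M w" and sq: "sq_integrable M gt" "sq_integrable M et"
  shows "(LINT t:{a..b}|lborel. L2ip M (g t) (e t)) + (LINT t:{a..b}|lborel. L2ip M (s t) (w t))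
      + 1 / (2 * lam) * (LINT t:{a..b}|lborel. L2sq M (g t)) + lam / 2 * (LINT t:{a..b}|lborel. L2sq M (e t))
      + lam / 4 * (LINT t:{a..b}|lborel. L2sq M (\<lambda>x. w t x - et x))
    \<le> (1 + c) * (1 / (2 * lam) * ((b - a) * L2sq M gt) + lam / 2 * ((b - a) * L2sq M et))
      + (2 + 1 / c) * (1 / (2 * lam) * (LINT t:{a..b}|lborel. L2sq M (\<lambda>x. lam *\<^sub>R e t x + g t x - lam *\<^sub>R w t x - gt x))
        + lam / 2 * (LINT t:{a..b}|lborel. L2sq M (\<lambda>x. e t x + (1 / lam) *\<^sub>R (s t x + g t x) - et x)))"
proof -
  let ?N = "lborel \<Otimes>\<^sub>M M" and ?C = "\<lambda>f. case_prod (cut a b f)"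
  have scaleR: "L2L2 a b M (\<lambda>t x. r *\<^sub>R f t x)" if "L2L2 a b M f" for r and f :: "real \<Rightarrow> 'a \<Rightarrow> 'b"
    by (rule L2L2_linear[OF bounded_linear_scaleR_right that])
  have add: "L2L2 a b M (\<lambda>t x. f t x + h t x)" if "L2L2 a b M f" "L2L2 a b M h" for f h :: "real \<Rightarrow> 'a \<Rightarrow> 'b"
    using L2L2_diff[OF that(1) scaleR[OF that(2), of "- 1"]] by simp
  have Lgt: "L2L2 a b M (\<lambda>t. gt)" and Let: "L2L2 a b M (\<lambda>t. et)"
    by (intro L2L2_const[OF M] sq)+
  have q1: "L2L2 a b M (\<lambda>t x. w t x - et x)"
    and q2: "L2L2 a b M (\<lambda>t x. lam *\<^sub>R e t x + g t x - lam *\<^sub>R w t x - gt x)"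
    and q3: "L2L2 a b M (\<lambda>t x. e t x + (1 / lam) *\<^sub>R (s t x + g t x) - et x)"
    by (intro L2L2_diff add scaleR L Lgt Let)+
  have eq: "?C (\<lambda>t x. w t x - et x) = (\<lambda>z. ?C w z - ?C (\<lambda>t. et) z)"
    "?C (\<lambda>t x. lam *\<^sub>R e t x + g t x - lam *\<^sub>R w t x - gt x) = (\<lambda>z. lam *\<^sub>R ?C e z + ?C g z - lam *\<^sub>R ?C w z - ?C (\<lambda>t. gt) z)"
    "?C (\<lambda>t x. e t x + (1 / lam) *\<^sub>R (s t x + g t x) - et x) = (\<lambda>z. ?C e z + (1 / lam) *\<^sub>R (?C s z + ?C g z) - ?C (\<lambda>t. et) z)"
    by (auto simp: cut_def split: split_indicator)
  have const: "L2sq ?N (?C (\<lambda>t. f)) = (b - a) * L2sq M f" if f: "sq_integrable M f" for f :: "'a \<Rightarrow> 'b"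
    using L2L2_sq_integral[OF M L2L2_const[OF M f], of a b] \<open>a \<le> b\<close> by (simp add: set_integral_const)
  show ?thesis
    unfolding L2L2_ip_integral[OF M L(2,1)] L2L2_ip_integral[OF M L(3,4)] L2L2_sq_integral[OF M L(1)] L2L2_sq_integral[OF M L(2)]
      L2L2_sq_integral[OF M q1] L2L2_sq_integral[OF M q2] L2L2_sq_integral[OF M q3] eq const[OF sq(1), symmetric] const[OF sq(2), symmetric]
    by (rule robin_inequality[OF lc L[unfolded L2L2_iff[OF M]] Lgt[unfolded L2L2_iff[OF M]] Let[unfolded L2L2_iff[OF M]]])
qed

text \<open>In \<open>V t x - slab_average dt v n x - et x\<close> the iterate cancels, because
  \<open>et\<close> is the averaged error of the same slab. What remains is the exact trace minus
  its own average over the previous slab, so the lag involves the exact solution only. For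
  \<open>n = 0\<close> there is no previous slab and the comparison is with the initial
  value.\<close>

lemma
  fixes V :: "real \<Rightarrow> 'a \<Rightarrow> 'b::euclidean_space" and v :: "nat \<Rightarrow> real \<Rightarrow> 'a \<Rightarrow> 'b"
  assumes M: "sigma_finite_measure M" and VL: "L2L2 0 T M V" and V: "has_time_derivative 0 T M V V'"
    and dt: "0 < dt" and n: "(real n + 1) * dt \<le> T"
    and v0: "n = 0 \<Longrightarrow> AE x in M. v 0 0 x = V 0 x"
    and v: "n \<noteq> 0 \<Longrightarrow> L2L2 ((real n - 1) * dt) (real n * dt) M (v n)"
  defines "et \<equiv> \<lambda>x. if n = 0 then 0 else slab_average dt (\<lambda>n t x. V t x - v n t x) n x"
  shows slab_average_error_sq_integrable: "sq_integrable M et"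
    and slab_average_error_le: "dt * L2sq M et \<le> (if n = 0 then 0 else LINT t:{(real n - 1) * dt..real n * dt}|lborel. L2sq M (\<lambda>x. V t x - v n t x))"
    and slab_average_lag_le: "t \<in> {real n * dt..(real n + 1) * dt} \<Longrightarrow>
      L2nn M (\<lambda>x. V t x - slab_average dt v n x - et x) \<le> ennreal (2 * dt * (LINT r:{real (n - 1) * dt..(real n + 1) * dt}|lborel. L2sq M (V' r)))"
proof -
  let ?a = "(real n - 1) * dt" and ?b = "real n * dt" and ?d = "(real n + 1) * dt"
  have V'L: "L2L2 0 T M V'"
    using V by (simp add: has_time_derivative_def)
  have ba: "?b - ?a = dt" by (simp add: algebra_simps)
  have pos: "n \<noteq> 0 \<Longrightarrow> 0 \<le> ?a" using dt by simp
  have ab: "?a < ?b" using dt by simp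
  have bd: "?b \<le> ?d" using dt by simp
  have VLs: "L2L2 ?a ?b M V" if "n \<noteq> 0"
    using pos[OF that] bd n by (intro L2L2_subinterval[OF M VL]) auto
  have eL: "L2L2 ?a ?b M (\<lambda>t x. V t x - v n t x)" if "n \<noteq> 0"
    by (intro L2L2_diff VLs v that)
  have sa: "slab_average dt f n = (\<lambda>x. (1 / (?b - ?a)) *\<^sub>R (LINT s:{?a..?b}|lborel. f n s x))" if "n \<noteq> 0" for f :: "nat \<Rightarrow> real \<Rightarrow> 'a \<Rightarrow> 'b"
    using that unfolding ba by (auto simp: slab_average_def)
  show "sq_integrable M et"
    using sq_integrable_average[OF M eL ab] by (cases "n = 0") (simp_all add: et_def sa)
  show "dt * L2sq M et \<le> (if n = 0 then 0 else LINT t:{?a..?b}|lborel. L2sq M (\<lambda>x. V t x - v n t x))"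
  proof (cases "n = 0")
    case True
    then show ?thesis by (simp add: et_def L2sq_def)
  next
    case False
    have nn: "0 \<le> (LINT t:{?a..?b}|lborel. L2sq M (\<lambda>x. V t x - v n t x))"
      unfolding set_lebesgue_integral_def by (intro integral_nonneg_AE) auto
    have "L2nn M et \<le> ennreal (1 / dt) * ennreal (LINT t:{?a..?b}|lborel. L2sq M (\<lambda>x. V t x - v n t x))"
      using L2nn_average_le[OF M eL[OF False] ab] False unfolding et_def by (simp add: sa ba)
    also have "\<dots> = ennreal (1 / dt * (LINT t:{?a..?b}|lborel. L2sq M (\<lambda>x. V t x - v n t x)))"
      using dt by (intro ennreal_mult'[symmetric]) simp
    finally have "L2sq M et \<le> 1 / dt * (LINT t:{?a..?b}|lborel. L2sq M (\<lambda>x. V t x - v n t x))"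
      using nn dt by (intro L2sq_le_of_L2nn_le) auto
    then show ?thesis
      using dt False by (simp add: field_simps)
  qed
  assume t: "t \<in> {?b..?d}"
  \<comment> \<open>Subtraction of naturals truncates: for \<open>n = 0\<close> the interval starts
    at time 0, otherwise it covers the current and the previous slab.\<close>
  let ?I = "LINT r:{real (n - 1) * dt..?d}|lborel. L2sq M (V' r)"
  have VT: "L2L2 (real (n - 1) * dt) ?d M V'"
    using n dt by (intro L2L2_subinterval[OF M V'L]) auto
  have "L2nn M (\<lambda>x. V t x - slab_average dt v n x - et x) \<le> ennreal (2 * dt) * ennreal ?I"
  proof (cases "n = 0")
    case True
    have "AE x in M. v 0 0 x = V 0 x" by (rule v0[OF True])
    then have "AE x in M. V t x - slab_average dt v n x - et x = V t x - V 0 x"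
      by eventually_elim (simp add: et_def True slab_average_def)
    then have "L2nn M (\<lambda>x. V t x - slab_average dt v n x - et x) = L2nn M (\<lambda>x. V t x - V 0 x)"
      by (rule L2nn_cong_AE)
    also have "\<dots> \<le> ennreal (t - 0) * ennreal (LINT r:{0..t}|lborel. L2sq M (V' r))"
      using t True n by (intro L2nn_increment_le[OF M V]) auto
    also have "\<dots> \<le> ennreal (2 * dt) * ennreal ?I"
    proof (intro mult_mono ennreal_leI)
      show "(LINT r:{0..t}|lborel. L2sq M (V' r)) \<le> ?I"
        using t True by (intro L2L2_sq_integral_mono[OF M VT]) auto
    qed (use t True dt in auto)
    finally show ?thesis .
  next
    case False
    have r1: "real (n - 1) = real n - 1" using False by simp
    have "AE x in M. set_integrable lborel {?a..?b} (\<lambda>s. V s x)" "AE x in M. set_integrable lborel {?a..?b} (\<lambda>s. v n s x)"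
      by (rule L2L2_ae_set_integrable[OF M VLs[OF False]], rule L2L2_ae_set_integrable[OF M v[OF False]])
    \<comment> \<open>The averages of the iterate cancel at the points where both time integrals
      exist.\<close>
    then have "AE x in M. V t x - slab_average dt v n x - et x = V t x - (1 / (?b - ?a)) *\<^sub>R (LINT s:{?a..?b}|lborel. V s x)"
    proof eventually_elim
      case (elim x)
      have "(LINT s:{?a..?b}|lborel. V s x - v n s x) = (LINT s:{?a..?b}|lborel. V s x) - (LINT s:{?a..?b}|lborel. v n s x)"
        using elim by (rule set_integral_diff(2))
      then show ?case
        using False by (simp add: et_def sa scaleR_diff_right)
    qed
    then have "L2nn M (\<lambda>x. V t x - slab_average dt v n x - et x)
        = L2nn M (\<lambda>x. V t x - (1 / (?b - ?a)) *\<^sub>R (LINT s:{?a..?b}|lborel. V s x))"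
      by (rule L2nn_cong_AE)
    also have "\<dots> \<le> ennreal (t - ?a) * ennreal (LINT r:{?a..t}|lborel. L2sq M (V' r))"
      using t n by (intro L2nn_lag_average_le[OF M VL V pos[OF False] ab]) auto
    also have "\<dots> \<le> ennreal (2 * dt) * ennreal ?I"
    proof (intro mult_mono ennreal_leI)
      show "(LINT r:{?a..t}|lborel. L2sq M (V' r)) \<le> ?I"
        unfolding r1 using t by (intro L2L2_sq_integral_mono[OF M VT[unfolded r1]]) auto
      show "t - ?a \<le> 2 * dt"
        using t by (simp add: algebra_simps)
    qed auto
    finally show ?thesis .
  qed
  then show "L2nn M (\<lambda>x. V t x - slab_average dt v n x - et x) \<le> ennreal (2 * dt * ?I)"
    using dt by (simp add: ennreal_mult')
qed

section \<open>Summation over the slabs\<close>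

lemma sum_slab_integrals:
  fixes q :: "real \<Rightarrow> real"
  assumes q: "set_integrable lborel {0..real N * dt} q" and "0 < dt" and "m \<le> N"
  shows "(\<Sum>k<m. LINT r:{real k * dt..(real k + 1) * dt}|lborel. q r) = (LINT r:{0..real m * dt}|lborel. q r)"
  using \<open>m \<le> N\<close>
proof (induction m)
  case 0
  show ?case
    using set_borel_integral_eq_integral(2)[OF set_integrable_subset[OF q, of "{0..0}"]] \<open>0 < dt\<close> by simp
next
  case (Suc m)
  have le: "real m * dt \<le> (real m + 1) * dt" "(real m + 1) * dt \<le> real N * dt" "0 \<le> real m * dt"
    using Suc.prems \<open>0 < dt\<close> by (auto intro!: mult_right_mono)
  have sub: "set_integrable lborel {0..real m * dt} q" "set_integrable lborel {real m * dt..(real m + 1) * dt} q"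
    "set_integrable lborel {0..(real m + 1) * dt} q"
    using le by (auto intro!: set_integrable_subset[OF q])
  have "integral {0..real m * dt} q + integral {real m * dt..(real m + 1) * dt} q = integral {0..(real m + 1) * dt} q"
    using le set_borel_integral_eq_integral(1)[OF sub(3)] by (intro Henstock_Kurzweil_Integration.integral_combine) auto
  then have "(LINT r:{0..real m * dt}|lborel. q r) + (LINT r:{real m * dt..(real m + 1) * dt}|lborel. q r) = (LINT r:{0..(real m + 1) * dt}|lborel. q r)"
    using set_borel_integral_eq_integral(2)[OF sub(1)] set_borel_integral_eq_integral(2)[OF sub(2)]
      set_borel_integral_eq_integral(2)[OF sub(3)] by simp
  then show ?case
    using Suc by (simp add: add.commute)
qed

text \<open>Window \<open>k\<close> consists of slabs \<open>k - 1\<close> and \<open>k\<close>, or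
  of slab 0 alone when \<open>k = 0\<close>, so no slab is counted more than twice.\<close>

lemma sum_overlapping_slab_integrals:
  fixes q :: "real \<Rightarrow> real"
  assumes q: "set_integrable lborel {0..real N * dt} q" and dt: "0 < dt" and nonneg: "\<And>r. 0 \<le> q r"
  shows "(\<Sum>k<N. LINT r:{real (k - 1) * dt..(real k + 1) * dt}|lborel. q r) \<le> 2 * (LINT r:{0..real N * dt}|lborel. q r)"
proof -
  let ?s = "\<lambda>k. LINT r:{real k * dt..(real k + 1) * dt}|lborel. q r"
  have s0: "0 \<le> ?s k" for k
    unfolding set_lebesgue_integral_def by (intro integral_nonneg_AE) (auto simp: nonneg)
  have split: "(LINT r:{real (k - 1) * dt..(real k + 1) * dt}|lborel. q r) = (if k = 0 then 0 else ?s (k - 1)) + ?s k" if k: "k < N" for k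
  proof (cases k)
    case 0
    then show ?thesis by simp
  next
    case (Suc j)
    have le: "real j * dt \<le> (real j + 1) * dt" "(real j + 1) * dt \<le> (real k + 1) * dt" "(real k + 1) * dt \<le> real N * dt" "0 \<le> real j * dt"
      using k dt Suc by (auto intro!: mult_right_mono)
    have sub: "set_integrable lborel {real j * dt..(real j + 1) * dt} q" "set_integrable lborel {(real j + 1) * dt..(real k + 1) * dt} q"
      "set_integrable lborel {real j * dt..(real k + 1) * dt} q"
      using le by (auto intro!: set_integrable_subset[OF q])
    have "integral {real j * dt..(real j + 1) * dt} q + integral {(real j + 1) * dt..(real k + 1) * dt} q = integral {real j * dt..(real k + 1) * dt} q"
      using le set_borel_integral_eq_integral(1)[OF sub(3)] by (intro Henstock_Kurzweil_Integration.integral_combine) auto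
    then show ?thesis
      using set_borel_integral_eq_integral(2)[OF sub(1)] set_borel_integral_eq_integral(2)[OF sub(2)]
        set_borel_integral_eq_integral(2)[OF sub(3)] Suc by (simp add: add.commute)
  qed
  have "(\<Sum>k<N. LINT r:{real (k - 1) * dt..(real k + 1) * dt}|lborel. q r) = (\<Sum>k<N. if k = 0 then 0 else ?s (k - 1)) + (\<Sum>k<N. ?s k)"
    unfolding sum.distrib[symmetric] by (intro sum.cong split) auto
  also have "(\<Sum>k<N. if k = 0 then 0 else ?s (k - 1)) \<le> (\<Sum>k<N. ?s k)"
  proof (cases N)
    case (Suc m)
    have "(\<Sum>k<Suc m. if k = 0 then 0 else ?s (k - 1)) = (\<Sum>k<m. ?s k)"
      by (subst sum.lessThan_Suc_shift) simp
    then show ?thesis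
      using s0[of m] by (simp add: Suc)
  qed simp
  also have "(\<Sum>k<N. ?s k) = (LINT r:{0..real N * dt}|lborel. q r)"
    by (rule sum_slab_integrals[OF q dt order_refl])
  finally show ?thesis by simp
qed

lemma discrete_gronwall:
  fixes x r :: "nat \<Rightarrow> real"
  assumes "0 \<le> c" "x 0 \<le> 0" "\<And>n. n < N \<Longrightarrow> x (Suc n) \<le> (1 + c) * x n + r n" "\<And>n. 0 \<le> r n" "m \<le> N"
  shows "x m \<le> (1 + c) ^ m * (\<Sum>k<m. r k)"
  using \<open>m \<le> N\<close>
proof (induction m)
  case 0
  then show ?case using assms(2) by simp
next
  case (Suc m)
  have "x (Suc m) \<le> (1 + c) * x m + r m"
    using Suc.prems by (intro assms(3)) simp
  also have "\<dots> \<le> (1 + c) * ((1 + c) ^ m * (\<Sum>k<m. r k)) + (1 + c) ^ Suc m * r m"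
  proof (intro add_mono mult_left_mono)
    \<comment> \<open>The new remainder is given the full growth factor. This is harmless since the
      factor will stay below 3.\<close>
    have "1 \<le> (1 + c) ^ Suc m" using assms(1) by (intro one_le_power) simp
    then show "r m \<le> (1 + c) ^ Suc m * r m"
      using assms(4)[of m] by (simp add: mult_le_cancel_right1)
  qed (use Suc assms(1) in auto)
  also have "\<dots> = (1 + c) ^ Suc m * (\<Sum>k<Suc m. r k)"
    by (simp add: algebra_simps)
  finally show ?case .
qed

lemma set_integral_le_const:
  assumes "ae_time a b (\<lambda>t. f t \<le> K)" "0 \<le> K" "a \<le> b"
  shows "(LINT t:{a..b}|lborel. f t) \<le> (b - a) * (K :: real)"
proof -
  have "(LINT t:{a..b}|lborel. f t) \<le> (LINT t:{a..b}|lborel. K)"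
    unfolding set_lebesgue_integral_def
  proof (rule integral_mono_AE')
    show "integrable lborel (\<lambda>t. indicator {a..b} t *\<^sub>R K)"
      by (intro integrable_scaleR_left integrable_real_indicator) (auto simp: emeasure_lborel_Icc_eq)
    show "AE t in lborel. indicator {a..b} t *\<^sub>R f t \<le> indicator {a..b} t *\<^sub>R K"
      using assms(1) unfolding ae_time_iff by eventually_elim (auto split: split_indicator)
    show "AE t in lborel. 0 \<le> indicator {a..b} t *\<^sub>R K"
      using assms(2) by (auto split: split_indicator)
  qed
  also have "\<dots> = (b - a) * K"
    using assms(3) by (simp add: set_integral_const)
  finally show ?thesis .
qed

lemma L2sq_integral_le_of_L2nn_le:
  assumes eq: "ae_time a b (\<lambda>t. AE x in M. f t x = g t x)" and le: "\<And>t. t \<in> {a..b} \<Longrightarrow> L2nn M (g t) \<le> ennreal K"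
    and "0 \<le> K" "a \<le> b"
  shows "(LINT t:{a..b}|lborel. L2sq M (f t)) \<le> (b - a) * K"
proof (rule set_integral_le_const)
  show "ae_time a b (\<lambda>t. L2sq M (f t) \<le> K)"
    using eq unfolding ae_time_iff
  proof eventually_elim
    case (elim t)
    then show ?case
      using L2nn_cong_AE[of "f t" "g t" M] le[of t] \<open>0 \<le> K\<close> by (auto intro: L2sq_le_of_L2nn_le)
  qed
qed (use assms in auto)

text \<open>Stated as an inequality because \<open>p\<close> is not assumed measurable. This matters
  for the iterate of index 0, of which only its values almost everywhere are known; a default value
  0 on the left keeps the bound true.\<close>

lemma L2sq_integral_cong_AE_le:
  assumes M: "sigma_finite_measure M" and g: "L2L2 a b M g" and q: "sq_integrable M q" and eq: "AE x in M. p x = q x"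
  shows "(LINT t:{a..b}|lborel. L2sq M (\<lambda>x. g t x - p x)) \<le> (LINT t:{a..b}|lborel. L2sq M (\<lambda>x. g t x - q x))"
  unfolding set_lebesgue_integral_def
proof (rule integral_mono_AE')
  have gq: "L2L2 a b M (\<lambda>t x. g t x - q x)"
    by (intro L2L2_diff g L2L2_const M q)
  show "integrable lborel (\<lambda>t. indicator {a..b} t *\<^sub>R L2sq M (\<lambda>x. g t x - q x))"
    using L2sq_set_integrable[OF M gq] by (simp add: set_integrable_def)
  show "AE t in lborel. indicator {a..b} t *\<^sub>R L2sq M (\<lambda>x. g t x - p x) \<le> indicator {a..b} t *\<^sub>R L2sq M (\<lambda>x. g t x - q x)"
    using L2L2_ae_sq_integrable[OF M gq] unfolding ae_time_iff
  proof eventually_elim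
    case (elim t)
    have "AE x in M. g t x - p x = g t x - q x"
      using eq by eventually_elim simp
    then have "L2nn M (\<lambda>x. g t x - p x) = L2nn M (\<lambda>x. g t x - q x)"
      by (rule L2nn_cong_AE)
    then have "L2sq M (\<lambda>x. g t x - p x) \<le> L2sq M (\<lambda>x. g t x - q x)" if "t \<in> {a..b}"
      using elim that by (intro L2sq_le_of_L2nn_le) (auto simp: L2nn_eq_L2sq)
    then show ?case by (auto split: split_indicator)
  qed
  show "AE t in lborel. 0 \<le> indicator {a..b} t *\<^sub>R L2sq M (\<lambda>x. g t x - q x)"
    by (auto split: split_indicator)
qed

section \<open>The error estimate\<close>

lemma LINT_L2sq_nonneg: "0 \<le> (LINT t:A|lborel. L2sq M (f t))"
  unfolding set_lebesgue_integral_def by (intro integral_nonneg_AE) auto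

lemma fsi_geometry_domains:
  assumes "fsi_geometry Oms Omf ns nf"
  shows "domain_with_interface Omf (interface Oms Omf) nf" "domain_with_interface Oms (interface Oms Omf) ns"
  using assms by (auto simp: fsi_geometry_def interface_def domain_with_interface_def intro: closed_Int)

lemma L2sq_zero_AE: "AE x in M. f x = 0 \<Longrightarrow> f \<in> borel_measurable M \<Longrightarrow> L2sq M f = 0"
  unfolding L2sq_def by (intro integral_eq_zero_AE) auto

lemma S_norm_sq_cong_AE:
  assumes "sq_integrable (vol Om) A" "sq_integrable (vol Om) B" "AE x in vol Om. A x = B x"
  shows "S_norm_sq L1 L2 Om A = S_norm_sq L1 L2 Om B"
proof -
  note lin = sq_integrable_linear[OF bounded_linear_sym_part] sq_integrable_linear[OF bounded_linear_divergence]
  have "L2sq (vol Om) (\<lambda>x. sym_part (A x)) = L2sq (vol Om) (\<lambda>x. sym_part (B x))"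
    by (rule L2sq_cong_AE) (use assms lin(1) in \<open>auto intro: sq_integrable_measurable\<close>)
  moreover have "L2sq (vol Om) (\<lambda>x. divergence (A x)) = L2sq (vol Om) (\<lambda>x. divergence (B x))"
    by (rule L2sq_cong_AE) (use assms lin(2) in \<open>auto intro: sq_integrable_measurable\<close>)
  ultimately show ?thesis by (simp add: S_norm_sq_def)
qed

text \<open>Pointwise on the interface, \<open>su\<close> and \<open>sg\<close> are the averages of velocity and traction over the previous slab.\<close>

lemma robin_error_conditions:
  fixes U u dE dn Sf sf Ss ss su sg :: "'b::real_vector"
  assumes "lam \<noteq> 0" "U = dE" "Ss + Sf = 0" "lam *\<^sub>R dn + ss = lam *\<^sub>R su - sg" "lam *\<^sub>R u + sf = lam *\<^sub>R dn + sg"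
  shows "lam *\<^sub>R (U - u) + (Sf - sf) - lam *\<^sub>R (dE - dn) = Sf - sg"
    and "(U - u) + (1 / lam) *\<^sub>R ((Ss - ss) + (Sf - sf)) = U - su"
proof -
  have sf: "sf = lam *\<^sub>R dn + sg - lam *\<^sub>R u" and ss: "ss = lam *\<^sub>R su - sg - lam *\<^sub>R dn" and Ss: "Ss = - Sf"
    using assms by (simp_all add: algebra_simps eq_neg_iff_add_eq_0)
  show "lam *\<^sub>R (U - u) + (Sf - sf) - lam *\<^sub>R (dE - dn) = Sf - sg"
    by (simp add: sf assms(2) algebra_simps)
  have "(Ss - ss) + (Sf - sf) = lam *\<^sub>R (u - su)"
    by (simp add: sf ss Ss algebra_simps)
  then show "(U - u) + (1 / lam) *\<^sub>R ((Ss - ss) + (Sf - sf)) = U - su"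
    using assms(1) by simp
qed

text \<open>The constant 18 is 3 * 3 * 2: a bound for (1 + 1/N)^N, the bound 2 + N \<le> 3N, and the
  double count of slabs. It depends neither on the geometry nor on the material parameters.\<close>

lemma splitting_error_estimate:
  fixes Oms Omf :: "(real ^ 'd::finite) set" and ns nf :: "real ^ 'd \<Rightarrow> real ^ 'd"
  assumes geo: "fsi_geometry Oms Omf ns nf"
    and pos: "\<rho>f > 0" "\<rho>s > 0" "\<mu> > 0" "L1 > 0" "L2 \<ge> 0" "lam > 0" "N \<ge> 1" "dt > 0" and T: "T = real N * dt"
    and exact: "coupled_solution \<rho>f \<rho>s \<mu> L1 L2 Oms Omf ns nf T U DU P SF E DE dE SS"
    and init: "splitting_initialization Oms Omf nf U SF E dE u sf \<eta> d\<eta>"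
    and steps: "\<forall>n<N. solid_step \<rho>s L1 L2 Oms Omf ns nf lam dt n u sf \<eta> D\<eta> d\<eta> ss \<and>
           fluid_step \<rho>f \<mu> Oms Omf nf lam dt n u Du p sf d\<eta>"
    and dtU: "has_time_derivative 0 T (surf (interface Oms Omf)) U dtU"
    and dtS: "has_time_derivative 0 T (surf (interface Oms Omf)) (\<lambda>t x. SF t x *v nf x) dtSFn"
  defines "M \<equiv> surf (interface Oms Omf)"
    and "tm \<equiv> \<lambda>n. real n * dt"
    and "eu \<equiv> \<lambda>n t x. U t x - u n t x"
    and "Deu \<equiv> \<lambda>n t x. DU t x - Du n t x"
    and "efn \<equiv> \<lambda>n t x. (SF t x - sf n t x) *v nf x"
    and "De\<eta> \<equiv> \<lambda>n t x. DE t x - D\<eta> n t x"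
    and "de\<eta> \<equiv> \<lambda>n t x. dE t x - d\<eta> n t x"
  shows "\<rho>f / 2 * L2sq (vol Omf) (eu N (tm N)) + \<rho>s / 2 * L2sq (vol Oms) (de\<eta> N (tm N)) + 1 / 2 * S_norm_sq L1 L2 Oms (De\<eta> N (tm N))
      + (\<Sum>n=1..N. 2 * \<mu> * (LINT s:{tm (n - 1)..tm n}|lborel. L2sq (vol Omf) (\<lambda>x. sym_part (Deu n s x)))
          + lam / 4 * (LINT s:{tm (n - 1)..tm n}|lborel. L2sq M (\<lambda>x. de\<eta> n s x - slab_average dt eu (n - 1) x)))
      + (1 / (2 * lam) * (LINT s:{tm (N - 1)..tm N}|lborel. L2sq M (efn N s))
        + lam / 2 * (LINT s:{tm (N - 1)..tm N}|lborel. L2sq M (eu N s)))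
    \<le> 18 * dt * T * (lam * (LINT s:{0..T}|lborel. L2sq M (dtU s)) + 1 / lam * (LINT s:{0..T}|lborel. L2sq M (dtSFn s)))"
proof -
  define Sig where "Sig = interface Oms Omf"
  interpret F: domain_with_interface Omf Sig nf
    unfolding Sig_def by (rule fsi_geometry_domains[OF geo])
  interpret S: domain_with_interface Oms Sig ns
    unfolding Sig_def by (rule fsi_geometry_domains[OF geo])
  have M: "M = surf Sig" by (simp add: M_def Sig_def)
  have Msf: "sigma_finite_measure M" unfolding M by (rule F.surf_sf)
  have Fex: "fluid_solution \<rho>f \<mu> Omf Sig nf 0 T U DU P SF"
    and Sex: "solid_solution \<rho>s L1 L2 Oms Sig ns 0 T E DE dE SS"
    and ifU: "ae_time 0 T (\<lambda>t. AE x in M. U t x = dE t x)"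
    and ifS: "ae_time 0 T (\<lambda>t. AE x in M. SS t x *v ns x + SF t x *v nf x = 0)"
    using exact unfolding M Sig_def coupled_solution_def Let_def by auto
  let ?SFn = "\<lambda>t x. SF t x *v nf x" and ?sfn = "\<lambda>n t x. sf n t x *v nf x"
  have UL: "L2L2 0 T M U" and SL: "L2L2 0 T M ?SFn"
    using Fex by (simp_all add: fluid_solution_def M)
  note dtU = dtU[folded M_def] and dtS = dtS[folded M_def]
  have efn_eq: "efn n t x = ?SFn t x - ?sfn n t x" for n t x
    by (simp add: efn_def matrix_vector_mult_diff_rdistrib)
  define es where "es = (\<lambda>n t x. (SS t x - ss n t x) *v ns x)"
  have es_eq: "es n t x = SS t x *v ns x - ss n t x *v ns x" for n t x
    by (simp add: es_def matrix_vector_mult_diff_rdistrib)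
  have tm: "tm n < tm (Suc n)" "0 \<le> tm n" "tm (Suc n) - tm n = dt" "(real n + 1) * dt = tm (Suc n)" for n
    using pos(8) by (simp_all add: tm_def algebra_simps)
  have tmT: "tm (Suc n) \<le> T" if "n < N" for n
    unfolding tm_def T using that pos(8) by (intro mult_right_mono) auto
  have fl: "fluid_solution \<rho>f \<mu> Omf Sig nf (tm n) (tm (Suc n)) (u (Suc n)) (Du (Suc n)) (p (Suc n)) (sf (Suc n))"
    and sl: "solid_solution \<rho>s L1 L2 Oms Sig ns (tm n) (tm (Suc n)) (\<eta> (Suc n)) (D\<eta> (Suc n)) (d\<eta> (Suc n)) (ss (Suc n))"
    and rf: "ae_time (tm n) (tm (Suc n)) (\<lambda>t. AE x in M. lam *\<^sub>R u (Suc n) t x + ?sfn (Suc n) t x = lam *\<^sub>R d\<eta> (Suc n) t x + slab_average dt ?sfn n x)"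
    and rs: "ae_time (tm n) (tm (Suc n)) (\<lambda>t. AE x in M. lam *\<^sub>R d\<eta> (Suc n) t x + ss (Suc n) t x *v ns x = lam *\<^sub>R slab_average dt u n x - slab_average dt ?sfn n x)"
    and cu: "AE x in vol Omf. u (Suc n) (tm n) x = u n (tm n) x"
    and c\<eta>: "AE x in vol Oms. \<eta> (Suc n) (tm n) x = \<eta> n (tm n) x"
    and cd: "AE x in vol Oms. d\<eta> (Suc n) (tm n) x = d\<eta> n (tm n) x"
    if "n < N" for n
    using steps[rule_format, OF that] unfolding M Sig_def tm_def fluid_step_def solid_step_def Let_def by blast+
  have fe: "fluid_solution \<rho>f \<mu> Omf Sig nf (tm n) (tm (Suc n)) (eu (Suc n)) (Deu (Suc n)) (\<lambda>t x. P t x - p (Suc n) t x) (\<lambda>t x. SF t x - sf (Suc n) t x)"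
    if "n < N" for n
    unfolding eu_def Deu_def
    by (rule F.fluid_solution_diff[OF F.fluid_solution_subinterval[OF Fex tm(2) tmT[OF that]] fl[OF that]])
  have se: "solid_solution \<rho>s L1 L2 Oms Sig ns (tm n) (tm (Suc n)) (\<lambda>t x. E t x - \<eta> (Suc n) t x) (De\<eta> (Suc n)) (de\<eta> (Suc n)) (\<lambda>t x. SS t x - ss (Suc n) t x)"
    if "n < N" for n
    unfolding De\<eta>_def de\<eta>_def
    by (rule S.solid_solution_diff[OF S.solid_solution_subinterval[OF Sex tm(2) tmT[OF that]] sl[OF that]])
  have L_eu: "L2L2 (tm n) (tm (Suc n)) M (eu (Suc n))" and L_efn: "L2L2 (tm n) (tm (Suc n)) M (efn (Suc n))"
    and L_es: "L2L2 (tm n) (tm (Suc n)) M (es (Suc n))" and L_de: "L2L2 (tm n) (tm (Suc n)) M (de\<eta> (Suc n))"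
    if "n < N" for n
    using fe[OF that] se[OF that] unfolding fluid_solution_def solid_solution_def has_time_derivative_def efn_def es_def M
    by simp_all
  have L_u: "L2L2 (tm n) (tm (Suc n)) M (u (Suc n))" and L_sf: "L2L2 (tm n) (tm (Suc n)) M (?sfn (Suc n))" if "n < N" for n
    using fl[OF that] by (simp_all add: fluid_solution_def M)
  \<comment> \<open>Set to 0 for \<open>n = 0\<close>: there \<open>slab_average\<close> of the
    error vanishes only almost everywhere, and an exact 0 is measurable.\<close>
  define et where "et = (\<lambda>n x. if n = 0 then 0 else slab_average dt (\<lambda>n t x. U t x - u n t x) n x)"
  define gt where "gt = (\<lambda>n x. if n = 0 then 0 else slab_average dt (\<lambda>n t x. ?SFn t x - ?sfn n t x) n x)"
  define IU where "IU = (\<lambda>n. LINT r:{real (n - 1) * dt..(real n + 1) * dt}|lborel. L2sq M (dtU r))"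
  define IS where "IS = (\<lambda>n. LINT r:{real (n - 1) * dt..(real n + 1) * dt}|lborel. L2sq M (dtSFn r))"
  have u0: "AE x in M. u 0 0 x = U 0 x" "AE x in M. ?sfn 0 0 x = ?SFn 0 x"
    using init unfolding splitting_initialization_def M Sig_def by blast+
  have prev: "L2L2 ((real n - 1) * dt) (real n * dt) M (u n)" "L2L2 ((real n - 1) * dt) (real n * dt) M (?sfn n)"
    if n: "n \<noteq> 0" "n < N" for n
  proof -
    obtain k where k: "n = Suc k" using n(1) by (cases n) auto
    then have "k < N" "tm k = (real n - 1) * dt" "tm (Suc k) = real n * dt"
      using n by (simp_all add: tm_def)
    then show "L2L2 ((real n - 1) * dt) (real n * dt) M (u n)" "L2L2 ((real n - 1) * dt) (real n * dt) M (?sfn n)"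
      using L_u[of k] L_sf[of k] k by simp_all
  qed
  have nT: "(real n + 1) * dt \<le> T" if "n < N" for n
    using tmT[OF that] tm(4)[of n] by simp
  have lagU: "sq_integrable M (et n)"
    "dt * L2sq M (et n) \<le> (if n = 0 then 0 else LINT t:{(real n - 1) * dt..real n * dt}|lborel. L2sq M (\<lambda>x. U t x - u n t x))"
    "t \<in> {real n * dt..(real n + 1) * dt} \<Longrightarrow> L2nn M (\<lambda>x. U t x - slab_average dt u n x - et n x) \<le> ennreal (2 * dt * IU n)"
    if n: "n < N" for n t
    unfolding et_def IU_def
    by (rule slab_average_error_sq_integrable[OF Msf UL dtU pos(8) nT[OF n] u0(1) prev(1)[OF _ n]]
        slab_average_error_le[OF Msf UL dtU pos(8) nT[OF n] u0(1) prev(1)[OF _ n]]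
        slab_average_lag_le[OF Msf UL dtU pos(8) nT[OF n] u0(1) prev(1)[OF _ n]]; assumption)+
  have lagS: "sq_integrable M (gt n)"
    "dt * L2sq M (gt n) \<le> (if n = 0 then 0 else LINT t:{(real n - 1) * dt..real n * dt}|lborel. L2sq M (\<lambda>x. ?SFn t x - ?sfn n t x))"
    "t \<in> {real n * dt..(real n + 1) * dt} \<Longrightarrow> L2nn M (\<lambda>x. ?SFn t x - slab_average dt ?sfn n x - gt n x) \<le> ennreal (2 * dt * IS n)"
    if n: "n < N" for n t
    unfolding gt_def IS_def
    by (rule slab_average_error_sq_integrable[where v = ?sfn, OF Msf SL dtS pos(8) nT[OF n] u0(2) prev(2)[OF _ n]]
        slab_average_error_le[where v = ?sfn, OF Msf SL dtS pos(8) nT[OF n] u0(2) prev(2)[OF _ n]]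
        slab_average_lag_le[where v = ?sfn, OF Msf SL dtS pos(8) nT[OF n] u0(2) prev(2)[OF _ n]]; assumption)+
  have IU0: "0 \<le> IU n" and IS0: "0 \<le> IS n" for n
    by (simp_all add: IU_def IS_def LINT_L2sq_nonneg)
  define Ee where "Ee = (\<lambda>k t. \<rho>f / 2 * L2sq (vol Omf) (eu k t) + \<rho>s / 2 * L2sq (vol Oms) (de\<eta> k t) + 1 / 2 * S_norm_sq L1 L2 Oms (De\<eta> k t))"
  define Y where "Y = (\<lambda>k. 1 / (2 * lam) * (LINT s:{tm (k - 1)..tm k}|lborel. L2sq M (efn k s)) + lam / 2 * (LINT s:{tm (k - 1)..tm k}|lborel. L2sq M (eu k s)))"
  define D where "D = (\<lambda>k. 2 * \<mu> * (LINT s:{tm (k - 1)..tm k}|lborel. L2sq (vol Omf) (\<lambda>x. sym_part (Deu k s x)))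
      + lam / 4 * (LINT s:{tm (k - 1)..tm k}|lborel. L2sq M (\<lambda>x. de\<eta> k s x - et (k - 1) x)))"
  have Snn: "0 \<le> S_norm_sq L1 L2 Oms A" for A
    using pos by (simp add: S_norm_sq_def)
  have Enn: "0 \<le> Ee k t" and Ynn: "0 \<le> Y k" and Dnn: "0 \<le> D k" for k t
    using pos Snn by (simp_all add: Ee_def Y_def D_def LINT_L2sq_nonneg)
  \<comment> \<open>The sum of the two energy identities; the interface powers of fluid and solid
    are all that couples them.\<close>
  have energy: "Ee (Suc n) (tm (Suc n)) + 2 * \<mu> * (LINT s:{tm n..tm (Suc n)}|lborel. L2sq (vol Omf) (\<lambda>x. sym_part (Deu (Suc n) s x)))
      = Ee (Suc n) (tm n) + (LINT s:{tm n..tm (Suc n)}|lborel. L2ip M (efn (Suc n) s) (eu (Suc n) s))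
        + (LINT s:{tm n..tm (Suc n)}|lborel. L2ip M (es (Suc n) s) (de\<eta> (Suc n) s))" if n: "n < N" for n
    using F.fluid_energy[OF tm(1) fe[OF n]] S.solid_energy[OF tm(1) se[OF n]] unfolding Ee_def M efn_def es_def by linarith
  have sqe: "sq_integrable (vol Omf) (eu (Suc n) t)" "sq_integrable (vol Oms) (de\<eta> (Suc n) t)"
    "sq_integrable (vol Oms) (De\<eta> (Suc n) t)" "H1_with_trace Oms ns (\<lambda>x. E t x - \<eta> (Suc n) t x) (De\<eta> (Suc n) t)"
    if "n < N" "t \<in> {tm n..tm (Suc n)}" for n t
    using fe[OF that(1)] se[OF that(1)] that(2) unfolding fluid_solution_def solid_solution_def CL2_def by blast+
  have openS: "open Oms"
    using S.dom by (simp add: lipschitz_domain_def)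
  have zero_mat: "sym_part 0 = (0 :: real ^ 'd ^ 'd)" "divergence (0 :: real ^ 'd ^ 'd) = 0"
    using linear_0[OF bounded_linear.linear[OF bounded_linear_sym_part]] linear_0[OF bounded_linear.linear[OF bounded_linear_divergence]] by auto
  \<comment> \<open>Velocities are handed over almost everywhere, so their energies match at once.
    For the elastic energy the gradients must match, which follows from uniqueness of the weak
    gradient of the difference of the two displacement errors.\<close>
  have start: "Ee (Suc n) (tm n) = (if n = 0 then 0 else Ee n (tm n))" if n: "n < N" for n
  proof (cases n)
    case 0
    have t0: "tm n = 0" "tm n \<in> {tm n..tm (Suc n)}" using 0 tm(1)[of n] by (simp_all add: tm_def)
    note sq = sqe[OF n t0(2)]
    have i: "AE x in vol Omf. u 0 0 x = U 0 x" "AE x in vol Oms. \<eta> 0 0 x = E 0 x" "AE x in vol Oms. d\<eta> 0 0 x = dE 0 x"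
      using init unfolding splitting_initialization_def by blast+
    have "AE x in vol Omf. eu (Suc n) (tm n) x = 0"
      using i(1) cu[OF n] unfolding t0(1) by eventually_elim (simp add: eu_def 0)
    then have 1: "L2sq (vol Omf) (eu (Suc n) (tm n)) = 0"
      by (rule L2sq_zero_AE) (rule sq_integrable_measurable[OF sq(1)])
    have "AE x in vol Oms. de\<eta> (Suc n) (tm n) x = 0"
      using i(3) cd[OF n] unfolding t0(1) by eventually_elim (simp add: de\<eta>_def 0)
    then have 2: "L2sq (vol Oms) (de\<eta> (Suc n) (tm n)) = 0"
      by (rule L2sq_zero_AE) (rule sq_integrable_measurable[OF sq(2)])
    have "AE x in vol Oms. E (tm n) x - \<eta> (Suc n) (tm n) x = 0"
      using i(2) c\<eta>[OF n] unfolding t0(1) by eventually_elim (simp add: 0)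
    then have "AE x in vol Oms. De\<eta> (Suc n) (tm n) x = 0"
      by (rule H1_gradient_unique[OF openS sq(4)])
    then have "S_norm_sq L1 L2 Oms (De\<eta> (Suc n) (tm n)) = S_norm_sq L1 L2 Oms (\<lambda>x. 0)"
      by (rule S_norm_sq_cong_AE[OF sq(3) sq_integrable_zero])
    also have "\<dots> = 0"
      by (simp add: S_norm_sq_def L2sq_def zero_mat)
    finally show ?thesis
      using 1 2 0 by (simp add: Ee_def)
  next
    case (Suc k)
    have k: "k < N" "tm n \<in> {tm k..tm (Suc k)}" "tm n \<in> {tm n..tm (Suc n)}"
      using n Suc tm(1)[of n] tm(1)[of k] by auto
    note sq = sqe[OF n k(3)] and sq' = sqe[OF k(1,2), folded Suc]
    have "AE x in vol Omf. eu (Suc n) (tm n) x = eu n (tm n) x"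
      using cu[OF n] by eventually_elim (simp add: eu_def)
    then have 1: "L2sq (vol Omf) (eu (Suc n) (tm n)) = L2sq (vol Omf) (eu n (tm n))"
      by (rule L2sq_cong_AE) (intro sq_integrable_measurable sq(1) sq'(1))+
    have "AE x in vol Oms. de\<eta> (Suc n) (tm n) x = de\<eta> n (tm n) x"
      using cd[OF n] by eventually_elim (simp add: de\<eta>_def)
    then have 2: "L2sq (vol Oms) (de\<eta> (Suc n) (tm n)) = L2sq (vol Oms) (de\<eta> n (tm n))"
      by (rule L2sq_cong_AE) (intro sq_integrable_measurable sq(2) sq'(2))+
    have "AE x in vol Oms. E (tm n) x - \<eta> (Suc n) (tm n) x - (E (tm n) x - \<eta> n (tm n) x) = 0"
      using c\<eta>[OF n] by eventually_elim simp
    then have "AE x in vol Oms. De\<eta> (Suc n) (tm n) x - De\<eta> n (tm n) x = 0"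
      by (rule H1_gradient_unique[OF openS H1_with_trace_diff[OF S.dom S.nrm sq(4) sq'(4)]])
    then have "AE x in vol Oms. De\<eta> (Suc n) (tm n) x = De\<eta> n (tm n) x"
      by eventually_elim simp
    then have "S_norm_sq L1 L2 Oms (De\<eta> (Suc n) (tm n)) = S_norm_sq L1 L2 Oms (De\<eta> n (tm n))"
      by (rule S_norm_sq_cong_AE[OF sq(3) sq'(3)])
    then show ?thesis
      using 1 2 Suc by (simp add: Ee_def)
  qed
  \<comment> \<open>The exact solution satisfies the same Robin conditions with its own
    instantaneous values in place of averages, so the two incoming combinations reduce to exact
    trace minus averaged iterate.\<close>
  have robin: "ae_time (tm n) (tm (Suc n)) (\<lambda>t. AE x in M.
      lam *\<^sub>R eu (Suc n) t x + efn (Suc n) t x - lam *\<^sub>R de\<eta> (Suc n) t x - gt n x = ?SFn t x - slab_average dt ?sfn n x - gt n x \<and>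
      eu (Suc n) t x + (1 / lam) *\<^sub>R (es (Suc n) t x + efn (Suc n) t x) - et n x = U t x - slab_average dt u n x - et n x)"
    if n: "n < N" for n
  proof -
    have "ae_time (tm n) (tm (Suc n)) (\<lambda>t. (AE x in M. U t x = dE t x) \<and> (AE x in M. SS t x *v ns x + ?SFn t x = 0)
      \<and> (AE x in M. lam *\<^sub>R d\<eta> (Suc n) t x + ss (Suc n) t x *v ns x = lam *\<^sub>R slab_average dt u n x - slab_average dt ?sfn n x)
      \<and> (AE x in M. lam *\<^sub>R u (Suc n) t x + ?sfn (Suc n) t x = lam *\<^sub>R d\<eta> (Suc n) t x + slab_average dt ?sfn n x))"
      by (intro ae_time_conj ae_time_subinterval[OF ifU tm(2) tmT[OF n]] ae_time_subinterval[OF ifS tm(2) tmT[OF n]] rs[OF n] rf[OF n])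
    then show ?thesis
      unfolding ae_time_def
    proof eventually_elim
      case (elim t)
      note el = elim[THEN conjunct1] elim[THEN conjunct2, THEN conjunct1] elim[THEN conjunct2, THEN conjunct2, THEN conjunct1]
        elim[THEN conjunct2, THEN conjunct2, THEN conjunct2]
      show ?case
        using el(1) el(2) el(3) el(4)
      proof eventually_elim
        case (elim x)
        have "lam \<noteq> 0" using pos(6) by simp
        from robin_error_conditions[OF this elim]
        show ?case by (simp only: eu_def efn_eq es_eq de\<eta>_def)
      qed
    qed
  qed
  have slab: "{tm n..tm (Suc n)} = {real n * dt..(real n + 1) * dt}" for n
    by (simp add: tm(4)) (simp add: tm_def)
  have A: "(LINT t:{tm n..tm (Suc n)}|lborel. L2sq M (\<lambda>x. lam *\<^sub>R eu (Suc n) t x + efn (Suc n) t x - lam *\<^sub>R de\<eta> (Suc n) t x - gt n x))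
      \<le> dt * (2 * dt * IS n)" if n: "n < N" for n
    unfolding tm(3)[of n, symmetric]
  proof (rule L2sq_integral_le_of_L2nn_le)
    show "ae_time (tm n) (tm (Suc n)) (\<lambda>t. AE x in M. lam *\<^sub>R eu (Suc n) t x + efn (Suc n) t x - lam *\<^sub>R de\<eta> (Suc n) t x - gt n x
        = ?SFn t x - slab_average dt ?sfn n x - gt n x)"
      using robin[OF n] unfolding ae_time_def by eventually_elim auto
  qed (use lagS(3)[OF n] IS0[of n] pos(8) less_imp_le[OF tm(1)[of n]] in \<open>auto simp: slab tm(3)\<close>)
  have B: "(LINT t:{tm n..tm (Suc n)}|lborel. L2sq M (\<lambda>x. eu (Suc n) t x + (1 / lam) *\<^sub>R (es (Suc n) t x + efn (Suc n) t x) - et n x))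
      \<le> dt * (2 * dt * IU n)" if n: "n < N" for n
    unfolding tm(3)[of n, symmetric]
  proof (rule L2sq_integral_le_of_L2nn_le)
    show "ae_time (tm n) (tm (Suc n)) (\<lambda>t. AE x in M. eu (Suc n) t x + (1 / lam) *\<^sub>R (es (Suc n) t x + efn (Suc n) t x) - et n x
        = U t x - slab_average dt u n x - et n x)"
      using robin[OF n] unfolding ae_time_def by eventually_elim auto
  qed (use lagU(3)[OF n] IU0[of n] pos(8) less_imp_le[OF tm(1)[of n]] in \<open>auto simp: slab tm(3)\<close>)
  \<comment> \<open>The largest growth rate of this order whose N-fold compounding remains
    bounded.\<close>
  define c where "c = 1 / real N"
  have c: "c > 0" using pos(7) by (simp add: c_def)
  \<comment> \<open>Averaging does not increase the mean square, so the averaged errors are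
    dominated by the interface energy of the previous slab.\<close>
  have prevY: "1 / (2 * lam) * (dt * L2sq M (gt n)) + lam / 2 * (dt * L2sq M (et n)) \<le> (if n = 0 then 0 else Y n)" if n: "n < N" for n
  proof (cases "n = 0")
    case True
    then show ?thesis by (simp add: gt_def et_def L2sq_def)
  next
    case False
    have t: "tm (n - 1) = (real n - 1) * dt" "tm n = real n * dt"
      using False by (simp_all add: tm_def)
    have "dt * L2sq M (gt n) \<le> (LINT t:{tm (n - 1)..tm n}|lborel. L2sq M (efn n t))"
      using lagS(2)[OF n] False unfolding t efn_eq by simp
    moreover have "dt * L2sq M (et n) \<le> (LINT t:{tm (n - 1)..tm n}|lborel. L2sq M (eu n t))"
      using lagU(2)[OF n] False unfolding t eu_def by simp
    ultimately have "1 / (2 * lam) * (dt * L2sq M (gt n)) + lam / 2 * (dt * L2sq M (et n)) \<le> Y n"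
      unfolding Y_def using pos(6) by (intro add_mono mult_left_mono) auto
    then show ?thesis using False by simp
  qed
  \<comment> \<open>Here 2 + N is 2 + 1/c; the factors 1/2 of the interface energy have cancelled
    the 2 in the length \<open>2 * dt\<close> of the lag.\<close>
  define r where "r = (\<lambda>n. (2 + real N) * (dt\<^sup>2 * (IS n / lam + lam * IU n)))"
  have rnn: "0 \<le> r n" for n
    using IS0[of n] IU0[of n] pos by (simp add: r_def)
  \<comment> \<open>Starts from 0 because the index 0 iterates have no slab: only their initial
    values carry information, and there the error vanishes.\<close>
  define X where "X = (\<lambda>k. if k = 0 then 0 else Ee k (tm k) + (\<Sum>i=1..k. D i) + Y k)"
  have step: "X (Suc n) \<le> (1 + c) * X n + r n" if n: "n < N" for n
  proof -
    let ?e0 = "if n = 0 then 0 else Ee n (tm n)" and ?y0 = "if n = 0 then 0 else Y n"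
    let ?A = "LINT t:{tm n..tm (Suc n)}|lborel. L2sq M (\<lambda>x. lam *\<^sub>R eu (Suc n) t x + efn (Suc n) t x - lam *\<^sub>R de\<eta> (Suc n) t x - gt n x)"
    let ?B = "LINT t:{tm n..tm (Suc n)}|lborel. L2sq M (\<lambda>x. eu (Suc n) t x + (1 / lam) *\<^sub>R (es (Suc n) t x + efn (Suc n) t x) - et n x)"
    have "1 / (2 * lam) * ?A + lam / 2 * ?B \<le> 1 / (2 * lam) * (dt * (2 * dt * IS n)) + lam / 2 * (dt * (2 * dt * IU n))"
      using A[OF n] B[OF n] pos(6) by (intro add_mono mult_left_mono) auto
    also have "\<dots> = dt\<^sup>2 * (IS n / lam + lam * IU n)"
      using pos(6) by (simp add: field_simps power2_eq_square)
    finally have "(2 + 1 / c) * (1 / (2 * lam) * ?A + lam / 2 * ?B) \<le> (2 + 1 / c) * (dt\<^sup>2 * (IS n / lam + lam * IU n))"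
      using c by (intro mult_left_mono) auto
    also have "\<dots> = r n"
      using pos(7) by (simp add: r_def c_def)
    finally have lag: "(2 + 1 / c) * (1 / (2 * lam) * ?A + lam / 2 * ?B) \<le> r n" .
    have y: "(1 + c) * (1 / (2 * lam) * (dt * L2sq M (gt n)) + lam / 2 * (dt * L2sq M (et n))) \<le> (1 + c) * ?y0"
      using prevY[OF n] c by (intro mult_left_mono) auto
    note ineq = robin_slab_inequality[OF Msf pos(6) c less_imp_le[OF tm(1)] L_eu[OF n] L_efn[OF n] L_es[OF n] L_de[OF n] lagS(1)[OF n] lagU(1)[OF n]]
    have "Ee (Suc n) (tm (Suc n)) + D (Suc n) + Y (Suc n) \<le> ?e0 + (1 + c) * ?y0 + r n"
      using ineq energy[OF n] start[OF n] y lag unfolding D_def Y_def tm(3) diff_Suc_1 by linarith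
    moreover have "X (Suc n) = Ee (Suc n) (tm (Suc n)) + D (Suc n) + Y (Suc n) + (if n = 0 then 0 else (\<Sum>i=1..n. D i))"
      by (simp add: X_def)
    moreover have "X n = ?e0 + ?y0 + (if n = 0 then 0 else (\<Sum>i=1..n. D i))"
      by (simp add: X_def)
    \<comment> \<open>Young's inequality inflates only the interface part of \<open>X n\<close>. The
      rest is nonnegative and may be inflated as well, which gives the form required by the Gronwall
      lemma.\<close>
    moreover have "0 \<le> ?e0 + (if n = 0 then 0 else (\<Sum>i=1..n. D i))"
      using Enn Dnn by (simp add: sum_nonneg)
    then have "0 \<le> c * (?e0 + (if n = 0 then 0 else (\<Sum>i=1..n. D i)))"
      using c by simp
    ultimately show ?thesis
      by (simp add: distrib_left distrib_right)
  qed
  define QU where "QU = (LINT s:{0..T}|lborel. L2sq M (dtU s))"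
  define QS where "QS = (LINT s:{0..T}|lborel. L2sq M (dtSFn s))"
  have QU0: "0 \<le> QU" and QS0: "0 \<le> QS" by (simp_all add: QU_def QS_def LINT_L2sq_nonneg)
  have dL: "L2L2 0 T M dtU" "L2L2 0 T M dtSFn"
    using dtU dtS by (simp_all add: has_time_derivative_def)
  have sumU: "(\<Sum>k<N. IU k) \<le> 2 * QU" and sumS: "(\<Sum>k<N. IS k) \<le> 2 * QS"
    unfolding IU_def IS_def QU_def QS_def T
    by (intro sum_overlapping_slab_integrals[OF L2sq_set_integrable[OF Msf, folded T] pos(8)] dL[unfolded T] L2sq_nonneg;
        simp add: L2sq_set_integrable[OF Msf] dL[unfolded T])+
  have "X N \<le> (1 + c) ^ N * (\<Sum>k<N. r k)"
    by (rule discrete_gronwall[where N = N and r = r]) (use c step rnn in \<open>auto simp: X_def\<close>)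
  also have "\<dots> \<le> 3 * (\<Sum>k<N. r k)"
  proof (rule mult_right_mono)
    \<comment> \<open>Compounding N times at rate 1/N gives at most e, whatever N and T are.\<close>
    have "(1 + c) ^ N \<le> exp c ^ N"
      using c by (intro power_mono exp_ge_add_one_self) auto
    also have "\<dots> = exp 1"
      using pos(7) by (simp add: c_def flip: exp_of_nat_mult)
    also have "\<dots> \<le> 3" by (rule exp_le)
    finally show "(1 + c) ^ N \<le> 3" .
    show "0 \<le> (\<Sum>k<N. r k)" using rnn by (simp add: sum_nonneg)
  qed
  finally have X3: "X N \<le> 3 * (\<Sum>k<N. r k)" .
  have "(\<Sum>k<N. r k) = (2 + real N) * (dt\<^sup>2 * ((\<Sum>k<N. IS k) / lam + lam * (\<Sum>k<N. IU k)))"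
    by (simp add: r_def sum_distrib_left sum.distrib sum_divide_distrib distrib_left)
  also have "\<dots> \<le> (3 * real N) * (dt\<^sup>2 * (2 * QS / lam + lam * (2 * QU)))"
  proof (rule mult_mono)
    show "2 + real N \<le> 3 * real N" using pos(7) by simp
    show "dt\<^sup>2 * ((\<Sum>k<N. IS k) / lam + lam * (\<Sum>k<N. IU k)) \<le> dt\<^sup>2 * (2 * QS / lam + lam * (2 * QU))"
      using pos(6) by (intro mult_left_mono add_mono divide_right_mono sumU sumS) auto
    have "0 \<le> (\<Sum>k<N. IS k)" "0 \<le> (\<Sum>k<N. IU k)"
      using IS0 IU0 by (simp_all add: sum_nonneg)
    then show "0 \<le> dt\<^sup>2 * ((\<Sum>k<N. IS k) / lam + lam * (\<Sum>k<N. IU k))"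
      using pos(6) by simp
  qed simp
  finally have "X N \<le> 3 * (3 * real N * (dt\<^sup>2 * (2 * QS / lam + lam * (2 * QU))))"
    using X3 by linarith
  also have "\<dots> = 18 * dt * T * (lam * QU + 1 / lam * QS)"
    unfolding T by (simp add: power2_eq_square algebra_simps add_divide_distrib)
  finally have main: "X N \<le> 18 * dt * T * (lam * QU + 1 / lam * QS)" .
  \<comment> \<open>\<open>D\<close> was built with \<open>et\<close>, the goal with the slab
    average of the error. They differ only in slab 1, where they agree almost everywhere, and an
    upper bound is enough.\<close>
  have dis: "(LINT s:{tm (n - 1)..tm n}|lborel. L2sq M (\<lambda>x. de\<eta> n s x - slab_average dt eu (n - 1) x))
      \<le> (LINT s:{tm (n - 1)..tm n}|lborel. L2sq M (\<lambda>x. de\<eta> n s x - et (n - 1) x))" if n: "n \<in> {1..N}" for n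
  proof -
    obtain k where k: "n = Suc k" "k < N" using n by (cases n) auto
    have "AE x in M. slab_average dt eu k x = et k x"
    proof (cases "k = 0")
      case True
      show ?thesis
        using u0(1) by eventually_elim (simp add: True slab_average_def et_def eu_def)
    next
      case False
      then show ?thesis by (simp add: et_def eu_def)
    qed
    from L2sq_integral_cong_AE_le[OF Msf L_de[OF k(2)] lagU(1)[OF k(2)] this]
    show ?thesis by (simp add: k)
  qed
  have "(\<Sum>n=1..N. 2 * \<mu> * (LINT s:{tm (n - 1)..tm n}|lborel. L2sq (vol Omf) (\<lambda>x. sym_part (Deu n s x)))
          + lam / 4 * (LINT s:{tm (n - 1)..tm n}|lborel. L2sq M (\<lambda>x. de\<eta> n s x - slab_average dt eu (n - 1) x))) \<le> (\<Sum>n=1..N. D n)"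
    unfolding D_def using pos(6) by (intro sum_mono add_left_mono mult_left_mono dis) auto
  moreover have "X N = Ee N (tm N) + (\<Sum>n=1..N. D n) + Y N"
    using pos(7) by (simp add: X_def)
  ultimately show ?thesis
    using main unfolding Ee_def Y_def QU_def QS_def by linarith
qed

theorem theorem5p2:
  fixes Oms Omf :: "(real ^ 'd::finite) set"
    and ns nf :: "real ^ 'd \<Rightarrow> real ^ 'd"
    and \<rho>f \<rho>s \<mu> L1 L2 :: real
  assumes "fsi_geometry Oms Omf ns nf"
    and "\<rho>f > 0" "\<rho>s > 0" "\<mu> > 0" "L1 > 0" "L2 \<ge> 0"
  shows "\<exists>C>0. \<forall>(lam::real) (N::nat) (dt::real) (T::real)
      (U :: real \<Rightarrow> real ^ 'd \<Rightarrow> real ^ 'd) DU P SF E DE dE SS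
      (u :: nat \<Rightarrow> real \<Rightarrow> real ^ 'd \<Rightarrow> real ^ 'd) Du p sf \<eta> D\<eta> d\<eta> ss
      dtU dtSFn.
    lam > 0 \<and> N \<ge> 1 \<and> dt > 0 \<and> T = real N * dt \<and>
    coupled_solution \<rho>f \<rho>s \<mu> L1 L2 Oms Omf ns nf T U DU P SF E DE dE SS \<and>
    splitting_initialization Oms Omf nf U SF E dE u sf \<eta> d\<eta> \<and>
    (\<forall>n<N. solid_step \<rho>s L1 L2 Oms Omf ns nf lam dt n u sf \<eta> D\<eta> d\<eta> ss \<and>
           fluid_step \<rho>f \<mu> Oms Omf nf lam dt n u Du p sf d\<eta>) \<and>
    has_time_derivative 0 T (surf (interface Oms Omf)) U dtU \<and>
    has_time_derivative 0 T (surf (interface Oms Omf)) (\<lambda>t x. SF t x *v nf x) dtSFn \<longrightarrow>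
    (let Sig = interface Oms Omf;
         tm = (\<lambda>n. real n * dt);
         eu = (\<lambda>n t x. U t x - u n t x);
         Deu = (\<lambda>n t x. DU t x - Du n t x);
         efn = (\<lambda>n t x. (SF t x - sf n t x) *v nf x);
         De\<eta> = (\<lambda>n t x. DE t x - D\<eta> n t x);
         de\<eta> = (\<lambda>n t x. dE t x - d\<eta> n t x);
         EN = \<rho>f / 2 * L2sq (vol Omf) (eu N (tm N)) + \<rho>s / 2 * L2sq (vol Oms) (de\<eta> N (tm N))
              + 1 / 2 * S_norm_sq L1 L2 Oms (De\<eta> N (tm N));
         TT = (\<lambda>n. 2 * \<mu> * (LINT s:{tm (n - 1)..tm n}|lborel. L2sq (vol Omf) (\<lambda>x. sym_part (Deu n s x)))
              + lam / 4 * (LINT s:{tm (n - 1)..tm n}|lborel.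
                             L2sq (surf Sig) (\<lambda>x. de\<eta> n s x - slab_average dt eu (n - 1) x)));
         SN = 1 / (2 * lam) * (LINT s:{tm (N - 1)..tm N}|lborel. L2sq (surf Sig) (efn N s))
              + lam / 2 * (LINT s:{tm (N - 1)..tm N}|lborel. L2sq (surf Sig) (eu N s))
     in EN + (\<Sum>n=1..N. TT n) + SN
        \<le> C * dt * T * (lam * (LINT s:{0..T}|lborel. L2sq (surf Sig) (dtU s))
                         + 1 / lam * (LINT s:{0..T}|lborel. L2sq (surf Sig) (dtSFn s))))"
proof (intro exI[of _ 18] conjI allI impI, goal_cases)
  case 1
  show ?case by simp
next
  case 2
  then show ?case
    unfolding Let_def by (intro splitting_error_estimate[OF assms]) auto
qed

end
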